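(* Let $(M_p)_{p\in\mathbb N}$ be a sequence of positive reals with $M_0=1$ satisfying $(M.1)$ and $(M.2)$, and let $\ast$ be either $(M_p)$, in which case assume $1\prec M_p$, or $\{M_p\}$, in which case assume $1\subset M_p$. Let $(\varphi_n)_{n\in\mathbb N}$ be a mollifier sequence. Then $$\iota:\mathcal E_{2\pi}'^{\ast}\to\mathcal G_{2\pi}^{\ast},\qquad f\mapsto[(f\ast\varphi_n)_n]$$ is a (well-defined) linear embedding, i.e. an injective linear map, with the following properties: (i) $\iota$ commutes with ultradifferential operators of class $\ast$: for all ultradifferential operators $P(D)$ of class $\ast$, $$P(D)\iota(f)=\iota(P(D)f),\qquad f\in\mathcal E_{2\pi}'^{\ast}.$$ (ii) The restriction $\iota_{|\mathcal E_{2\pi}^\ast}$ coincides with the constant embedding $\sigma:\mathcal E_{2\pi}^\ast\to\mathcal G_{2\pi}^\ast$, $\sigma(f)=[(f)_n]$. Consequently, $$\iota(fg)=\iota(f)\iota(g),\qquad f,g\in\mathcal E_{2\pi}^\ast.$$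
   Context: $\mathbb N=\{0,1,2,\dots\}$, $D=-i\,d/dt$. Conditions on $(M_p)$: $(M.1)$: $M_p^2\le M_{p-1}M_{p+1}$ for $p\ge1$; $(M.2)$: there are $A,H\ge1$ with $M_{p+q}\le AH^{p+q}M_pM_q$ for all $p,q\in\mathbb N$. $1\subset M_p$ means: there are $C,h>0$ with $1\le Ch^pM_p$ for all $p$; $1\prec M_p$ means: for every $h>0$ there is $C>0$ with $1\le Ch^pM_p$ for all $p$. Associated function: $M(t)=\sup_{p\in\mathbb N}\log(t^p/M_p)$ for $t>0$, $M(0)=0$, $M(t)=M(|t|)$. (In the Roumieu case $M$ may take the value $+\infty$; then $e^{-\infty}=0$, and $0\cdot\infty=0$.) For $h>0$, $\mathcal E_{2\pi}^{M_p,h}$ is the Banach space of smooth $2\pi$-periodic $\varphi:\mathbb R\to\mathbb C$ with $\|\varphi\|_h=\sup_{p} h^p\|D^p\varphi\|_{L^\infty(\mathbb R)}/M_p<\infty$. $\mathcal E_{2\pi}^{(M_p)}=\varprojlim_{h\to\infty}\mathcal E_{2\pi}^{M_p,h}$ (intersection over all $h$) and $\mathcal E_{2\pi}^{\{M_p\}}=\varinjlim_{h\to0^+}\mathcal E_{2\pi}^{M_p,h}$ (union over all $h$, locally convex inductive limit). $\mathcal E_{2\pi}'^\ast$ is the dual of $\mathcal E_{2\pi}^\ast$; $\mathcal E_{2\pi}^\ast\subset\mathcal E_{2\pi}'^\ast$ via $\langle f,\varphi\rangle=\int_0^{2\pi}f\varphi\,dt$. For $f\in\mathcal E_{2\pi}'^\ast$,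 $g\in\mathcal E_{2\pi}^\ast$: $(f\ast g)(t)=\langle f(u),g(t-u)\rangle$. Fourier coefficients of a function: $\widehat\varphi(k)=\frac1{2\pi}\int_0^{2\pi}\varphi(t)e^{-ikt}dt$. An ultradifferential operator of class $(M_p)$ (of class $\{M_p\}$) is $P(D)=\sum_{n\ge0}a_nD^n$, where $P(z)=\sum_na_nz^n$ is entire with $|a_n|\le CL^n/M_n$ for all $n$, for some $L,C>0$ (for every $L>0$ and some $C=C_L>0$). It acts continuously on $\mathcal E_{2\pi}^\ast$, and on $\mathcal E_{2\pi}'^\ast$ by $\langle P(D)f,\varphi\rangle=\langle f,P(-D)\varphi\rangle$. Moderate sequences: $\mathcal E_{2\pi,\mathcal M}^{(M_p)}$ is the set of $(f_n)_n\in(\mathcal E_{2\pi}^{(M_p)})^{\mathbb N}$ such that $\forall h>0\,\exists\lambda>0:\ \sup_n\|f_n\|_he^{-M(\lambda n)}<\infty$; $\mathcal E_{2\pi,\mathcal M}^{\{M_p\}}$ is the set of $(f_n)_n\in(\mathcal E_{2\pi}^{\{M_p\}})^{\mathbb N}$ such that $\forall\lambda>0\,\exists h>0:\ \sup_n\|f_n\|_he^{-M(\lambda n)}<\infty$. Negligible sequences: $\mathcal E_{2\pi,\mathcal N}^{(M_p)}$: $\forall h>0\,\forall\lambda>0:\ \sup_n\|f_n\|_he^{M(\lambda n)}<\infty$; $\mathcal E_{2\pi,\mathcal N}^{\{M_p\}}$: $\exists\lambda>0\,\exists h>0:\ \sup_n\|f_n\|_he^{M(\lambda n)}<\infty$.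 $\mathcal E_{2\pi,\mathcal M}^\ast$ is an algebra under termwise operations with ideal $\mathcal E_{2\pi,\mathcal N}^\ast$, and $\mathcal G_{2\pi}^\ast=\mathcal E_{2\pi,\mathcal M}^\ast/\mathcal E_{2\pi,\mathcal N}^\ast$, with classes written $[(f_n)_n]$. Ultradifferential operators of class $\ast$ act on $\mathcal G_{2\pi}^\ast$ by $P(D)[(f_n)_n]=[(P(D)f_n)_n]$. Mollifier sequence: a sequence $(\varphi_n)_{n\in\mathbb N}$ of smooth $2\pi$-periodic functions whose Fourier coefficients $c_{k,n}=\widehat\varphi_n(k)$ satisfy: there is $C>0$ with $|c_{k,n}|\le C$ for all $k\in\mathbb Z,n\in\mathbb N$; there is $R>0$ such that for all $n$, $c_{k,n}=0$ whenever $|k|>Rn$; there is $r>0$ such that for all $n$, $c_{k,n}=\frac1{2\pi}$ whenever $|k|\le rn$. *)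

theory Defs
  imports "HOL-Analysis.Analysis" "HOL-Algebra.QuotRing"
begin

section \<open>Weight sequences\<close>

datatype ultra_class = Beurling | Roumieu

definition cond_M1 :: "(nat \<Rightarrow> real) \<Rightarrow> bool" where
  "cond_M1 M \<longleftrightarrow> (\<forall>p\<ge>1. (M p)\<^sup>2 \<le> M (p - 1) * M (p + 1))"

definition cond_M2 :: "(nat \<Rightarrow> real) \<Rightarrow> bool" where
  "cond_M2 M \<longleftrightarrow> (\<exists>A\<ge>1. \<exists>H\<ge>1. \<forall>p q. M (p + q) \<le> A * H ^ (p + q) * M p * M q)"

definition one_subset :: "(nat \<Rightarrow> real) \<Rightarrow> bool" where
  "one_subset M \<longleftrightarrow> (\<exists>C>0. \<exists>h>0. \<forall>p. 1 \<le> C * h ^ p * M p)"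

definition one_prec :: "(nat \<Rightarrow> real) \<Rightarrow> bool" where
  "one_prec M \<longleftrightarrow> (\<forall>h>0. \<exists>C>0. \<forall>p. 1 \<le> C * h ^ p * M p)"

fun cond_one :: "ultra_class \<Rightarrow> (nat \<Rightarrow> real) \<Rightarrow> bool" where
  "cond_one Beurling M = one_prec M"
| "cond_one Roumieu M = one_subset M"

definition assoc_fun :: "(nat \<Rightarrow> real) \<Rightarrow> real \<Rightarrow> ereal" where
  "assoc_fun M t = (if t = 0 then 0 else (SUP p. ereal (ln (\<bar>t\<bar> ^ p / M p))))"

text \<open>The exponential with values in \<open>[0, \<infinity>]\<close>. The product on \<^typ>\<open>ennreal\<close> satisfies
  \<open>0 * \<infinity> = 0\<close>, which is the convention used for the weights below.\<close>

definition exp_ereal :: "ereal \<Rightarrow> ennreal" where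
  "exp_ereal x = (if x = \<infinity> then \<infinity> else if x = -\<infinity> then 0 else ennreal (exp (real_of_ereal x)))"


section \<open>Periodic ultradifferentiable functions\<close>

definition Dop :: "(real \<Rightarrow> complex) \<Rightarrow> real \<Rightarrow> complex" where
  "Dop \<phi> t = - \<i> * vector_derivative \<phi> (at t)"

definition smooth_periodic :: "(real \<Rightarrow> complex) set" where
  "smooth_periodic = {\<phi>. (\<forall>p t. (Dop ^^ p) \<phi> differentiable at t) \<and> (\<forall>t. \<phi> (t + 2 * pi) = \<phi> t)}"

text \<open>The norm takes values in \<open>[0, \<infinity>]\<close>. The \<open>L\<^sup>\<infinity>\<close>-norm is a supremum, since it is only ever
  taken of continuous functions.\<close>

definition unorm :: "(nat \<Rightarrow> real) \<Rightarrow> real \<Rightarrow> (real \<Rightarrow> complex) \<Rightarrow> ennreal" where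
  "unorm M h \<phi> = (SUP p. ennreal (h ^ p / M p) * (SUP t. ennreal (cmod ((Dop ^^ p) \<phi> t))))"

definition ultra_h :: "(nat \<Rightarrow> real) \<Rightarrow> real \<Rightarrow> (real \<Rightarrow> complex) set" where
  "ultra_h M h = {\<phi> \<in> smooth_periodic. unorm M h \<phi> < \<infinity>}"

fun ultra :: "ultra_class \<Rightarrow> (nat \<Rightarrow> real) \<Rightarrow> (real \<Rightarrow> complex) set" where
  "ultra Beurling M = (\<Inter>h\<in>{0<..}. ultra_h M h)"
| "ultra Roumieu M = (\<Union>h\<in>{0<..}. ultra_h M h)"

definition norm_open_h :: "(nat \<Rightarrow> real) \<Rightarrow> real \<Rightarrow> (real \<Rightarrow> complex) set \<Rightarrow> bool" where
  "norm_open_h M h U \<longleftrightarrow> U \<subseteq> ultra_h M h \<and>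
     (\<forall>\<phi>\<in>U. \<exists>r>0. \<forall>\<psi>\<in>ultra_h M h. unorm M h (\<lambda>t. \<psi> t - \<phi> t) < ennreal r \<longrightarrow> \<psi> \<in> U)"

definition norm_topology_h :: "(nat \<Rightarrow> real) \<Rightarrow> real \<Rightarrow> (real \<Rightarrow> complex) topology" where
  "norm_topology_h M h = topology (norm_open_h M h)"

definition absolutely_convex :: "(real \<Rightarrow> complex) set \<Rightarrow> bool" where
  "absolutely_convex V \<longleftrightarrow>
     (\<forall>\<phi>\<in>V. \<forall>\<psi>\<in>V. \<forall>a b :: complex. cmod a + cmod b \<le> 1 \<longrightarrow> (\<lambda>t. a * \<phi> t + b * \<psi> t) \<in> V)"

text \<open>A base of neighbourhoods of \<open>0\<close> for the locally convex inductive limit: the absolutely convex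
  sets whose intersection with every step is a neighbourhood of \<open>0\<close> there.\<close>

definition ind_zero_nbhd :: "(nat \<Rightarrow> real) \<Rightarrow> (real \<Rightarrow> complex) set \<Rightarrow> bool" where
  "ind_zero_nbhd M V \<longleftrightarrow> V \<subseteq> ultra Roumieu M \<and> absolutely_convex V \<and>
     (\<forall>h>0. \<exists>U. openin (norm_topology_h M h) U \<and> (\<lambda>t. 0) \<in> U \<and> U \<subseteq> V)"

definition ind_open :: "(nat \<Rightarrow> real) \<Rightarrow> (real \<Rightarrow> complex) set \<Rightarrow> bool" where
  "ind_open M U \<longleftrightarrow> U \<subseteq> ultra Roumieu M \<and>
     (\<forall>\<phi>\<in>U. \<exists>V. ind_zero_nbhd M V \<and> (\<forall>\<psi>\<in>V. (\<lambda>t. \<phi> t + \<psi> t) \<in> U))"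

text \<open>Beurling case: the initial topology for the inclusions into all steps (projective limit).\<close>

fun ultra_topology :: "ultra_class \<Rightarrow> (nat \<Rightarrow> real) \<Rightarrow> (real \<Rightarrow> complex) topology" where
  "ultra_topology Beurling M = topology_generated_by
     (\<Union>h\<in>{0<..}. {U \<inter> ultra Beurling M |U. openin (norm_topology_h M h) U})"
| "ultra_topology Roumieu M = topology (ind_open M)"

text \<open>Functionals are extensional, i.e. equal to \<^const>\<open>undefined\<close> outside the test space, so that
  equality of functionals is equality on the test space.\<close>

definition ultra_dual :: "ultra_class \<Rightarrow> (nat \<Rightarrow> real) \<Rightarrow> ((real \<Rightarrow> complex) \<Rightarrow> complex) set" where
  "ultra_dual cls M = {f \<in> extensional (ultra cls M).
     (\<forall>\<phi>\<in>ultra cls M. \<forall>\<psi>\<in>ultra cls M. f (\<lambda>t. \<phi> t + \<psi> t) = f \<phi> + f \<psi>) \<and>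
     (\<forall>c. \<forall>\<phi>\<in>ultra cls M. f (\<lambda>t. c * \<phi> t) = c * f \<phi>) \<and>
     continuous_map (ultra_topology cls M) euclidean f}"

definition dual_add :: "ultra_class \<Rightarrow> (nat \<Rightarrow> real) \<Rightarrow> ((real \<Rightarrow> complex) \<Rightarrow> complex)
    \<Rightarrow> ((real \<Rightarrow> complex) \<Rightarrow> complex) \<Rightarrow> (real \<Rightarrow> complex) \<Rightarrow> complex" where
  "dual_add cls M f g = (\<lambda>\<phi>\<in>ultra cls M. f \<phi> + g \<phi>)"

definition dual_smult :: "ultra_class \<Rightarrow> (nat \<Rightarrow> real) \<Rightarrow> complex
    \<Rightarrow> ((real \<Rightarrow> complex) \<Rightarrow> complex) \<Rightarrow> (real \<Rightarrow> complex) \<Rightarrow> complex" where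
  "dual_smult cls M c f = (\<lambda>\<phi>\<in>ultra cls M. c * f \<phi>)"

definition dual_embed :: "ultra_class \<Rightarrow> (nat \<Rightarrow> real) \<Rightarrow> (real \<Rightarrow> complex)
    \<Rightarrow> (real \<Rightarrow> complex) \<Rightarrow> complex" where
  "dual_embed cls M f = (\<lambda>\<phi>\<in>ultra cls M. integral {0..2 * pi} (\<lambda>t. f t * \<phi> t))"

definition conv :: "((real \<Rightarrow> complex) \<Rightarrow> complex) \<Rightarrow> (real \<Rightarrow> complex) \<Rightarrow> real \<Rightarrow> complex" where
  "conv f g t = f (\<lambda>u. g (t - u))"

definition fourier_coeff :: "(real \<Rightarrow> complex) \<Rightarrow> int \<Rightarrow> complex" where
  "fourier_coeff \<phi> k = integral {0..2 * pi} (\<lambda>t. \<phi> t * cis (- (of_int k * t))) / (2 * pi)"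


section \<open>Ultradifferential operators\<close>

text \<open>An operator is represented by its coefficient sequence.\<close>

definition ultradiff_coeffs :: "ultra_class \<Rightarrow> (nat \<Rightarrow> real) \<Rightarrow> (nat \<Rightarrow> complex) \<Rightarrow> bool" where
  "ultradiff_coeffs cls M a \<longleftrightarrow> (\<forall>z. summable (\<lambda>n. a n * z ^ n)) \<and>
     (case cls of
        Beurling \<Rightarrow> \<exists>L>0. \<exists>C>0. \<forall>n. cmod (a n) \<le> C * L ^ n / M n
      | Roumieu \<Rightarrow> \<forall>L>0. \<exists>C>0. \<forall>n. cmod (a n) \<le> C * L ^ n / M n)"

definition ultradiff :: "(nat \<Rightarrow> complex) \<Rightarrow> (real \<Rightarrow> complex) \<Rightarrow> real \<Rightarrow> complex" where
  "ultradiff a \<phi> t = (\<Sum>n. a n * (Dop ^^ n) \<phi> t)"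

definition dual_ultradiff :: "ultra_class \<Rightarrow> (nat \<Rightarrow> real) \<Rightarrow> (nat \<Rightarrow> complex)
    \<Rightarrow> ((real \<Rightarrow> complex) \<Rightarrow> complex) \<Rightarrow> (real \<Rightarrow> complex) \<Rightarrow> complex" where
  "dual_ultradiff cls M a f = (\<lambda>\<phi>\<in>ultra cls M. f (ultradiff (\<lambda>n. (-1) ^ n * a n) \<phi>))"


section \<open>The algebra of generalized functions\<close>

definition moderate :: "ultra_class \<Rightarrow> (nat \<Rightarrow> real) \<Rightarrow> (nat \<Rightarrow> real \<Rightarrow> complex) set" where
  "moderate cls M = {f. (\<forall>n. f n \<in> ultra cls M) \<and>
     (case cls of
        Beurling \<Rightarrow> \<forall>h>0. \<exists>\<mu>>0.
          (SUP n. unorm M h (f n) * exp_ereal (- assoc_fun M (\<mu> * real n))) < \<infinity>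
      | Roumieu \<Rightarrow> \<forall>\<mu>>0. \<exists>h>0.
          (SUP n. unorm M h (f n) * exp_ereal (- assoc_fun M (\<mu> * real n))) < \<infinity>)}"

definition negligible_seqs :: "ultra_class \<Rightarrow> (nat \<Rightarrow> real) \<Rightarrow> (nat \<Rightarrow> real \<Rightarrow> complex) set" where
  "negligible_seqs cls M = {f. (\<forall>n. f n \<in> ultra cls M) \<and>
     (case cls of
        Beurling \<Rightarrow> \<forall>h>0. \<forall>\<mu>>0.
          (SUP n. unorm M h (f n) * exp_ereal (assoc_fun M (\<mu> * real n))) < \<infinity>
      | Roumieu \<Rightarrow> \<exists>\<mu>>0. \<exists>h>0.
          (SUP n. unorm M h (f n) * exp_ereal (assoc_fun M (\<mu> * real n))) < \<infinity>)}"

definition moderate_ring :: "ultra_class \<Rightarrow> (nat \<Rightarrow> real) \<Rightarrow> (nat \<Rightarrow> real \<Rightarrow> complex) ring" where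
  "moderate_ring cls M =
     \<lparr>carrier = moderate cls M, mult = (\<lambda>f g n t. f n t * g n t), one = (\<lambda>n t. 1),
      zero = (\<lambda>n t. 0), add = (\<lambda>f g n t. f n t + g n t)\<rparr>"

definition gen_alg :: "ultra_class \<Rightarrow> (nat \<Rightarrow> real) \<Rightarrow> (nat \<Rightarrow> real \<Rightarrow> complex) set ring" where
  "gen_alg cls M = moderate_ring cls M Quot negligible_seqs cls M"

definition gen_class :: "ultra_class \<Rightarrow> (nat \<Rightarrow> real) \<Rightarrow> (nat \<Rightarrow> real \<Rightarrow> complex)
    \<Rightarrow> (nat \<Rightarrow> real \<Rightarrow> complex) set" where
  "gen_class cls M f = negligible_seqs cls M +>\<^bsub>moderate_ring cls M\<^esub> f"

text \<open>The map induced on classes by a map applied to each term of a sequence. As for the library's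
  multiplication of cosets, the union runs over all representatives, so it is a single class exactly
  when the result does not depend on the representative.\<close>

definition gen_lift :: "ultra_class \<Rightarrow> (nat \<Rightarrow> real) \<Rightarrow> ((real \<Rightarrow> complex) \<Rightarrow> real \<Rightarrow> complex)
    \<Rightarrow> (nat \<Rightarrow> real \<Rightarrow> complex) set \<Rightarrow> (nat \<Rightarrow> real \<Rightarrow> complex) set" where
  "gen_lift cls M T A = (\<Union>f\<in>A. gen_class cls M (\<lambda>n. T (f n)))"

definition gen_smult :: "ultra_class \<Rightarrow> (nat \<Rightarrow> real) \<Rightarrow> complex
    \<Rightarrow> (nat \<Rightarrow> real \<Rightarrow> complex) set \<Rightarrow> (nat \<Rightarrow> real \<Rightarrow> complex) set" where
  "gen_smult cls M c = gen_lift cls M (\<lambda>\<phi> t. c * \<phi> t)"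

definition gen_ultradiff :: "ultra_class \<Rightarrow> (nat \<Rightarrow> real) \<Rightarrow> (nat \<Rightarrow> complex)
    \<Rightarrow> (nat \<Rightarrow> real \<Rightarrow> complex) set \<Rightarrow> (nat \<Rightarrow> real \<Rightarrow> complex) set" where
  "gen_ultradiff cls M a = gen_lift cls M (ultradiff a)"

definition mollifier :: "(nat \<Rightarrow> real \<Rightarrow> complex) \<Rightarrow> bool" where
  "mollifier \<phi> \<longleftrightarrow> (\<forall>n. \<phi> n \<in> smooth_periodic) \<and>
     (\<exists>C>0. \<forall>k n. cmod (fourier_coeff (\<phi> n) k) \<le> C) \<and>
     (\<exists>R>0. \<forall>n k. \<bar>of_int k\<bar> > R * real n \<longrightarrow> fourier_coeff (\<phi> n) k = 0) \<and>
     (\<exists>r>0. \<forall>n k. \<bar>of_int k\<bar> \<le> r * real n \<longrightarrow> fourier_coeff (\<phi> n) k = 1 / (2 * pi))"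

definition gen_iota :: "ultra_class \<Rightarrow> (nat \<Rightarrow> real) \<Rightarrow> (nat \<Rightarrow> real \<Rightarrow> complex)
    \<Rightarrow> ((real \<Rightarrow> complex) \<Rightarrow> complex) \<Rightarrow> (nat \<Rightarrow> real \<Rightarrow> complex) set" where
  "gen_iota cls M \<phi> f = gen_class cls M (\<lambda>n. conv f (\<phi> n))"

definition gen_sigma :: "ultra_class \<Rightarrow> (nat \<Rightarrow> real) \<Rightarrow> (real \<Rightarrow> complex)
    \<Rightarrow> (nat \<Rightarrow> real \<Rightarrow> complex) set" where
  "gen_sigma cls M f = gen_class cls M (\<lambda>n. f)"


section \<open>The norm and inductive limit topologies are well defined\<close>

lemma istopology_norm_open_h: "istopology (norm_open_h M h)"
  unfolding istopology_def
proof (intro conjI allI impI)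
  fix S T assume S: "norm_open_h M h S" and T: "norm_open_h M h T"
  show "norm_open_h M h (S \<inter> T)"
    unfolding norm_open_h_def
  proof (intro conjI ballI)
    show "S \<inter> T \<subseteq> ultra_h M h" using S by (auto simp: norm_open_h_def)
    fix \<phi> assume \<phi>: "\<phi> \<in> S \<inter> T"
    obtain r where r: "r > 0"
      "\<forall>\<psi>\<in>ultra_h M h. unorm M h (\<lambda>t. \<psi> t - \<phi> t) < ennreal r \<longrightarrow> \<psi> \<in> S"
      using S \<phi> unfolding norm_open_h_def by blast
    obtain s where s: "s > 0"
      "\<forall>\<psi>\<in>ultra_h M h. unorm M h (\<lambda>t. \<psi> t - \<phi> t) < ennreal s \<longrightarrow> \<psi> \<in> T"
      using T \<phi> unfolding norm_open_h_def by blast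
    have "x < ennreal r \<and> x < ennreal s" if "x < ennreal (min r s)" for x
      using less_le_trans[OF that ennreal_leI] by simp
    with r s show "\<exists>r>0. \<forall>\<psi>\<in>ultra_h M h. unorm M h (\<lambda>t. \<psi> t - \<phi> t) < ennreal r \<longrightarrow> \<psi> \<in> S \<inter> T"
      by (intro exI[of _ "min r s"]) auto
  qed
next
  fix K assume "\<forall>S\<in>K. norm_open_h M h S"
  then show "norm_open_h M h (\<Union>K)"
    unfolding norm_open_h_def by (smt (verit) Union_iff Union_least)
qed

lemma istopology_ind_open: "istopology (ind_open M)"
proof -
  have nbhd_Int: "ind_zero_nbhd M (V \<inter> W)" if "ind_zero_nbhd M V" "ind_zero_nbhd M W" for V W
    unfolding ind_zero_nbhd_def
  proof (intro conjI allI impI)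
    show "V \<inter> W \<subseteq> ultra Roumieu M" using that by (auto simp: ind_zero_nbhd_def)
    show "absolutely_convex (V \<inter> W)"
      using that by (auto simp: ind_zero_nbhd_def absolutely_convex_def)
    fix h :: real assume "h > 0"
    then have "\<exists>A. openin (norm_topology_h M h) A \<and> (\<lambda>t. 0) \<in> A \<and> A \<subseteq> V"
      "\<exists>B. openin (norm_topology_h M h) B \<and> (\<lambda>t. 0) \<in> B \<and> B \<subseteq> W"
      using that by (simp_all add: ind_zero_nbhd_def)
    then obtain A B where "openin (norm_topology_h M h) A" "(\<lambda>t. 0) \<in> A" "A \<subseteq> V"
      "openin (norm_topology_h M h) B" "(\<lambda>t. 0) \<in> B" "B \<subseteq> W"
      by blast
    then show "\<exists>U. openin (norm_topology_h M h) U \<and> (\<lambda>t. 0) \<in> U \<and> U \<subseteq> V \<inter> W"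
      by (intro exI[of _ "A \<inter> B"]) auto
  qed
  show ?thesis
    unfolding istopology_def
  proof (intro conjI allI impI)
    fix S T assume S: "ind_open M S" and T: "ind_open M T"
    show "ind_open M (S \<inter> T)"
      unfolding ind_open_def
    proof (intro conjI ballI)
      show "S \<inter> T \<subseteq> ultra Roumieu M" using S by (auto simp: ind_open_def)
      fix \<phi> assume "\<phi> \<in> S \<inter> T"
      then obtain V W where "ind_zero_nbhd M V" "\<forall>\<psi>\<in>V. (\<lambda>t. \<phi> t + \<psi> t) \<in> S"
        "ind_zero_nbhd M W" "\<forall>\<psi>\<in>W. (\<lambda>t. \<phi> t + \<psi> t) \<in> T"
        using S T unfolding ind_open_def by (metis IntE)
      then show "\<exists>V. ind_zero_nbhd M V \<and> (\<forall>\<psi>\<in>V. (\<lambda>t. \<phi> t + \<psi> t) \<in> S \<inter> T)"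
        by (intro exI[of _ "V \<inter> W"]) (auto simp: nbhd_Int)
    qed
  next
    fix K assume "\<forall>S\<in>K. ind_open M S"
    then show "ind_open M (\<Union>K)"
      unfolding ind_open_def by (smt (verit) Union_iff Union_least)
  qed
qed

end

theory Submission
  imports Defs "HOL-Real_Asymp.Real_Asymp"
begin

text \<open>Everything is read off Fourier coefficients. Write \<open>w(t) = sup\<^sub>p |t|\<^sup>p / M\<^sub>p\<close> for the
  exponential of the associated function. The norm \<open>\<parallel>f\<parallel>\<^sub>h\<close> dominates \<open>|c\<^sub>k| w(hk)\<close> for every Fourier
  coefficient \<open>c\<^sub>k\<close> of \<open>f\<close> and is dominated by the sum of these quantities over \<open>k\<close>; since (M.2) gives
  \<open>w(t)\<^sup>2 \<le> A w(Ht)\<close> and \<open>w(t) \<ge> t\<^sup>2 / M\<^sub>2\<close>, the two bounds differ only by a change of \<open>h\<close>.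
  The regularization \<open>f * \<phi>\<^sub>n\<close> is the trigonometric polynomial with coefficients
  \<open>c\<^sub>k\<^sub>,\<^sub>n f(e\<^sub>-\<^sub>k)\<close>: it has frequencies at most \<open>Rn\<close>, which gives moderateness, and for a function \<open>f\<close>
  it differs from \<open>f\<close> only in frequencies above \<open>rn\<close>, where the decay of the coefficients turns into
  the factor \<open>1 / w(\<mu>n)\<close>. Letting \<open>n\<close> tend to infinity at a fixed frequency recovers
  \<open>f(e\<^sub>-\<^sub>k)\<close> from the class, and a continuous functional is determined by these values.\<close>

section \<open>Smooth functions\<close>

text \<open>In the Roumieu case \<open>weight\<close> may be infinite, so weighted estimates live in
  \<open>ennreal\<close>, where a factor cannot simply be divided out: \<open>x * w \<le> Y\<close>
  gives \<open>x \<le> Y * inverse w\<close> only for finite \<open>Y\<close> and nonzero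
  \<open>w\<close>. Series over the frequencies appear as suprema of symmetric partial sums.

  Each summation over the frequencies is bought with a factor H in the scale: of two factors w(hk)
  one is kept and the other is turned into its summable inverse. Beurling spaces quantify
  universally over scales and Roumieu spaces existentially; rescaling by a constant respects both,
  which is what \<open>for_scale\<close> isolates.

  Regularization evaluates a functional on finitely many exponentials only. Hence regularizations
  are compared under the weak notion \<open>trig_linear\<close>, which \<open>dual_embed\<close> and
  \<open>dual_ultradiff\<close> satisfy by direct computation. Continuity of functionals is used for
  moderateness and for injectivity, in the form of a norm estimate at some scale (Beurling) or at
  every scale (Roumieu).\<close>

definition smooth_fun :: "(real \<Rightarrow> complex) \<Rightarrow> bool" where
  "smooth_fun f \<longleftrightarrow> (\<forall>p t. (Dop ^^ p) f differentiable at t)"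

definition periodic :: "(real \<Rightarrow> complex) \<Rightarrow> bool" where
  "periodic f \<longleftrightarrow> (\<forall>t. f (t + 2 * pi) = f t)"

lemma smooth_periodic_iff: "f \<in> smooth_periodic \<longleftrightarrow> smooth_fun f \<and> periodic f"
  by (simp add: smooth_periodic_def smooth_fun_def periodic_def)

lemma Dop_eqI: "(f has_vector_derivative \<i> * z) (at t) \<Longrightarrow> Dop f t = z"
  by (simp add: Dop_def vector_derivative_at)

text \<open>The factor \<open>\<i>\<close> cancels the one in D = -i d/dt, so a family linked in
  this way consists of the iterates of \<open>Dop\<close> on its first member. Exhibiting such a
  family yields smoothness and the formula for D^p at once; exponentials, products and operator
  series are all treated so.\<close>

lemma Dop_funpow_family:
  assumes "\<And>p t. (G p has_vector_derivative \<i> * G (Suc p) t) (at t)"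
  shows "(Dop ^^ p) (G 0) = G p" "smooth_fun (G 0)"
proof -
  have *: "(Dop ^^ p) (G 0) = G p" for p
    by (induction p) (use assms in \<open>auto intro!: Dop_eqI ext\<close>)
  show "(Dop ^^ p) (G 0) = G p" by (rule *)
  show "smooth_fun (G 0)"
    using assms unfolding smooth_fun_def * by (auto intro: differentiableI_vector)
qed

text \<open>Prepares the L'Hospital step in Chernoff's argument, where two difference quotients are
  divided by each other.\<close>

lemma has_vector_derivative_quotient_tendsto:
  fixes f :: "real \<Rightarrow> 'a::real_normed_vector"
  assumes "(f has_vector_derivative v) (at s)"
  shows "(\<lambda>u. (f u - f s) /\<^sub>R (u - s)) \<midarrow>s\<rightarrow> v"
proof (rule LIM_zero_cancel, rule tendsto_norm_zero_cancel)
  have "(\<lambda>u. norm ((1 / norm (u - s)) *\<^sub>R (f u - (f s + (u - s) *\<^sub>R v)))) \<midarrow>s\<rightarrow> 0"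
    using assms unfolding has_vector_derivative_def has_derivative_at2
    by (intro tendsto_norm_zero) blast
  moreover have "norm ((1 / norm (u - s)) *\<^sub>R (f u - (f s + (u - s) *\<^sub>R v)))
      = norm ((f u - f s) /\<^sub>R (u - s) - v)" if "u \<noteq> s" for u
  proof -
    have "(f u - f s) /\<^sub>R (u - s) - v = (f u - (f s + (u - s) *\<^sub>R v)) /\<^sub>R (u - s)"
      using that by (simp add: diff_diff_add[symmetric] scaleR_diff_right)
    then show ?thesis by (simp add: divide_inverse)
  qed
  ultimately show "(\<lambda>u. norm ((f u - f s) /\<^sub>R (u - s) - v)) \<midarrow>s\<rightarrow> 0"
    by (subst LIM_cong[OF refl _ refl]) auto
qed

lemma smooth_fun_deriv:
  assumes "smooth_fun f"
  shows "((Dop ^^ p) f has_vector_derivative \<i> * (Dop ^^ Suc p) f t) (at t)"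
  using assms by (simp add: smooth_fun_def Dop_def vector_derivative_works[symmetric] algebra_simps
      flip: mult.assoc)

lemma smooth_fun_deriv0:
  assumes "smooth_fun f"
  shows "(f has_vector_derivative \<i> * Dop f t) (at t)"
  using smooth_fun_deriv[OF assms, of 0] by simp

lemma smooth_fun_continuous: "smooth_fun f \<Longrightarrow> continuous_on S ((Dop ^^ p) f)"
  by (meson continuous_at_imp_continuous_on has_vector_derivative_continuous smooth_fun_deriv)

lemma smooth_fun_continuous0: "smooth_fun f \<Longrightarrow> continuous_on S f"
  using smooth_fun_continuous[of f S 0] by simp

lemma smooth_fun_Dop_funpow: "smooth_fun f \<Longrightarrow> smooth_fun ((Dop ^^ p) f)"
  unfolding smooth_fun_def by (metis comp_apply funpow_add)

lemma smooth_fun_const: "smooth_fun (\<lambda>t. c)"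
  and Dop_funpow_zero: "(Dop ^^ p) (\<lambda>t. 0) = (\<lambda>t. 0)"
proof -
  let ?G = "\<lambda>(p::nat) (t::real). if p = 0 then c else 0"
  have "(?G p has_vector_derivative \<i> * ?G (Suc p) t) (at t)" for p t by simp
  from Dop_funpow_family(2)[of ?G, OF this] show "smooth_fun (\<lambda>t. c)" by simp
  show "(Dop ^^ p) (\<lambda>t. 0) = (\<lambda>t. 0)"
    using Dop_funpow_family(1)[of "\<lambda>p t. 0"] by simp
qed

lemma
  assumes "smooth_fun f" "smooth_fun g"
  shows smooth_fun_lincomb: "smooth_fun (\<lambda>t. a * f t + b * g t)"
    and Dop_funpow_lincomb:
      "(Dop ^^ p) (\<lambda>t. a * f t + b * g t) = (\<lambda>t. a * (Dop ^^ p) f t + b * (Dop ^^ p) g t)"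
proof -
  let ?G = "\<lambda>p t. a * (Dop ^^ p) f t + b * (Dop ^^ p) g t"
  have *: "(?G p has_vector_derivative \<i> * ?G (Suc p) t) (at t)" for p t
    by (rule derivative_eq_intros smooth_fun_deriv assms refl)+ (simp add: algebra_simps)
  from Dop_funpow_family[of ?G, OF this]
  show "smooth_fun (\<lambda>t. a * f t + b * g t)"
    "(Dop ^^ p) (\<lambda>t. a * f t + b * g t) = (\<lambda>t. a * (Dop ^^ p) f t + b * (Dop ^^ p) g t)"
    by simp_all
qed

text \<open>\<open>vector_derivative\<close> is picked from the relation
  \<open>has_vector_derivative\<close> alone, so it is enough that this relation is invariant under
  the shift by a period; the chain rule gives both directions.\<close>

lemma periodic_Dop: "periodic f \<Longrightarrow> periodic (Dop f)"
proof -
  assume f: "periodic f"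
  have "(f has_vector_derivative v) (at (t + 2 * pi)) \<longleftrightarrow> (f has_vector_derivative v) (at t)" for v t
  proof -
    have sh: "((\<lambda>x. x + c) has_real_derivative 1) (at x)" for c x :: real
      by (auto intro!: derivative_eq_intros)
    have fp: "f \<circ> (\<lambda>x. x + 2 * pi) = f"
      using f by (auto simp: periodic_def fun_eq_iff)
    then have fm: "f \<circ> (\<lambda>x. x + - 2 * pi) = f"
      by (auto simp: fun_eq_iff) (metis diff_add_cancel)
    have "(f has_vector_derivative v) (at t)" if "(f has_vector_derivative v) (at (t + 2 * pi))"
      using vector_diff_chain_at[OF sh[of "2*pi", unfolded has_real_derivative_iff_has_vector_derivative] that]
      unfolding fp by simp
    moreover have "(f has_vector_derivative v) (at (t + 2 * pi))" if "(f has_vector_derivative v) (at t)"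
      using vector_diff_chain_at[of "\<lambda>x. x + - 2*pi" _ "t + 2 * pi",
          OF sh[unfolded has_real_derivative_iff_has_vector_derivative], of f v] that
      unfolding fm by simp
    ultimately show ?thesis by blast
  qed
  then show "periodic (Dop f)"
    by (simp add: periodic_def Dop_def vector_derivative_def)
qed

lemma periodic_Dop_funpow: "periodic f \<Longrightarrow> periodic ((Dop ^^ p) f)"
  by (induction p) (auto intro: periodic_Dop)

lemma smooth_periodic_Dop_funpow: "f \<in> smooth_periodic \<Longrightarrow> (Dop ^^ p) f \<in> smooth_periodic"
  by (simp add: smooth_periodic_iff smooth_fun_Dop_funpow periodic_Dop_funpow)

lemma smooth_periodic_const: "(\<lambda>t. c) \<in> smooth_periodic"
  by (simp add: smooth_periodic_iff smooth_fun_const periodic_def)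

lemma smooth_periodic_lincomb:
  "f \<in> smooth_periodic \<Longrightarrow> g \<in> smooth_periodic \<Longrightarrow> (\<lambda>t. a * f t + b * g t) \<in> smooth_periodic"
  by (simp add: smooth_periodic_iff smooth_fun_lincomb periodic_def)

lemma periodic_int:
  assumes "periodic f"
  shows "f (t + 2 * pi * of_int m) = f t"
proof -
  have nat: "f (t + 2 * pi * real n) = f t" for n t
  proof (induction n)
    case (Suc n)
    have "f (t + 2 * pi * real (Suc n)) = f ((t + 2 * pi * real n) + 2 * pi)"
      by (simp add: algebra_simps)
    then show ?case using Suc assms by (simp add: periodic_def)
  qed simp
  show ?thesis
  proof (cases "m \<ge> 0")
    case True then show ?thesis using nat[of t "nat m"] by simp
  next
    case False then show ?thesis using nat[of "t + 2 * pi * of_int m" "nat (-m)"] by simp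
  qed
qed

text \<open>The Leibniz rule in unexpanded form: \<open>D\<^sup>p (D\<^sup>i f \<cdot> D\<^sup>j g)\<close>. The recursion makes the factor
  \<open>2\<^sup>p\<close> of the product estimate visible without binomial coefficients.\<close>

fun leibniz :: "(real \<Rightarrow> complex) \<Rightarrow> (real \<Rightarrow> complex) \<Rightarrow> nat \<Rightarrow> nat \<Rightarrow> nat \<Rightarrow> real \<Rightarrow> complex" where
  "leibniz f g 0 i j t = (Dop ^^ i) f t * (Dop ^^ j) g t"
| "leibniz f g (Suc p) i j t = leibniz f g p (Suc i) j t + leibniz f g p i (Suc j) t"

lemma leibniz_deriv:
  assumes "smooth_fun f" "smooth_fun g"
  shows "(leibniz f g p i j has_vector_derivative \<i> * leibniz f g (Suc p) i j t) (at t)"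
proof (induction p arbitrary: i j)
  case 0
  have "((\<lambda>t. (Dop ^^ i) f t * (Dop ^^ j) g t) has_vector_derivative
      \<i> * leibniz f g (Suc 0) i j t) (at t)"
    by (rule derivative_eq_intros smooth_fun_deriv assms refl)+ (simp add: algebra_simps)
  then show ?case by (simp add: fun_eq_iff[symmetric])
next
  case (Suc p)
  have "((\<lambda>t. leibniz f g p (Suc i) j t + leibniz f g p i (Suc j) t) has_vector_derivative
      \<i> * leibniz f g (Suc (Suc p)) i j t) (at t)"
    by (rule derivative_eq_intros Suc refl)+ (simp add: algebra_simps)
  then show ?case by (simp add: fun_eq_iff[symmetric])
qed

lemma
  assumes "smooth_fun f" "smooth_fun g"
  shows smooth_fun_mult: "smooth_fun (\<lambda>t. f t * g t)"
    and Dop_funpow_mult: "(Dop ^^ p) (\<lambda>t. f t * g t) = leibniz f g p 0 0"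
proof -
  have *: "leibniz f g 0 0 0 = (\<lambda>t. f t * g t)" by (simp add: fun_eq_iff)
  show "smooth_fun (\<lambda>t. f t * g t)" "(Dop ^^ p) (\<lambda>t. f t * g t) = leibniz f g p 0 0"
    using Dop_funpow_family[of "\<lambda>p. leibniz f g p 0 0", OF leibniz_deriv[OF assms]]
    unfolding * by simp_all
qed

text \<open>The total order \<open>p + i + j\<close> is the same for both summands of the recursion,
  so a bound that depends on the total order only doubles at each step.\<close>

lemma leibniz_bound:
  assumes "\<And>i j. cmod ((Dop ^^ i) f t) * cmod ((Dop ^^ j) g t) \<le> K (i + j)"
  shows "cmod (leibniz f g p i j t) \<le> 2 ^ p * K (p + i + j)"
proof (induction p arbitrary: i j)
  case 0 then show ?case using assms by (simp add: norm_mult)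
next
  case (Suc p)
  show ?case
    using norm_triangle_ineq[of "leibniz f g p (Suc i) j t" "leibniz f g p i (Suc j) t"]
      Suc[of "Suc i" j] Suc[of i "Suc j"] by (simp add: algebra_simps)
qed


section \<open>Fourier series of smooth periodic functions\<close>

definition echar :: "int \<Rightarrow> real \<Rightarrow> complex" where
  "echar k t = cis (of_int k * t)"

lemma norm_echar [simp]: "cmod (echar k t) = 1"
  by (simp add: echar_def)

lemma echar_mult: "echar j t * echar k t = echar (j + k) t"
  by (simp add: echar_def cis_mult algebra_simps)

lemma echar_0 [simp]: "echar 0 t = 1"
  by (simp add: echar_def)

lemma echar_diff: "echar k (t - u) = echar k t * echar (- k) u"
  by (simp add: echar_def cis_mult algebra_simps)

lemma cnj_echar: "cnj (echar k t) = echar (- k) t"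
  by (simp add: echar_def cis_cnj)

lemma echar_deriv [derivative_intros]:
  "(echar k has_vector_derivative \<i> * (of_int k * echar k t)) (at t within S)"
  unfolding echar_def has_vector_derivative_def
  by (auto intro!: derivative_eq_intros simp: fun_eq_iff scaleR_conv_of_real)

lemma continuous_on_echar [continuous_intros]: "continuous_on S (echar k)"
  by (rule continuous_on_vector_derivative) (rule echar_deriv)

lemma
  shows smooth_fun_echar: "smooth_fun (echar k)"
    and Dop_funpow_echar: "(Dop ^^ p) (echar k) = (\<lambda>t. of_int k ^ p * echar k t)"
proof -
  let ?G = "\<lambda>p t. of_int k ^ p * echar k t"
  have *: "(?G p has_vector_derivative \<i> * ?G (Suc p) t) (at t)" for p t
    by (rule derivative_eq_intros refl)+ (simp add: algebra_simps)
  have eq: "?G 0 = echar k" by (simp add: fun_eq_iff)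
  from Dop_funpow_family[of ?G, OF *] show "smooth_fun (echar k)"
    "(Dop ^^ p) (echar k) = (\<lambda>t. of_int k ^ p * echar k t)"
    unfolding eq by simp_all
qed

lemma periodic_echar: "periodic (echar k)"
proof -
  have "echar k (t + 2 * pi) = echar k t * cis (2 * pi * of_int k)" for t
    by (simp add: echar_def cis_mult algebra_simps)
  then show ?thesis by (simp add: periodic_def cis_multiple_2pi)
qed

lemma smooth_periodic_echar: "echar k \<in> smooth_periodic"
  by (simp add: smooth_periodic_iff smooth_fun_echar periodic_echar)

lemma integral_echar: "integral {0..2*pi} (echar k) = (if k = 0 then 2 * pi else 0)"
proof (cases "k = 0")
  case True
  then have "echar k = (\<lambda>t. 1)" by (simp add: fun_eq_iff)
  then show ?thesis using True by (simp add: scaleR_conv_of_real)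
next
  case False
  have "(echar k has_integral (echar k (2*pi) / (\<i> * of_int k) - echar k 0 / (\<i> * of_int k))) {0..2*pi}"
    by (rule fundamental_theorem_of_calculus)
       (use False in \<open>auto intro!: derivative_eq_intros\<close>)
  moreover have "echar k (2*pi) = echar k 0"
    using periodic_echar[of k] unfolding periodic_def by (metis add_0)
  ultimately show ?thesis using False by (simp add: integral_unique)
qed

lemma fourier_coeff_eq: "fourier_coeff f k = integral {0..2*pi} (\<lambda>t. f t * echar (-k) t) / (2 * pi)"
  by (simp add: fourier_coeff_def echar_def)

lemma fourier_coeff_lincomb:
  assumes "continuous_on {0..2*pi} f" "continuous_on {0..2*pi} g"
  shows "fourier_coeff (\<lambda>t. a * f t + b * g t) k = a * fourier_coeff f k + b * fourier_coeff g k"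
proof -
  have i: "(\<lambda>t. h t * echar (-k) t) integrable_on {0..2*pi}" if "continuous_on {0..2*pi} h" for h
    using that by (intro integrable_continuous_interval continuous_intros)
  have "integral {0..2*pi} (\<lambda>t. (a * f t + b * g t) * echar (-k) t)
      = integral {0..2*pi} (\<lambda>t. a * (f t * echar (-k) t) + b * (g t * echar (-k) t))"
    by (simp add: algebra_simps)
  also have "\<dots> = a * integral {0..2*pi} (\<lambda>t. f t * echar (-k) t)
      + b * integral {0..2*pi} (\<lambda>t. g t * echar (-k) t)"
    using i[OF assms(1)] i[OF assms(2)]
    by (subst Henstock_Kurzweil_Integration.integral_add) (auto intro: integrable_on_mult_right)
  finally show ?thesis by (simp add: fourier_coeff_eq add_divide_distrib)
qed

lemma fourier_coeff_echar: "fourier_coeff (echar j) k = (if j = k then 1 else 0)"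
  by (auto simp: fourier_coeff_eq echar_mult integral_echar)

lemma
  assumes "finite K"
  shows fourier_coeff_trig_poly: "fourier_coeff (\<lambda>t. \<Sum>j\<in>K. d j * echar j t) k = (if k \<in> K then d k else 0)"
    and smooth_periodic_trig_poly: "(\<lambda>t. \<Sum>j\<in>K. d j * echar j t) \<in> smooth_periodic"
    and Dop_funpow_trig_poly: "(Dop ^^ p) (\<lambda>t. \<Sum>j\<in>K. d j * echar j t)
      = (\<lambda>t. \<Sum>j\<in>K. of_int j ^ p * d j * echar j t)"
proof -
  have "fourier_coeff (\<lambda>t. \<Sum>j\<in>K. d j * echar j t) k = (if k \<in> K then d k else 0)
    \<and> (\<lambda>t. \<Sum>j\<in>K. d j * echar j t) \<in> smooth_periodic
    \<and> (Dop ^^ p) (\<lambda>t. \<Sum>j\<in>K. d j * echar j t) = (\<lambda>t. \<Sum>j\<in>K. of_int j ^ p * d j * echar j t)"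
    using assms
  proof (induction K)
    case empty
    show ?case by (simp add: fourier_coeff_def smooth_periodic_const Dop_funpow_zero)
  next
    case (insert x K)
    let ?S = "\<lambda>t. \<Sum>j\<in>K. d j * echar j t"
    have eq: "(\<lambda>t. \<Sum>j\<in>insert x K. d j * echar j t) = (\<lambda>t. d x * echar x t + 1 * ?S t)"
      using insert by simp
    have S: "?S \<in> smooth_periodic" using insert by blast
    have S': "smooth_fun ?S" "continuous_on {0..2*pi} ?S"
      using S by (auto simp: smooth_periodic_iff smooth_fun_continuous0)
    show ?case unfolding eq
      using insert smooth_periodic_lincomb[OF smooth_periodic_echar[of x] S, of "d x" 1]
      by (subst fourier_coeff_lincomb[OF continuous_on_echar S'(2)],
          subst Dop_funpow_lincomb[OF smooth_fun_echar S'(1)])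
        (auto simp: fourier_coeff_echar Dop_funpow_echar algebra_simps fun_eq_iff)
  qed
  then show "fourier_coeff (\<lambda>t. \<Sum>j\<in>K. d j * echar j t) k = (if k \<in> K then d k else 0)"
    "(\<lambda>t. \<Sum>j\<in>K. d j * echar j t) \<in> smooth_periodic"
    "(Dop ^^ p) (\<lambda>t. \<Sum>j\<in>K. d j * echar j t) = (\<lambda>t. \<Sum>j\<in>K. of_int j ^ p * d j * echar j t)"
    by blast+
qed

lemma norm_fourier_coeff_le:
  assumes "continuous_on {0..2*pi} f" "\<And>t. t \<in> {0..2*pi} \<Longrightarrow> cmod (f t) \<le> B"
  shows "cmod (fourier_coeff f k) \<le> B"
proof -
  have "cmod (integral {0..2*pi} (\<lambda>t. f t * echar (-k) t)) \<le> B * (2 * pi - 0)"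
    using assms by (intro integral_bound) (auto intro!: continuous_intros simp: norm_mult)
  then show ?thesis by (simp add: fourier_coeff_eq norm_divide norm_mult field_simps)
qed

text \<open>Integration by parts; the boundary terms cancel by periodicity.\<close>

lemma fourier_coeff_Dop:
  assumes "f \<in> smooth_periodic"
  shows "fourier_coeff (Dop f) k = of_int k * fourier_coeff f k"
proof -
  have f: "smooth_fun f" "periodic f" using assms by (auto simp: smooth_periodic_iff)
  let ?F = "\<lambda>t. f t * echar (-k) t"
  let ?D = "\<lambda>t. \<i> * (Dop f t * echar (-k) t) + (- (\<i> * of_int k)) * (f t * echar (-k) t)"
  have "(?D has_integral (?F (2*pi) - ?F 0)) {0..2*pi}"
    by (rule fundamental_theorem_of_calculus)
      (auto intro!: derivative_eq_intros has_vector_derivative_at_within[OF smooth_fun_deriv0] f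
        simp: algebra_simps)
  moreover have "?F (2*pi) = ?F 0"
    using f(2) periodic_echar[of "-k"] unfolding periodic_def by (metis add_0)
  moreover have c: "continuous_on {0..2*pi} (\<lambda>t. Dop f t * echar (-k) t)"
     "continuous_on {0..2*pi} (\<lambda>t. f t * echar (-k) t)"
    using smooth_fun_continuous[OF f(1), of _ 1] smooth_fun_continuous0[OF f(1)]
    by (auto intro!: continuous_intros)
  ultimately have "0 = integral {0..2*pi} ?D" by (simp add: integral_unique)
  also have "\<dots> = \<i> * integral {0..2*pi} (\<lambda>t. Dop f t * echar (-k) t)
      + (- (\<i> * of_int k)) * integral {0..2*pi} (\<lambda>t. f t * echar (-k) t)"
    using c by (subst Henstock_Kurzweil_Integration.integral_add)
      (auto intro!: integrable_continuous_interval continuous_intros)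
  finally show ?thesis by (simp add: fourier_coeff_eq field_simps)
qed

lemma fourier_coeff_Dop_funpow:
  assumes "f \<in> smooth_periodic"
  shows "fourier_coeff ((Dop ^^ p) f) k = of_int k ^ p * fourier_coeff f k"
  by (induction p) (simp_all add: fourier_coeff_Dop smooth_periodic_Dop_funpow assms)

section \<open>Bessel's inequality and pointwise convergence of Fourier series\<close>

lemma bessel_inequality:
  assumes h: "continuous_on {0..2*pi} h" and "finite K"
  shows "(\<Sum>k\<in>K. (cmod (fourier_coeff h k))\<^sup>2) \<le> integral {0..2*pi} (\<lambda>t. (cmod (h t))\<^sup>2) / (2 * pi)"
proof -
  define c where "c = fourier_coeff h"
  define S where "S t = (\<Sum>k\<in>K. c k * echar k t)" for t
  have S: "continuous_on {0..2*pi} S"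
    using smooth_periodic_trig_poly[OF assms(2), of c]
    by (auto simp: smooth_periodic_iff S_def[abs_def] smooth_fun_continuous0)
  \<comment> \<open>The coefficients of the residual \<open>h - S\<close> vanish on
    \<open>K\<close>, which makes it orthogonal to \<open>S\<close>.\<close>
  have orth: "integral {0..2*pi} (\<lambda>t. (h t - S t) * echar (-k) t) = 0" if "k \<in> K" for k
  proof -
    have "fourier_coeff (\<lambda>t. 1 * h t + (-1) * S t) k = 0"
      using fourier_coeff_trig_poly[OF assms(2), where d = c and k = k] that
      by (subst fourier_coeff_lincomb[OF h S]) (simp add: S_def[abs_def] c_def)
    then show ?thesis by (simp add: fourier_coeff_eq)
  qed
  have hS: "continuous_on {0..2*pi} (\<lambda>t. h t - S t)" using h S by (intro continuous_intros)
  have "integral {0..2*pi} (\<lambda>t. (h t - S t) * cnj (S t))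
      = integral {0..2*pi} (\<lambda>t. \<Sum>k\<in>K. cnj (c k) * ((h t - S t) * echar (-k) t))"
    by (simp add: S_def[abs_def] sum_distrib_left sum_distrib_right cnj_echar mult_ac)
  also have "\<dots> = (\<Sum>k\<in>K. cnj (c k) * integral {0..2*pi} (\<lambda>t. (h t - S t) * echar (-k) t))"
    using assms(2) hS
    by (subst Henstock_Kurzweil_Integration.integral_sum) (auto intro!: integrable_continuous_interval continuous_intros)
  finally have 1: "integral {0..2*pi} (\<lambda>t. (h t - S t) * cnj (S t)) = 0"
    using orth by simp
  have "integral {0..2*pi} (\<lambda>t. S t * cnj (h t))
      = integral {0..2*pi} (\<lambda>t. \<Sum>k\<in>K. c k * cnj (h t * echar (-k) t))"
    by (simp add: S_def[abs_def] sum_distrib_left sum_distrib_right cnj_echar mult_ac)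
  also have "\<dots> = (\<Sum>k\<in>K. c k * integral {0..2*pi} (\<lambda>t. cnj (h t * echar (-k) t)))"
    using assms(2) h
    by (subst Henstock_Kurzweil_Integration.integral_sum) (auto intro!: integrable_continuous_interval continuous_intros)
  also have "\<dots> = (\<Sum>k\<in>K. c k * cnj (2 * pi * c k))"
    by (intro sum.cong refl) (simp add: c_def fourier_coeff_eq integral_cnj)
  also have "\<dots> = of_real (2 * pi * (\<Sum>k\<in>K. (cmod (c k))\<^sup>2))"
    unfolding of_real_mult of_real_sum complex_norm_square by (simp add: sum_distrib_left mult_ac)
  finally have 2: "integral {0..2*pi} (\<lambda>t. S t * cnj (h t)) = of_real (2 * pi * (\<Sum>k\<in>K. (cmod (c k))\<^sup>2))" .
  have I: "u integrable_on {0..2*pi}" if "continuous_on {0..2*pi} u" for u :: "real \<Rightarrow> complex"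
    using that by (rule integrable_continuous_interval)
  have R: "integral {0..2*pi} (\<lambda>t. complex_of_real (u t)) = of_real (integral {0..2*pi} u)"
    if "continuous_on {0..2*pi} u" for u :: "real \<Rightarrow> real"
    by (metis has_integral_of_real integrable_continuous_interval integrable_integral integral_unique that)
  have "of_real (integral {0..2*pi} (\<lambda>t. (cmod (h t - S t))\<^sup>2))
      = integral {0..2*pi} (\<lambda>t. complex_of_real ((cmod (h t - S t))\<^sup>2))"
    by (rule R[symmetric]) (intro continuous_intros hS)
  \<comment> \<open>The square is expanded so that the last term is the residual against
    \<open>S\<close>, whose integral vanishes; the middle one gives the sum of squared
    coefficients.\<close>
  also have "\<dots> = integral {0..2*pi} (\<lambda>t. (h t * cnj (h t) - S t * cnj (h t)) - (h t - S t) * cnj (S t))"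
    unfolding complex_norm_square by (simp add: algebra_simps)
  also have "\<dots> = integral {0..2*pi} (\<lambda>t. h t * cnj (h t)) - integral {0..2*pi} (\<lambda>t. S t * cnj (h t))
     - integral {0..2*pi} (\<lambda>t. (h t - S t) * cnj (S t))"
  proof -
    have *: "(\<lambda>t. h t * cnj (h t)) integrable_on {0..2*pi}" "(\<lambda>t. S t * cnj (h t)) integrable_on {0..2*pi}"
      "(\<lambda>t. (h t - S t) * cnj (S t)) integrable_on {0..2*pi}"
      by (rule I, intro continuous_intros h S)+
    show ?thesis
      by (simp only: Henstock_Kurzweil_Integration.integral_diff integrable_diff *)
  qed
  also have "integral {0..2*pi} (\<lambda>t. h t * cnj (h t)) = of_real (integral {0..2*pi} (\<lambda>t. (cmod (h t))\<^sup>2))"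
    using R[of "\<lambda>t. (cmod (h t))\<^sup>2"] h unfolding complex_norm_square by (simp add: continuous_intros)
  finally have "complex_of_real (integral {0..2*pi} (\<lambda>t. (cmod (h t - S t))\<^sup>2)) = of_real
     (integral {0..2*pi} (\<lambda>t. (cmod (h t))\<^sup>2) - 2 * pi * (\<Sum>k\<in>K. (cmod (c k))\<^sup>2))"
    unfolding 1 2 by simp
  then have "integral {0..2*pi} (\<lambda>t. (cmod (h t - S t))\<^sup>2) =
     integral {0..2*pi} (\<lambda>t. (cmod (h t))\<^sup>2) - 2 * pi * (\<Sum>k\<in>K. (cmod (c k))\<^sup>2)"
    using of_real_eq_iff by blast
  moreover have "integral {0..2*pi} (\<lambda>t. (cmod (h t - S t))\<^sup>2) \<ge> 0"
    by (rule Henstock_Kurzweil_Integration.integral_nonneg)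
      (auto intro!: integrable_continuous_interval continuous_intros hS)
  ultimately show ?thesis by (simp add: c_def field_simps)
qed

text \<open>Bessel's inequality makes the squared coefficients along \<open>\<kappa>\<close>
  summable, injectivity preventing a frequency from being counted twice. A general
  \<open>\<kappa>\<close> serves both ends of the frequency axis.\<close>

lemma fourier_coeff_tendsto_0:
  assumes h: "continuous_on {0..2*pi} h" and inj: "inj \<kappa>"
  shows "(\<lambda>n::nat. fourier_coeff h (\<kappa> n)) \<longlonglongrightarrow> 0"
proof -
  let ?g = "\<lambda>n. (cmod (fourier_coeff h (\<kappa> n)))\<^sup>2"
  have "(\<Sum>i<n. ?g i) \<le> integral {0..2*pi} (\<lambda>t. (cmod (h t))\<^sup>2) / (2 * pi)" for n
    using bessel_inequality[OF h, of "\<kappa> ` {..<n}"] inj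
    by (simp add: sum.reindex inj_on_subset)
  then have "summable ?g" by (intro summableI_nonneg_bounded) auto
  then have "?g \<longlonglongrightarrow> 0" by (rule summable_LIMSEQ_zero)
  then have "(\<lambda>n. sqrt (?g n)) \<longlonglongrightarrow> sqrt 0" by (rule tendsto_real_sqrt)
  then show ?thesis by (simp add: tendsto_norm_zero_iff)
qed

definition fourier_sum :: "(real \<Rightarrow> complex) \<Rightarrow> nat \<Rightarrow> real \<Rightarrow> complex" where
  "fourier_sum f N t = (\<Sum>k\<in>{- int N..int N}. fourier_coeff f k * echar k t)"

text \<open>Chernoff's argument: if \<open>f(s) - f(t) = (e\<^sup>i\<^sup>(\<^sup>s\<^sup>-\<^sup>t\<^sup>) - 1) h(s)\<close> with \<open>h\<close> continuous, then the
  Fourier series of \<open>f - f(t)\<close> at \<open>t\<close> telescopes, and the boundary terms vanish by Bessel's inequality.\<close>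

lemma fourier_sum_tendsto:
  assumes "f \<in> smooth_periodic"
  shows "(\<lambda>N. fourier_sum f N t) \<longlonglongrightarrow> f t"
proof -
  have f: "smooth_fun f" "periodic f" using assms by (auto simp: smooth_periodic_iff)
  define q where "q s = echar 1 (s - t) - 1" for s
  \<comment> \<open>The zeros of \<open>q\<close> are the points that differ from \<open>t\<close>
    by a period multiple. There the increments of numerator and denominator are
    \<open>\<i> * Dop f t\<close> and \<open>\<i>\<close> to first order, so \<open>Dop f t\<close>
    is the value that makes \<open>h\<close> continuous.\<close>
  define h where "h s = (if q s = 0 then Dop f t else (f s - f t) / q s)" for s
  have q0: "f s = f t \<and> Dop f s = Dop f t \<and> (\<forall>u. q (s + u) = echar 1 u - 1)" if "q s = 0" for s
  proof -
    have cs: "cis (s - t) = 1" using that by (simp add: q_def echar_def)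
    then obtain m :: int where "s - t = of_int m * (2 * pi)"
      by (auto simp: complex_eq_iff cos_one_2pi_int)
    then have s: "s = t + 2 * pi * of_int m" by (simp add: algebra_simps)
    have "q (s + u) = echar 1 u - 1" for u
      using cs by (simp add: q_def echar_def add_diff_eq[symmetric] cis_mult[symmetric] add.commute[of s u])
    then show ?thesis using s periodic_int[OF f(2)] periodic_int[OF periodic_Dop[OF f(2)]] by simp
  qed
  have qd: "(q has_vector_derivative \<i> * echar 1 (s - t)) (at s)" for s
    unfolding q_def has_vector_derivative_def echar_def
    by (auto intro!: derivative_eq_intros simp: fun_eq_iff)
  have qc: "isCont q s" for s using qd has_vector_derivative_continuous by blast
  have fc: "isCont f s" for s using smooth_fun_deriv0[OF f(1)] has_vector_derivative_continuous by blast
  have "isCont h s" for s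
  proof (cases "q s = 0")
    case False
    have "\<forall>\<^sub>F u in nhds s. q u \<noteq> 0"
      using qc[of s] False by (simp add: continuous_at_imp_continuous_within eventually_nhds_conv_at
          isCont_def tendsto_imp_eventually_ne)
    then have "\<forall>\<^sub>F u in nhds s. h u = (f u - f t) / q u"
      by eventually_elim (simp add: h_def)
    moreover have "isCont (\<lambda>u. (f u - f t) / q u) s"
      using False qc fc by (intro continuous_intros) auto
    ultimately show ?thesis by (simp add: isCont_cong)
  next
    case True
    have ds: "(f has_vector_derivative \<i> * Dop f t) (at s)"
      using smooth_fun_deriv0[OF f(1), of s] q0[OF True] by simp
    have dq: "(q has_vector_derivative \<i>) (at s)"
      using qd[of s] True by (simp add: q_def)
    have Lf: "(\<lambda>u. (f u - f s) /\<^sub>R (u - s)) \<midarrow>s\<rightarrow> \<i> * Dop f t"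
      and Lq: "(\<lambda>u. (q u - q s) /\<^sub>R (u - s)) \<midarrow>s\<rightarrow> \<i>"
      using ds dq by (auto intro: has_vector_derivative_quotient_tendsto)
    have "\<forall>\<^sub>F u in at s. (q u - q s) /\<^sub>R (u - s) \<noteq> 0"
      using Lq by (rule tendsto_imp_eventually_ne) simp
    then have "\<forall>\<^sub>F u in at s. ((f u - f s) /\<^sub>R (u - s)) / ((q u - q s) /\<^sub>R (u - s)) = h u"
      by eventually_elim (use True q0[OF True] in \<open>auto simp: h_def scaleR_conv_of_real divide_simps\<close>)
    moreover have "(\<lambda>u. ((f u - f s) /\<^sub>R (u - s)) / ((q u - q s) /\<^sub>R (u - s))) \<midarrow>s\<rightarrow> (\<i> * Dop f t) / \<i>"
      by (intro tendsto_divide Lf Lq) simp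
    ultimately have "h \<midarrow>s\<rightarrow> Dop f t" using tendsto_cong by force
    then show ?thesis using True by (simp add: isCont_def h_def)
  qed
  then have hc: "continuous_on S h" for S by (simp add: continuous_at_imp_continuous_on)
  have hq: "f s - f t = q s * h s" for s
    using q0[of s] by (auto simp: h_def)
  define b where "b k = echar k t * fourier_coeff h k" for k
  have tel: "fourier_coeff f k * echar k t - (if k = 0 then f t else 0) = b (k - 1) - b k" for k
  proof -
    \<comment> \<open>Written as a multiple of \<open>echar 0\<close>, the constant contributes at
      frequency 0 only. Multiplying \<open>h\<close> by \<open>echar 1\<close> shifts its
      coefficients by one, which produces a difference of neighbours.\<close>
    have e: "(f s + (- f t) * echar 0 s) = echar (-1) t * (h s * echar 1 s) + (-1) * h s" for s
      using hq[of s] by (simp add: q_def echar_diff algebra_simps)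
    have "fourier_coeff f k - (if k = 0 then f t else 0) =
       fourier_coeff (\<lambda>s. 1 * f s + (- f t) * echar 0 s) k"
      by (subst fourier_coeff_lincomb) (use f in \<open>auto intro: smooth_fun_continuous0 continuous_on_echar
         simp: fourier_coeff_echar simp del: echar_0\<close>)
    also have "\<dots> = echar (-1) t * fourier_coeff (\<lambda>s. h s * echar 1 s) k + (-1) * fourier_coeff h k"
      unfolding mult_1 e by (rule fourier_coeff_lincomb) (auto intro!: hc continuous_intros)
    also have "fourier_coeff (\<lambda>s. h s * echar 1 s) k = fourier_coeff h (k - 1)"
      by (simp add: fourier_coeff_eq mult.assoc echar_mult)
    finally have "(fourier_coeff f k - (if k = 0 then f t else 0)) * echar k t =
      (echar (-1) t * fourier_coeff h (k-1) + (-1) * fourier_coeff h k) * echar k t" by simp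
    moreover have "(fourier_coeff f k - (if k = 0 then f t else 0)) * echar k t
        = fourier_coeff f k * echar k t - (if k = 0 then f t else 0)"
      by (simp add: left_diff_distrib)
    moreover have "echar (-1) t * fourier_coeff h (k-1) * echar k t = b (k - 1)"
      using echar_mult[of "-1" t k] by (simp add: b_def mult_ac)
    ultimately have "fourier_coeff f k * echar k t - (if k = 0 then f t else 0)
        = b (k - 1) + - fourier_coeff h k * echar k t"
      by (metis (no_types, lifting) distrib_right mult_minus1)
    then show ?thesis
      by (simp add: b_def mult.commute)
  qed
  have "fourier_sum f N t - f t = b (- int N - 1) - b (int N)" for N
  proof -
    have "fourier_sum f N t - f t = (\<Sum>k\<in>{-int N..int N}. b (k - 1) - b k)"
      unfolding tel[symmetric] by (simp add: sum_subtractf fourier_sum_def)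
    also have "\<dots> = b (- int N - 1) - b (int N)"
    proof (induction N)
      case (Suc N)
      have "{- int (Suc N)..int (Suc N)} = insert (int (Suc N)) (insert (- int (Suc N)) {- int N..int N})"
        by auto
      moreover have "b (- int N - 1) = b (- 1 - int N)" by (rule arg_cong[of _ _ b]) simp
      ultimately show ?case using Suc by simp
    qed simp
    finally show ?thesis .
  qed
  moreover have "(\<lambda>N. b (- int N - 1) - b (int N)) \<longlonglongrightarrow> 0"
  proof -
    have bt: "(\<lambda>n. b (\<kappa> n)) \<longlonglongrightarrow> 0" if "inj \<kappa>" for \<kappa> :: "nat \<Rightarrow> int"
    proof (rule tendsto_norm_zero_cancel)
      show "(\<lambda>n. cmod (b (\<kappa> n))) \<longlonglongrightarrow> 0"
        using tendsto_norm_zero[OF fourier_coeff_tendsto_0[OF hc that]]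
        by (simp add: b_def norm_mult)
    qed
    show ?thesis using tendsto_diff[OF bt[of "\<lambda>N. - int N - 1"] bt[of int]] by (simp add: inj_def)
  qed
  ultimately have "(\<lambda>N. fourier_sum f N t - f t) \<longlonglongrightarrow> 0" by simp
  then show ?thesis by (rule LIM_zero_cancel)
qed

text \<open>The partial Fourier sums are constant once they exhaust \<open>K\<close>, so their limit
  is this finite sum. This turns the mollifiers, known through their coefficients, into explicit
  trigonometric polynomials.\<close>

lemma smooth_periodic_eq_trig_poly:
  assumes "f \<in> smooth_periodic" "finite K" "\<And>k. k \<notin> K \<Longrightarrow> fourier_coeff f k = 0"
  shows "f = (\<lambda>t. \<Sum>k\<in>K. fourier_coeff f k * echar k t)"
proof
  fix t
  obtain N0 :: nat where N0: "\<And>k. k \<in> K \<Longrightarrow> \<bar>k\<bar> \<le> int N0"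
  proof -
    have "finite ((\<lambda>k. nat \<bar>k\<bar>) ` K)" using assms(2) by simp
    then obtain m where "\<And>k. k \<in> K \<Longrightarrow> nat \<bar>k\<bar> \<le> m" by (meson finite_nat_set_iff_bounded_le imageI)
    then show ?thesis by (intro that[of m]) (simp add: nat_le_iff)
  qed
  have "fourier_sum f N t = (\<Sum>k\<in>K. fourier_coeff f k * echar k t)" if "N \<ge> N0" for N
    unfolding fourier_sum_def
  proof (intro sum.mono_neutral_right ballI)
    show "K \<subseteq> {- int N..int N}" using N0 that by (force simp: abs_le_iff)
  qed (use assms(3) in auto)
  then have "(\<lambda>N. fourier_sum f N t) \<longlonglongrightarrow> (\<Sum>k\<in>K. fourier_coeff f k * echar k t)"
    by (intro tendsto_eventually) (rule eventually_sequentiallyI)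
  then show "f t = (\<Sum>k\<in>K. fourier_coeff f k * echar k t)"
    using fourier_sum_tendsto[OF assms(1)] LIMSEQ_unique by blast
qed

section \<open>Weights and norms\<close>

text \<open>At \<open>t = 0\<close> only the term p = 0 survives, which matches M(0) = 0 when
  \<open>M 0 = 1\<close>. The type \<open>ennreal\<close> admits the infinite values of the Roumieu
  case.\<close>

definition weight :: "(nat \<Rightarrow> real) \<Rightarrow> real \<Rightarrow> ennreal" where
  "weight M t = (SUP p. ennreal (\<bar>t\<bar> ^ p / M p))"

lemma weight_ge: "ennreal (\<bar>t\<bar> ^ p / M p) \<le> weight M t"
  unfolding weight_def by (rule SUP_upper) simp

lemma weight_minus [simp]: "weight M (- t) = weight M t"
  by (simp add: weight_def)

lemma unorm_ge: "ennreal (h ^ p / M p) * ennreal (cmod ((Dop ^^ p) f t)) \<le> unorm M h f"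
  unfolding unorm_def
  by (rule order_trans[OF mult_left_mono SUP_upper[of p]]) (auto intro: SUP_upper)

lemma unorm_leI:
  assumes "\<And>p t. ennreal (h ^ p / M p) * ennreal (cmod ((Dop ^^ p) f t)) \<le> B"
  shows "unorm M h f \<le> B"
  unfolding unorm_def by (auto simp: SUP_mult_left_ennreal intro!: SUP_least assms)

lemma exp_ereal_mono: "x \<le> y \<Longrightarrow> exp_ereal x \<le> exp_ereal y"
  by (cases x; cases y) (auto simp: exp_ereal_def intro!: ennreal_leI)

lemma exp_ereal_uminus: "exp_ereal (- x) = inverse (exp_ereal x)"
  by (cases x) (auto simp: exp_ereal_def exp_minus inverse_ennreal)

lemma smooth_periodic_sum2:
  assumes "f \<in> smooth_periodic" "g \<in> smooth_periodic"
  shows "(\<lambda>t. f t + g t) \<in> smooth_periodic" "(\<lambda>t. f t - g t) \<in> smooth_periodic"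
    "(\<lambda>t. c * f t) \<in> smooth_periodic"
  using smooth_periodic_lincomb[OF assms, of 1 1] smooth_periodic_lincomb[OF assms, of 1 "-1"]
    smooth_periodic_lincomb[OF assms, of c 0] by simp_all

lemma smooth_periodic_mult:
  "f \<in> smooth_periodic \<Longrightarrow> g \<in> smooth_periodic \<Longrightarrow> (\<lambda>t. f t * g t) \<in> smooth_periodic"
  by (simp add: smooth_periodic_iff smooth_fun_mult periodic_def)

text \<open>(M.1) enters through its consequence \<open>M_super\<close>, which controls the Leibniz
  rule. The constants of (M.2) are fixed because \<open>H\<close> measures every change of
  scale.\<close>

locale weight_sequence =
  fixes M :: "nat \<Rightarrow> real" and A H :: real
  assumes M_pos: "M p > 0" and M_0: "M 0 = 1"
    and M_super: "M p * M q \<le> M (p + q)"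
    and A_ge: "A \<ge> 1" and H_ge: "H \<ge> 1"
    and M_2: "M (p + q) \<le> A * H ^ (p + q) * M p * M q"
begin

lemma M_nz [simp]: "M p \<noteq> 0" "M p \<ge> 0"
  using M_pos[of p] by auto

lemma H_pos [simp]: "H > 0" using H_ge by simp

lemma weight_ge_1: "1 \<le> weight M t"
  using weight_ge[of t 0 M] M_0 by simp

lemma weight_nz [simp]: "weight M t \<noteq> 0"
  using weight_ge_1[of t] by auto

lemma weight_mono: "\<bar>s\<bar> \<le> \<bar>t\<bar> \<Longrightarrow> weight M s \<le> weight M t"
  unfolding weight_def by (intro SUP_mono' ennreal_leI divide_right_mono power_mono) auto

text \<open>Read backwards, (M.2) bounds \<open>1 / (M p * M q)\<close> by
  \<open>A * H ^ (p + q) / M (p + q)\<close>, so a product of one term from each supremum is at most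
  \<open>A\<close> times a single term at \<open>H * r\<close>. The common bound \<open>r\<close>
  allows weights at different arguments to be merged.\<close>

lemma weight_mult:
  assumes "\<bar>s\<bar> \<le> r" "\<bar>t\<bar> \<le> r"
  shows "weight M s * weight M t \<le> ennreal A * weight M (H * r)"
proof -
  have "ennreal (\<bar>s\<bar> ^ p / M p) * ennreal (\<bar>t\<bar> ^ q / M q) \<le> ennreal A * weight M (H * r)" for p q
  proof -
    have "\<bar>s\<bar> ^ p / M p * (\<bar>t\<bar> ^ q / M q) \<le> r ^ p * r ^ q / (M p * M q)"
      using assms by (simp add: divide_right_mono mult_mono power_mono)
    also have "\<dots> \<le> r ^ p * r ^ q * (A * H ^ (p + q) / M (p + q))"
    proof -
      have "1 / (M p * M q) \<le> A * H ^ (p + q) / M (p + q)"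
        using M_2[of p q] M_pos by (simp add: field_simps)
      moreover have "r ^ p * r ^ q \<ge> 0" using assms(1) by auto
      ultimately have "r ^ p * r ^ q * (1 / (M p * M q)) \<le> r ^ p * r ^ q * (A * H ^ (p + q) / M (p + q))"
        by (rule mult_left_mono)
      then show ?thesis by simp
    qed
    also have "\<dots> = A * (\<bar>H * r\<bar> ^ (p + q) / M (p + q))"
      using assms(1) H_ge by (simp add: power_mult_distrib power_add)
    finally have "ennreal (\<bar>s\<bar> ^ p / M p) * ennreal (\<bar>t\<bar> ^ q / M q)
       \<le> ennreal A * ennreal (\<bar>H * r\<bar> ^ (p + q) / M (p + q))"
      using A_ge by (simp add: ennreal_mult[symmetric] ennreal_leI)
    then show ?thesis by (rule order_trans) (intro mult_left_mono weight_ge zero_le)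
  qed
  then show ?thesis
    unfolding weight_def[of M s] weight_def[of M t]
    by (auto simp: SUP_mult_left_ennreal SUP_mult_right_ennreal intro!: SUP_least)
qed

text \<open>Both inequalities come from monotonicity of the exponential, applied to each term and,
  when the weight is a finite \<open>w\<close>, to the upper bound \<open>ln w\<close>. If the
  weight is infinite the second inequality is trivial.\<close>

lemma exp_ereal_assoc_fun: "exp_ereal (assoc_fun M t) = weight M t"
proof (cases "t = 0")
  case True
  have "weight M 0 \<le> 1"
    unfolding weight_def using M_0 by (auto intro!: SUP_least simp: power_0_left)
  then show ?thesis using True weight_ge_1[of 0] by (simp add: assoc_fun_def exp_ereal_def)
next
  case False
  define x where "x p = \<bar>t\<bar> ^ p / M p" for p
  define s where "s = (SUP p. ereal (ln (x p)))"
  have x: "x p > 0" for p using False M_pos[of p] by (simp add: x_def)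
  have "exp_ereal s = weight M t"
  proof (rule antisym)
    show "weight M t \<le> exp_ereal s"
      unfolding weight_def x_def[symmetric]
    proof (rule SUP_least)
      fix p
      have "exp_ereal (ereal (ln (x p))) \<le> exp_ereal s"
        unfolding s_def by (intro exp_ereal_mono SUP_upper) simp
      then show "ennreal (x p) \<le> exp_ereal s" using x by (simp add: exp_ereal_def)
    qed
    show "exp_ereal s \<le> weight M t"
    proof (cases "weight M t")
      case (real w)
      have "x p \<le> w" for p using weight_ge[of t p M] real by (simp add: x_def)
      then have "s \<le> ereal (ln w)"
        unfolding s_def using x by (auto intro!: SUP_least ln_mono intro: less_le_trans)
      moreover have "w > 0" using x[of 0] \<open>\<And>p. x p \<le> w\<close>[of 0] by linarith
      ultimately show ?thesis using exp_ereal_mono[of s "ereal (ln w)"] real by (simp add: exp_ereal_def)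
    qed simp
  qed
  then show ?thesis using False by (simp add: assoc_fun_def s_def x_def)
qed

lemma exp_ereal_uminus_assoc_fun: "exp_ereal (- assoc_fun M t) = inverse (weight M t)"
  by (simp add: exp_ereal_uminus exp_ereal_assoc_fun)

lemma unorm_finiteD:
  assumes "h > 0" "unorm M h f \<le> ennreal u" "u \<ge> 0"
  shows "cmod ((Dop ^^ p) f t) \<le> u * M p / h ^ p"
proof -
  have "ennreal (h ^ p / M p * cmod ((Dop ^^ p) f t)) \<le> ennreal u"
    using order_trans[OF unorm_ge assms(2), of p t] assms(1)
    by (simp only: ennreal_mult[symmetric] zero_le_power less_imp_le M_nz divide_nonneg_nonneg norm_ge_zero)
  then show ?thesis using assms M_pos[of p] by (simp add: field_simps)
qed

lemma unorm_real_leI: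
  assumes "h > 0" "\<And>p t. cmod ((Dop ^^ p) f t) \<le> u * M p / h ^ p" "u \<ge> 0"
  shows "unorm M h f \<le> ennreal u"
proof (rule unorm_leI)
  fix p t
  show "ennreal (h ^ p / M p) * ennreal (cmod ((Dop ^^ p) f t)) \<le> ennreal u"
    using assms(1,3) assms(2)[of p t] M_pos[of p] 
    by (simp add: ennreal_mult[symmetric] field_simps ennreal_leI)
qed

lemma unorm_mono:
  assumes "0 \<le> h" "h \<le> h'"
  shows "unorm M h f \<le> unorm M h' f"
proof (rule unorm_leI)
  fix p t
  have "ennreal (h ^ p / M p) * ennreal (cmod ((Dop ^^ p) f t)) \<le> ennreal (h' ^ p / M p) * ennreal (cmod ((Dop ^^ p) f t))"
    using assms by (intro mult_right_mono ennreal_leI divide_right_mono power_mono) auto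
  also note unorm_ge
  finally show "ennreal (h ^ p / M p) * ennreal (cmod ((Dop ^^ p) f t)) \<le> unorm M h' f" .
qed

lemma unorm_lincomb:
  assumes "f \<in> smooth_periodic" "g \<in> smooth_periodic"
  shows "unorm M h (\<lambda>t. a * f t + b * g t) \<le> ennreal (cmod a) * unorm M h f + ennreal (cmod b) * unorm M h g"
proof (rule unorm_leI)
  fix p t
  let ?c = "ennreal (h ^ p / M p)"
  have "ennreal (cmod ((Dop ^^ p) (\<lambda>t. a * f t + b * g t) t)) \<le>
     ennreal (cmod a * cmod ((Dop ^^ p) f t) + cmod b * cmod ((Dop ^^ p) g t))"
    using assms norm_triangle_ineq[of "a * (Dop ^^ p) f t" "b * (Dop ^^ p) g t"]
    by (intro ennreal_leI) (simp add: Dop_funpow_lincomb smooth_periodic_iff norm_mult)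
  then have "?c * ennreal (cmod ((Dop ^^ p) (\<lambda>t. a * f t + b * g t) t))
      \<le> ennreal (cmod a) * (?c * ennreal (cmod ((Dop ^^ p) f t)))
        + ennreal (cmod b) * (?c * ennreal (cmod ((Dop ^^ p) g t)))"
    by (simp add: ennreal_plus ennreal_mult mult_left_mono distrib_left[symmetric] mult.left_commute[of _ ?c])
  also have "\<dots> \<le> ennreal (cmod a) * unorm M h f + ennreal (cmod b) * unorm M h g"
    by (intro add_mono mult_left_mono unorm_ge) auto
  finally show "?c * ennreal (cmod ((Dop ^^ p) (\<lambda>t. a * f t + b * g t) t))
      \<le> ennreal (cmod a) * unorm M h f + ennreal (cmod b) * unorm M h g" .
qed

lemma unorm_cmult:
  assumes "f \<in> smooth_periodic"
  shows "unorm M h (\<lambda>t. c * f t) \<le> ennreal (cmod c) * unorm M h f"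
  using unorm_lincomb[OF assms assms, of h c 0] by simp

text \<open>Halving the scale absorbs the factor \<open>2 ^ p\<close> of the Leibniz rule, and
  \<open>M_super\<close> merges \<open>M i * M j\<close> into the weight of the total order.\<close>

lemma unorm_mult:
  assumes "f \<in> ultra_h M (2 * h)" "g \<in> ultra_h M (2 * h)" "h > 0"
  shows "unorm M h (\<lambda>t. f t * g t) \<le> unorm M (2 * h) f * unorm M (2 * h) g"
proof -
  have fg: "f \<in> smooth_periodic" "g \<in> smooth_periodic" using assms by (auto simp: ultra_h_def)
  obtain a where a: "unorm M (2 * h) f = ennreal a" "a \<ge> 0"
    using assms(1) by (cases "unorm M (2 * h) f") (auto simp: ultra_h_def)
  obtain b where b: "unorm M (2 * h) g = ennreal b" "b \<ge> 0"
    using assms(2) by (cases "unorm M (2 * h) g") (auto simp: ultra_h_def)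
  have "unorm M h (\<lambda>t. f t * g t) \<le> ennreal (a * b)"
  proof (rule unorm_real_leI)
    fix p t
    have "cmod ((Dop ^^ i) f t) * cmod ((Dop ^^ j) g t) \<le> a * b * M (i + j) / (2 * h) ^ (i + j)" for i j
    proof -
      have "cmod ((Dop ^^ i) f t) * cmod ((Dop ^^ j) g t) \<le> (a * M i / (2 * h) ^ i) * (b * M j / (2 * h) ^ j)"
        using assms(3) a b by (intro mult_mono unorm_finiteD) auto
      also have "\<dots> = a * b / (2 * h) ^ (i + j) * (M i * M j)" by (simp add: power_add)
      also have "\<dots> \<le> a * b / (2 * h) ^ (i + j) * M (i + j)"
        using assms(3) a b by (intro mult_left_mono M_super) auto
      finally show ?thesis by simp
    qed
    from leibniz_bound[where K = "\<lambda>n. a * b * M n / (2 * h) ^ n", OF this, of p 0 0]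
    show "cmod ((Dop ^^ p) (\<lambda>t. f t * g t) t) \<le> a * b * M p / h ^ p"
      using fg assms(3) by (simp add: Dop_funpow_mult smooth_periodic_iff power_mult_distrib)
  qed (use assms a b in auto)
  then show ?thesis using a b by (simp add: ennreal_mult)
qed

text \<open>D^p multiplies the coefficient by \<open>k ^ p\<close>, and a coefficient is at most the
  sup norm; then the supremum over \<open>p\<close> is taken.\<close>

lemma unorm_fourier_ge:
  assumes "f \<in> smooth_periodic" "h > 0"
  shows "ennreal (cmod (fourier_coeff f k)) * weight M (h * of_int k) \<le> unorm M h f"
proof (cases "unorm M h f")
  case (real u)
  have "ennreal (cmod (fourier_coeff f k)) * ennreal (\<bar>h * of_int k\<bar> ^ p / M p) \<le> ennreal u" for p
  proof -
    have "cmod (fourier_coeff ((Dop ^^ p) f) k) \<le> u * M p / h ^ p"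
      using assms real by (intro norm_fourier_coeff_le unorm_finiteD)
        (auto simp: smooth_periodic_iff intro: smooth_fun_continuous)
    then have "cmod (fourier_coeff f k) * (\<bar>h * of_int k\<bar> ^ p / M p) \<le> u"
      using assms M_pos[of p] unfolding fourier_coeff_Dop_funpow[OF assms(1)]
      by (simp add: norm_mult norm_power abs_mult power_mult_distrib field_simps)
    then show ?thesis by (simp add: ennreal_mult[symmetric] ennreal_leI)
  qed
  then show ?thesis unfolding weight_def real by (auto simp: SUP_mult_left_ennreal intro!: SUP_least)
qed simp

text \<open>Pointwise convergence is applied to the Fourier series of each derivative separately, so
  nothing has to be differentiated term by term. The supremum of partial sums is meaningful even
  where it is infinite.\<close>

lemma unorm_fourier_le:
  assumes "f \<in> smooth_periodic" "h > 0"
  shows "unorm M h f \<le>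
    (SUP N. \<Sum>k\<in>{- int N..int N}. ennreal (cmod (fourier_coeff f k)) * weight M (h * of_int k))"
    (is "_ \<le> (SUP N. ?S N)")
proof (rule unorm_leI)
  fix p t
  let ?c = "h ^ p / M p"
  have c: "?c \<ge> 0" using assms by simp
  have "(\<lambda>N. ennreal (?c * cmod (fourier_sum ((Dop ^^ p) f) N t)))
      \<longlonglongrightarrow> ennreal (?c * cmod ((Dop ^^ p) f t))"
    by (intro tendsto_ennrealI tendsto_intros fourier_sum_tendsto smooth_periodic_Dop_funpow assms(1))
  moreover have "ennreal (?c * cmod (fourier_sum ((Dop ^^ p) f) N t)) \<le> (SUP N. ?S N)" for N
  proof -
    have "?c * cmod (fourier_sum ((Dop ^^ p) f) N t)
        \<le> ?c * (\<Sum>k\<in>{- int N..int N}. cmod (fourier_coeff ((Dop ^^ p) f) k * echar k t))"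
      unfolding fourier_sum_def by (intro mult_left_mono norm_sum c)
    also have "\<dots> = (\<Sum>k\<in>{- int N..int N}. cmod (fourier_coeff f k) * (\<bar>h * of_int k\<bar> ^ p / M p))"
      using assms unfolding sum_distrib_left fourier_coeff_Dop_funpow[OF assms(1)]
      by (intro sum.cong) (auto simp: norm_mult norm_power abs_mult power_mult_distrib)
    finally have "ennreal (?c * cmod (fourier_sum ((Dop ^^ p) f) N t))
      \<le> ennreal (\<Sum>k\<in>{- int N..int N}. cmod (fourier_coeff f k) * (\<bar>h * of_int k\<bar> ^ p / M p))"
      by (rule ennreal_leI)
    also have "\<dots> = (\<Sum>k\<in>{- int N..int N}. ennreal (cmod (fourier_coeff f k)) * ennreal (\<bar>h * of_int k\<bar> ^ p / M p))"
      by (subst sum_ennreal[symmetric]) (auto simp: ennreal_mult[symmetric])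
    also have "\<dots> \<le> ?S N" by (intro sum_mono mult_left_mono weight_ge) auto
    also have "\<dots> \<le> (SUP N. ?S N)" by (rule SUP_upper) simp
    finally show ?thesis .
  qed
  ultimately have "ennreal (?c * cmod ((Dop ^^ p) f t)) \<le> (SUP N. ?S N)"
    by (intro LIMSEQ_le_const2) auto
  then show "ennreal ?c * ennreal (cmod ((Dop ^^ p) f t)) \<le> (SUP N. ?S N)"
    by (simp only: ennreal_mult[OF c norm_ge_zero])
qed

text \<open>The form in which the upper bound is applied: \<open>w\<close> is the weight attached to
  the index of a sequence, \<open>b\<close> a summable majorant, in practice a constant times an
  inverse weight at \<open>k\<close>.\<close>

lemma unorm_fourier_leI:
  assumes "f \<in> smooth_periodic" "h > 0"
    and "\<And>k. ennreal (cmod (fourier_coeff f k)) * weight M (h * of_int k) * w \<le> b k"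
    and "\<And>N. (\<Sum>k\<in>{- int N..int N}. b k) \<le> B"
  shows "unorm M h f * w \<le> B"
proof -
  have "unorm M h f * w \<le> (SUP N. (\<Sum>k\<in>{- int N..int N}.
      ennreal (cmod (fourier_coeff f k)) * weight M (h * of_int k) * w))"
    using mult_right_mono[OF unorm_fourier_le[OF assms(1,2)], of w]
    by (simp add: SUP_mult_right_ennreal sum_distrib_right)
  also have "\<dots> \<le> B"
    by (rule SUP_least) (rule order_trans[OF sum_mono[OF assms(3)] assms(4)])
  finally show ?thesis .
qed

end

text \<open>The function spaces and the negligible sequences of the two classes differ only in this
  quantifier over the scale \<open>h\<close>.\<close>

fun for_scale :: "ultra_class \<Rightarrow> (real \<Rightarrow> bool) \<Rightarrow> bool" where
  "for_scale Beurling P \<longleftrightarrow> (\<forall>h>0. P h)"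
| "for_scale Roumieu P \<longleftrightarrow> (\<exists>h>0. P h)"

text \<open>A constant factor in the scale is harmless under either quantifier: to reach a given
  \<open>h\<close> one starts from \<open>h / c\<close>, and from a witness \<open>h\<close> one
  passes to \<open>c * h\<close>.\<close>

lemma for_scale_map:
  assumes "for_scale cls P" "c > 0" "\<And>h. h > 0 \<Longrightarrow> P h \<Longrightarrow> P' (c * h)"
  shows "for_scale cls P'"
proof (cases cls)
  case Beurling
  have "P' h" if "h > 0" for h
    using assms(3)[of "h / c"] assms(1,2) that Beurling by simp
  then show ?thesis using Beurling by simp
next
  case Roumieu
  then obtain h where "h > 0" "P h" using assms(1) by auto
  then have "c * h > 0" "P' (c * h)" using assms(2,3) by simp_all
  then show ?thesis using Roumieu by auto
qed

lemma for_scale_mono: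
  assumes "for_scale cls P" "\<And>h. h > 0 \<Longrightarrow> P h \<Longrightarrow> P' h"
  shows "for_scale cls P'"
  using for_scale_map[of cls P 1 P'] assms by simp

text \<open>Downward closure lets two Roumieu witnesses be replaced by their minimum.\<close>

lemma for_scale_conj:
  assumes "for_scale cls P" "for_scale cls P'"
    and "\<And>h h'. 0 < h' \<Longrightarrow> h' \<le> h \<Longrightarrow> P h \<Longrightarrow> P h'"
    and "\<And>h h'. 0 < h' \<Longrightarrow> h' \<le> h \<Longrightarrow> P' h \<Longrightarrow> P' h'"
  shows "for_scale cls (\<lambda>h. P h \<and> P' h)"
proof (cases cls)
  case Beurling
  then show ?thesis using assms(1,2) by simp
next
  case Roumieu
  then obtain h h' where "h > 0" "P h" "h' > 0" "P' h'" using assms(1,2) by auto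
  then have "P (min h h') \<and> P' (min h h')" "min h h' > 0"
    using assms(3)[of "min h h'" h] assms(4)[of "min h h'" h'] by auto
  then show ?thesis using Roumieu by (auto intro!: exI[of _ "min h h'"])
qed

lemma ultra_iff: "f \<in> ultra cls M \<longleftrightarrow> for_scale cls (\<lambda>h. f \<in> ultra_h M h)"
  by (cases cls) auto

lemma for_scale_const: "for_scale cls (\<lambda>h. P) \<longleftrightarrow> P"
  by (cases cls) (auto intro: exI[of _ 1])

lemma ultra_smooth: "f \<in> ultra cls M \<Longrightarrow> f \<in> smooth_periodic"
  unfolding ultra_iff
  by (drule for_scale_mono[where P' = "\<lambda>h. f \<in> smooth_periodic"])
    (auto simp: ultra_h_def for_scale_const)

section \<open>Weighted boundedness and inverse weights\<close>

definition wbounded :: "(nat \<Rightarrow> real) \<Rightarrow> real \<Rightarrow> (nat \<Rightarrow> ennreal) \<Rightarrow> (nat \<Rightarrow> real \<Rightarrow> complex) \<Rightarrow> bool" where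
  "wbounded M h w F \<longleftrightarrow> (\<exists>B::real. \<forall>n. unorm M h (F n) * w n \<le> ennreal B)"

lemma SUP_less_top_iff: "(SUP n::nat. x n) < (\<infinity>::ennreal) \<longleftrightarrow> (\<exists>B::real. \<forall>n. x n \<le> ennreal B)"
proof
  assume *: "(SUP n. x n) < \<infinity>"
  then obtain B where "(SUP n. x n) = ennreal B" by (cases "SUP n. x n") auto
  then have "x n \<le> ennreal B" for n by (metis SUP_upper UNIV_I)
  then show "\<exists>B::real. \<forall>n. x n \<le> ennreal B" by blast
next
  assume "\<exists>B::real. \<forall>n. x n \<le> ennreal B"
  then obtain B :: real where "(SUP n. x n) \<le> ennreal B" by (auto intro: SUP_least)
  then show "(SUP n. x n) < \<infinity>" by (rule order.strict_trans1) simp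
qed

lemma wboundedI_ennreal: "(\<And>n. unorm M h (F n) * w n \<le> B) \<Longrightarrow> B < \<infinity> \<Longrightarrow> wbounded M h w F"
  unfolding wbounded_def by (cases B) auto

text \<open>Only an inequality: at 0 and at infinity the product is 0 by the convention for
  \<open>0 * \<infinity>\<close>.\<close>

lemma ennreal_times_inverse_le: "x * inverse x \<le> (1::ennreal)"
proof (cases "x = 0 \<or> x = \<infinity>")
  case False
  then have "x * inverse x = 1" by (intro ennreal_divide_self[unfolded divide_ennreal_def]) (auto simp: top.not_eq_extremum)
  then show ?thesis by simp
qed auto

text \<open>Finiteness of \<open>Y\<close> settles the infinite weight: it forces
  \<open>x = 0\<close>, in agreement with the inverse of infinity being 0. A zero weight must be
  excluded, as it would say nothing about \<open>x\<close>.\<close>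

lemma ennreal_le_times_inverse:
  fixes x w Y :: ennreal
  assumes "x * w \<le> Y" "Y < \<infinity>" "w \<noteq> 0"
  shows "x \<le> Y * inverse w"
proof (cases "w = \<infinity>")
  case True
  then have "x = 0" using assms by (cases "x = 0") (auto simp: ennreal_mult_top top_unique)
  then show ?thesis by simp
next
  case False
  then have "w * inverse w = 1"
    using assms(3) by (intro ennreal_divide_self[unfolded divide_ennreal_def]) (auto simp: top.not_eq_extremum)
  then have "x = x * w * inverse w" by (simp add: mult.assoc)
  also have "\<dots> \<le> Y * inverse w" using assms(1) by (rule mult_right_mono) simp
  finally show ?thesis .
qed

lemma ennreal_inverse_antimono:
  assumes "a \<le> (b::ennreal)"
  shows "inverse b \<le> inverse a"
proof (cases "a = 0")
  case False
  have "inverse b * a \<le> 1"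
    using mult_left_mono[OF assms, of "inverse b"] ennreal_times_inverse_le[of b]
    by (simp add: mult.commute)
  from ennreal_le_times_inverse[OF this _ False] show ?thesis by simp
qed simp

text \<open>Since (2n + 1)(2n + 3) is just below 4(n + 1)^2, each inverse square is at most 2/(2n +
  1) - 2/(2n + 3), and these differences telescope. The numerator 4 accounts for both signs of
  \<open>k\<close>.\<close>

lemma sum_inverse_squares_tail:
  "(\<Sum>k\<in>{- int N'..int N'}. if \<bar>k\<bar> > int N then 1 / (of_int k)\<^sup>2 else 0) \<le> 4 / (2 * real N + 1)"
proof -
  let ?f = "\<lambda>k. if \<bar>k\<bar> > int N then 1 / (real_of_int k)\<^sup>2 else 0"
  \<comment> \<open>The subtracted remainder is what carries the induction on \<open>N'\<close>; at
    \<open>N' = N\<close> both branches agree, so telescoping starts from zero.\<close>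
  have "(\<Sum>k\<in>{- int N'..int N'}. ?f k) \<le> (if N' \<le> N then 0 else 4 / (2 * real N + 1) - 4 / (2 * real N' + 1))"
  proof (induction N')
    case 0 show ?case by simp
  next
    case (Suc n)
    have "{- int (Suc n)..int (Suc n)} = insert (int (Suc n)) (insert (- int (Suc n)) {- int n..int n})"
      by auto
    moreover have "?f (- int (Suc n)) = ?f (int (Suc n))"
      by (simp only: abs_minus_cancel of_int_minus power2_minus)
    ultimately have eq: "(\<Sum>k\<in>{- int (Suc n)..int (Suc n)}. ?f k)
        = 2 * ?f (int (Suc n)) + (\<Sum>k\<in>{- int n..int n}. ?f k)"
      by (simp only:) (subst sum.insert, auto)+
    show ?case
    proof (cases "Suc n \<le> N")
      case True
      then show ?thesis using Suc unfolding eq by simp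
    next
      case False
      have "1 / (real (Suc n))\<^sup>2 \<le> 2 / (2 * real n + 1) - 2 / (2 * real (Suc n) + 1)"
      proof -
        have "2 / (2 * real n + 1) - 2 / (2 * real (Suc n) + 1) = 4 / ((2 * real n + 1) * (2 * real n + 3))"
          by (simp add: field_simps)
        also have "\<dots> \<ge> 4 / (4 * (real (Suc n))\<^sup>2)"
        proof (rule frac_le)
          show "0 < (2 * real n + 1) * (2 * real n + 3)" by (intro mult_pos_pos) auto
          show "(2 * real n + 1) * (2 * real n + 3) \<le> 4 * (real (Suc n))\<^sup>2"
            by (simp add: power2_eq_square algebra_simps)
        qed auto
        finally show ?thesis by simp
      qed
      then have "2 * ?f (int (Suc n)) \<le> 4 / (2 * real n + 1) - 4 / (2 * real (Suc n) + 1)"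
        using False by simp
      moreover have "(\<Sum>k\<in>{- int n..int n}. ?f k) \<le> 4 / (2 * real N + 1) - 4 / (2 * real n + 1)"
        using Suc False by (cases "n = N") auto
      ultimately show ?thesis using False unfolding eq by simp
    qed
  qed
  also have "\<dots> \<le> 4 / (2 * real N + 1)" by simp
  finally show ?thesis .
qed

context weight_sequence
begin

lemma ultra_h_antimono:
  assumes "0 \<le> h'" "h' \<le> h" "f \<in> ultra_h M h"
  shows "f \<in> ultra_h M h'"
  using assms unorm_mono[OF assms(1,2), of f] by (auto simp: ultra_h_def intro: order.strict_trans1)

lemma ultra_h_lincomb:
  assumes "f \<in> ultra_h M h" "g \<in> ultra_h M h"
  shows "(\<lambda>t. a * f t + b * g t) \<in> ultra_h M h"
proof -
  have "unorm M h (\<lambda>t. a * f t + b * g t) \<le> ennreal (cmod a) * unorm M h f + ennreal (cmod b) * unorm M h g"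
    using assms by (intro unorm_lincomb) (auto simp: ultra_h_def)
  also have "\<dots> < \<infinity>" using assms by (auto simp: ultra_h_def ennreal_mult_less_top)
  finally show ?thesis using assms by (auto simp: ultra_h_def smooth_periodic_lincomb)
qed

lemma ultra_lincomb:
  assumes "f \<in> ultra cls M" "g \<in> ultra cls M"
  shows "(\<lambda>t. a * f t + b * g t) \<in> ultra cls M"
proof -
  have "for_scale cls (\<lambda>h. f \<in> ultra_h M h \<and> g \<in> ultra_h M h)"
    using assms by (intro for_scale_conj) (auto simp: ultra_iff intro: ultra_h_antimono)
  then show ?thesis unfolding ultra_iff by (rule for_scale_mono) (auto intro: ultra_h_lincomb)
qed

lemma ultra_add: "f \<in> ultra cls M \<Longrightarrow> g \<in> ultra cls M \<Longrightarrow> (\<lambda>t. f t + g t) \<in> ultra cls M"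
  using ultra_lincomb[of f cls g 1 1] by simp

lemma ultra_diff: "f \<in> ultra cls M \<Longrightarrow> g \<in> ultra cls M \<Longrightarrow> (\<lambda>t. f t - g t) \<in> ultra cls M"
  using ultra_lincomb[of f cls g 1 "-1"] by simp

lemma ultra_cmult: "f \<in> ultra cls M \<Longrightarrow> (\<lambda>t. c * f t) \<in> ultra cls M"
  using ultra_lincomb[of f cls f c 0] by simp

lemma ultra_h_zero: "(\<lambda>t. 0) \<in> ultra_h M h"
proof -
  have "unorm M h (\<lambda>t. 0) \<le> 0" by (rule unorm_leI) (simp add: Dop_funpow_zero)
  then show ?thesis by (simp add: ultra_h_def smooth_periodic_const)
qed

lemma ultra_zero: "(\<lambda>t. 0) \<in> ultra cls M"
  by (cases cls) (auto simp: ultra_h_zero intro: exI[of _ 1])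

lemma ultra_mult:
  assumes "f \<in> ultra cls M" "g \<in> ultra cls M"
  shows "(\<lambda>t. f t * g t) \<in> ultra cls M"
proof -
  have "for_scale cls (\<lambda>h. f \<in> ultra_h M h \<and> g \<in> ultra_h M h)"
    using assms by (intro for_scale_conj) (auto simp: ultra_iff intro: ultra_h_antimono)
  then show ?thesis unfolding ultra_iff
  proof (rule for_scale_map[where c = "1/2"])
    fix h :: real assume h: "h > 0" and fg: "f \<in> ultra_h M h \<and> g \<in> ultra_h M h"
    then have "unorm M (1/2 * h) (\<lambda>t. f t * g t) \<le> unorm M h f * unorm M h g"
      using unorm_mult[of f "h/2" g] by simp
    also have "\<dots> < \<infinity>" using fg by (auto simp: ultra_h_def ennreal_mult_less_top)
    finally show "(\<lambda>t. f t * g t) \<in> ultra_h M (1/2 * h)"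
      using fg by (auto simp: ultra_h_def smooth_periodic_mult)
  qed simp
qed

lemma ultra_sum:
  assumes "finite K" "\<And>k. k \<in> K \<Longrightarrow> f k \<in> ultra cls M"
  shows "(\<lambda>t. \<Sum>k\<in>K. d k * f k t) \<in> ultra cls M"
  using assms
  by (induction K) (auto simp: ultra_zero intro!: ultra_add ultra_cmult)

lemma unorm_echar_le: "h > 0 \<Longrightarrow> unorm M h (echar k) \<le> weight M (h * of_int k)"
proof (rule unorm_leI)
  fix p t assume "h > 0"
  then have "ennreal (h ^ p / M p) * ennreal (cmod ((Dop ^^ p) (echar k) t)) = ennreal (\<bar>h * of_int k\<bar> ^ p / M p)"
    by (simp add: Dop_funpow_echar norm_mult norm_power ennreal_mult[symmetric] abs_mult power_mult_distrib)
  then show "ennreal (h ^ p / M p) * ennreal (cmod ((Dop ^^ p) (echar k) t)) \<le> weight M (h * of_int k)"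
    using weight_ge by simp
qed

text \<open>With h = 1/t the inequality \<open>1 \<le> C * h ^ p * M p\<close> says that
  \<open>C\<close> bounds all terms of the weight at \<open>t\<close>. The two growth conditions
  thus mean finite weights everywhere, respectively at some positive point.\<close>

lemma weight_finite:
  assumes "cond_one cls M"
  shows "for_scale cls (\<lambda>t. weight M t < \<infinity>)"
proof -
  have *: "weight M t < \<infinity>" if "t > 0" "\<forall>p. 1 \<le> C * (1/t) ^ p * M p" for C t
  proof -
    have "t ^ p / M p \<le> C" for p
      using that M_pos[of p] by (simp add: field_simps power_divide)
    then have "weight M t \<le> ennreal C"
      unfolding weight_def using that(1) by (auto intro!: SUP_least ennreal_leI)
    then show ?thesis by (rule order.strict_trans1) simp
  qed
  show ?thesis
  proof (cases cls)
    case Beurling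
    have "weight M t < \<infinity>" if "t > 0" for t
      using assms Beurling *[OF that] that by (simp add: one_prec_def) (meson zero_less_divide_1_iff)
    then show ?thesis using Beurling by simp
  next
    case Roumieu
    then obtain C h where "h > 0" "\<forall>p. 1 \<le> C * h ^ p * M p"
      using assms by (auto simp: one_subset_def)
    then show ?thesis using Roumieu *[of "1/h" C] by (auto intro!: exI[of _ "1/h"])
  qed
qed

lemma ultra_echar:
  assumes "cond_one cls M"
  shows "echar k \<in> ultra cls M"
proof -
  \<comment> \<open>Shrinking the scale by this factor keeps the argument of the weight below
    \<open>t\<close>; the summand 1 covers \<open>k = 0\<close>.\<close>
  have "1 / (\<bar>real_of_int k\<bar> + 1) > 0" by simp
  with weight_finite[OF assms] show ?thesis
    unfolding ultra_iff
  proof (rule for_scale_map)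
    fix t :: real assume t: "t > 0" "weight M t < \<infinity>"
    let ?h = "1 / (\<bar>real_of_int k\<bar> + 1) * t"
    have "unorm M ?h (echar k) \<le> weight M (?h * of_int k)"
      using t by (intro unorm_echar_le) auto
    also have "\<dots> \<le> weight M t"
      using t by (intro weight_mono) (auto simp: abs_mult divide_simps)
    finally show "echar k \<in> ultra_h M ?h"
      using t by (auto simp: ultra_h_def smooth_periodic_echar)
  qed
qed

lemma ultra_trig_poly:
  assumes "cond_one cls M" "finite K"
  shows "(\<lambda>t. \<Sum>k\<in>K. d k * echar k t) \<in> ultra cls M"
  using assms by (intro ultra_sum ultra_echar)

text \<open>The term p = 2 of the weight is enough for summability over the frequencies.\<close>

lemma inverse_weight_le:
  assumes "h > 0" "k \<noteq> 0"
  shows "inverse (weight M (h * of_int k)) \<le> ennreal (M 2 / h\<^sup>2 / (of_int k)\<^sup>2)"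
proof -
  have "inverse (weight M (h * of_int k)) \<le> inverse (ennreal (\<bar>h * of_int k\<bar>\<^sup>2 / M 2))"
    by (rule ennreal_inverse_antimono[OF weight_ge])
  also have "\<dots> = ennreal (M 2 / h\<^sup>2 / (of_int k)\<^sup>2)"
    using assms M_pos[of 2] by (subst inverse_ennreal) (auto simp: field_simps)
  finally show ?thesis .
qed

text \<open>The explicit rate in \<open>N\<close> later gives convergence of Fourier series in norm;
  the case \<open>N = 0\<close> gives the full sum apart from \<open>k = 0\<close>.\<close>

lemma inverse_weight_sum_tail:
  assumes "h > 0"
  shows "(\<Sum>k\<in>{- int N'..int N'}. if \<bar>k\<bar> > int N then inverse (weight M (h * of_int k)) else 0)
    \<le> ennreal (M 2 / h\<^sup>2 * (4 / (2 * real N + 1)))"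
proof -
  let ?f = "\<lambda>k. if \<bar>k\<bar> > int N then 1 / (real_of_int k)\<^sup>2 else 0"
  have "(\<Sum>k\<in>{- int N'..int N'}. if \<bar>k\<bar> > int N then inverse (weight M (h * of_int k)) else 0)
      \<le> (\<Sum>k\<in>{- int N'..int N'}. ennreal (M 2 / h\<^sup>2 * ?f k))"
    by (intro sum_mono) (use inverse_weight_le[OF assms] in \<open>auto simp: mult.commute\<close>)
  also have "\<dots> = ennreal (M 2 / h\<^sup>2 * (\<Sum>k\<in>{- int N'..int N'}. ?f k))"
    using assms by (subst sum_ennreal) (auto simp: sum_distrib_left)
  also have "\<dots> \<le> ennreal (M 2 / h\<^sup>2 * (4 / (2 * real N + 1)))"
    using assms by (intro ennreal_leI mult_left_mono sum_inverse_squares_tail) auto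
  finally show ?thesis .
qed

lemma inverse_weight_sum:
  assumes "h > 0"
  shows "(\<Sum>k\<in>{- int N..int N}. inverse (weight M (h * of_int k))) \<le> ennreal (1 + 4 * M 2 / h\<^sup>2)"
proof -
  let ?g = "\<lambda>k::int. inverse (weight M (h * of_int k))"
  have "(\<Sum>k\<in>{- int N..int N}. ?g k)
      = (\<Sum>k\<in>{- int N..int N}. (if k = 0 then ?g k else 0) + (if \<bar>k\<bar> > int 0 then ?g k else 0))"
    by (intro sum.cong) auto
  also have "\<dots> = ?g 0 + (\<Sum>k\<in>{- int N..int N}. (if \<bar>k\<bar> > int 0 then ?g k else 0))"
    by (simp add: sum.distrib sum.delta)
  also have "\<dots> \<le> 1 + ennreal (M 2 / h\<^sup>2 * (4 / (2 * real 0 + 1)))"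
    by (intro add_mono inverse_weight_sum_tail assms) (use weight_ge_1 ennreal_inverse_antimono[of 1] in auto)
  also have "\<dots> = ennreal (1 + 4 * M 2 / h\<^sup>2)"
    using assms by (subst ennreal_plus) (auto simp: mult.commute)
  finally show ?thesis .
qed

section \<open>Negligible and bounded sequences\<close>

lemma wbounded_antimono:
  assumes "wbounded M h w F" "0 \<le> h'" "h' \<le> h" "\<And>n. w' n \<le> w n"
  shows "wbounded M h' w' F"
proof -
  obtain B :: real where B: "\<And>n. unorm M h (F n) * w n \<le> ennreal B"
    using assms(1) by (auto simp: wbounded_def)
  have "unorm M h' (F n) * w' n \<le> ennreal B" for n
    by (rule order_trans[OF mult_mono[OF unorm_mono[OF assms(2,3)] assms(4)] B]) auto
  then show ?thesis by (auto simp: wbounded_def)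
qed

lemma wbounded_lincomb:
  assumes "wbounded M h w F" "wbounded M h w G"
    and "\<And>n. F n \<in> smooth_periodic" "\<And>n. G n \<in> smooth_periodic"
  shows "wbounded M h w (\<lambda>n t. a * F n t + b * G n t)"
proof -
  obtain B B' :: real where B: "\<And>n. unorm M h (F n) * w n \<le> ennreal B"
    and B': "\<And>n. unorm M h (G n) * w n \<le> ennreal B'"
    using assms(1,2) by (auto simp: wbounded_def)
  have "unorm M h (\<lambda>t. a * F n t + b * G n t) * w n
     \<le> ennreal (cmod a) * ennreal B + ennreal (cmod b) * ennreal B'" for n
  proof -
    have "unorm M h (\<lambda>t. a * F n t + b * G n t) * w n
      \<le> (ennreal (cmod a) * unorm M h (F n) + ennreal (cmod b) * unorm M h (G n)) * w n"
      by (intro mult_right_mono unorm_lincomb assms) auto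
    also have "\<dots> = ennreal (cmod a) * (unorm M h (F n) * w n) + ennreal (cmod b) * (unorm M h (G n) * w n)"
      by (simp add: distrib_right mult.assoc)
    also have "\<dots> \<le> ennreal (cmod a) * ennreal B + ennreal (cmod b) * ennreal B'"
      by (intro add_mono mult_left_mono B B') auto
    finally show ?thesis .
  qed
  then show ?thesis by (rule wboundedI_ennreal) (simp add: ennreal_mult_less_top)
qed

text \<open>The weight is carried by the second factor alone. From \<open>1 \<le> w\<close> its
  norms are bounded too, so \<open>unorm_mult\<close> applies.\<close>

lemma wbounded_mult:
  assumes F: "wbounded M (2 * h) (\<lambda>_. 1) F" and G: "wbounded M (2 * h) w G"
    and sm: "\<And>n. F n \<in> smooth_periodic" "\<And>n. G n \<in> smooth_periodic"
    and "h > 0" "\<And>n. 1 \<le> w n"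
  shows "wbounded M h w (\<lambda>n t. F n t * G n t)"
proof -
  obtain B B' :: real where B: "\<And>n. unorm M (2*h) (F n) * 1 \<le> ennreal B"
    and B': "\<And>n. unorm M (2*h) (G n) * w n \<le> ennreal B'"
    using F G by (auto simp: wbounded_def)
  have "unorm M h (\<lambda>t. F n t * G n t) * w n \<le> ennreal B * ennreal B'" for n
  proof -
    have "F n \<in> ultra_h M (2*h)"
      using sm B[of n] by (auto simp: ultra_h_def intro: order.strict_trans1)
    moreover have "G n \<in> ultra_h M (2*h)"
      using sm order_trans[OF mult_left_mono[OF assms(6)[of n], of "unorm M (2*h) (G n)"] B'[of n]]
      by (auto simp: ultra_h_def intro: order.strict_trans1)
    ultimately have "unorm M h (\<lambda>t. F n t * G n t) * w n \<le> unorm M (2*h) (F n) * unorm M (2*h) (G n) * w n"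
      by (intro mult_right_mono unorm_mult assms) auto
    also have "\<dots> \<le> ennreal B * ennreal B'"
      using B[of n] B'[of n] unfolding mult.assoc by (intro mult_mono) auto
    finally show ?thesis .
  qed
  then show ?thesis by (rule wboundedI_ennreal) (simp add: ennreal_mult_less_top)
qed

lemma scaled_weight_mono: "0 \<le> a \<Longrightarrow> a \<le> b \<Longrightarrow> weight M (a * real n) \<le> weight M (b * real n)"
  by (intro weight_mono) (simp add: abs_mult mult_right_mono)

text \<open>Norm and weight both grow with their parameters, so the two scales can be tied together:
  to the larger one under universal quantifiers, to the smaller one under existential
  quantifiers.\<close>

lemma negligible_iff:
  "F \<in> negligible_seqs cls M \<longleftrightarrow> (\<forall>n. F n \<in> ultra cls M) \<and>
    for_scale cls (\<lambda>h. wbounded M h (\<lambda>n. weight M (h * real n)) F)"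
proof (cases cls)
  case Beurling
  have "wbounded M h (\<lambda>n. weight M (\<mu> * real n)) F"
    if "\<forall>h>0. wbounded M h (\<lambda>n. weight M (h * real n)) F" "h > 0" "\<mu> > 0" for h \<mu>
    by (rule wbounded_antimono[of "max h \<mu>" "\<lambda>n. weight M (max h \<mu> * real n)"])
      (use that scaled_weight_mono in auto)
  then show ?thesis using Beurling
    unfolding negligible_seqs_def exp_ereal_assoc_fun SUP_less_top_iff wbounded_def[symmetric] by auto
next
  case Roumieu
  have "wbounded M (min h \<mu>) (\<lambda>n. weight M (min h \<mu> * real n)) F"
    if "wbounded M h (\<lambda>n. weight M (\<mu> * real n)) F" "h > 0" "\<mu> > 0" for h \<mu>
    by (rule wbounded_antimono[OF that(1)]) (use that scaled_weight_mono in auto)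
  then have "(\<exists>\<mu>>0. \<exists>h>0. wbounded M h (\<lambda>n. weight M (\<mu> * real n)) F) \<longleftrightarrow>
      (\<exists>h>0. wbounded M h (\<lambda>n. weight M (h * real n)) F)"
    by (metis min_less_iff_conj)
  then show ?thesis using Roumieu
    unfolding negligible_seqs_def exp_ereal_assoc_fun SUP_less_top_iff wbounded_def[symmetric] by auto
qed

lemma wbounded_weight_antimono:
  "0 < h' \<Longrightarrow> h' \<le> h \<Longrightarrow> wbounded M h (\<lambda>n. weight M (h * real n)) F
    \<Longrightarrow> wbounded M h' (\<lambda>n. weight M (h' * real n)) F"
  by (erule wbounded_antimono) (use scaled_weight_mono in auto)

lemma wbounded_1_antimono:
  "0 < h' \<Longrightarrow> h' \<le> h \<Longrightarrow> wbounded M h (\<lambda>n. 1) F \<Longrightarrow> wbounded M h' (\<lambda>n. 1) F"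
  by (erule wbounded_antimono) auto

lemma negligible_lincomb:
  assumes "F \<in> negligible_seqs cls M" "G \<in> negligible_seqs cls M"
  shows "(\<lambda>n t. a * F n t + b * G n t) \<in> negligible_seqs cls M"
proof -
  have u: "\<And>n. F n \<in> ultra cls M" "\<And>n. G n \<in> ultra cls M" using assms by (auto simp: negligible_iff)
  have "for_scale cls (\<lambda>h. wbounded M h (\<lambda>n. weight M (h * real n)) F \<and> wbounded M h (\<lambda>n. weight M (h * real n)) G)"
    by (rule for_scale_conj[OF _ _ wbounded_weight_antimono wbounded_weight_antimono])
      (use assms in \<open>auto simp: negligible_iff\<close>)
  then have "for_scale cls (\<lambda>h. wbounded M h (\<lambda>n. weight M (h * real n)) (\<lambda>n t. a * F n t + b * G n t))"
    by (rule for_scale_mono) (auto intro!: wbounded_lincomb ultra_smooth u)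
  then show ?thesis using u by (auto simp: negligible_iff ultra_lincomb)
qed

lemma negligible_zero: "(\<lambda>n t. 0) \<in> negligible_seqs cls M"
proof -
  have "unorm M h (\<lambda>t. 0) = 0" for h
    using unorm_leI[of h M "\<lambda>t. 0" 0] by (simp add: Dop_funpow_zero)
  then have "wbounded M h w (\<lambda>n t. 0)" for h w by (simp add: wbounded_def)
  then show ?thesis by (cases cls) (auto simp: negligible_iff ultra_h_zero intro: exI[of _ 1])
qed

text \<open>The setting for products: it contains constant and negligible sequences, and negligible
  sequences absorb it under multiplication. That covers the products of classes of test
  functions.\<close>

definition bounded_seqs :: "ultra_class \<Rightarrow> (nat \<Rightarrow> real \<Rightarrow> complex) set" where
  "bounded_seqs cls = {F. (\<forall>n. F n \<in> ultra cls M) \<and> for_scale cls (\<lambda>h. wbounded M h (\<lambda>n. 1) F)}"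

lemma negligible_bounded: "negligible_seqs cls M \<subseteq> bounded_seqs cls"
proof
  fix F assume F: "F \<in> negligible_seqs cls M"
  then have "for_scale cls (\<lambda>h. wbounded M h (\<lambda>n. weight M (h * real n)) F)"
    by (simp add: negligible_iff)
  then have "for_scale cls (\<lambda>h. wbounded M h (\<lambda>n. 1) F)"
    by (rule for_scale_mono) (erule wbounded_antimono, auto simp: weight_ge_1)
  then show "F \<in> bounded_seqs cls" using F by (simp add: negligible_iff bounded_seqs_def)
qed

lemma bounded_seqs_add:
  assumes "F \<in> bounded_seqs cls" "G \<in> bounded_seqs cls"
  shows "(\<lambda>n t. F n t + G n t) \<in> bounded_seqs cls"
proof -
  have u: "\<And>n. F n \<in> ultra cls M" "\<And>n. G n \<in> ultra cls M" using assms by (auto simp: bounded_seqs_def)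
  have "for_scale cls (\<lambda>h. wbounded M h (\<lambda>n. 1) F \<and> wbounded M h (\<lambda>n. 1) G)"
    by (rule for_scale_conj[OF _ _ wbounded_1_antimono wbounded_1_antimono])
      (use assms in \<open>auto simp: bounded_seqs_def\<close>)
  then have "for_scale cls (\<lambda>h. wbounded M h (\<lambda>n. 1) (\<lambda>n t. 1 * F n t + 1 * G n t))"
    by (rule for_scale_mono) (rule wbounded_lincomb, auto intro!: ultra_smooth u)
  then show ?thesis using u by (auto simp: bounded_seqs_def ultra_add)
qed

lemma bounded_seqs_const: "f \<in> ultra cls M \<Longrightarrow> (\<lambda>n. f) \<in> bounded_seqs cls"
  unfolding bounded_seqs_def ultra_iff
  by (auto elim!: for_scale_mono intro: wboundedI_ennreal simp: ultra_h_def)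

lemma negligible_mult:
  assumes "F \<in> bounded_seqs cls" "G \<in> negligible_seqs cls M"
  shows "(\<lambda>n t. F n t * G n t) \<in> negligible_seqs cls M"
proof -
  have u: "\<And>n. F n \<in> ultra cls M" "\<And>n. G n \<in> ultra cls M"
    using assms by (auto simp: bounded_seqs_def negligible_iff)
  have "for_scale cls (\<lambda>h. wbounded M h (\<lambda>n. 1) F \<and> wbounded M h (\<lambda>n. weight M (h * real n)) G)"
    by (rule for_scale_conj[OF _ _ wbounded_1_antimono wbounded_weight_antimono])
      (use assms in \<open>auto simp: bounded_seqs_def negligible_iff\<close>)
  then have "for_scale cls (\<lambda>h. wbounded M h (\<lambda>n. weight M (h * real n)) (\<lambda>n t. F n t * G n t))"
  proof (rule for_scale_map[where c = "1/2"])
    fix h :: real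
    assume h: "h > 0" "wbounded M h (\<lambda>n. 1) F \<and> wbounded M h (\<lambda>n. weight M (h * real n)) G"
    have "wbounded M h (\<lambda>n. weight M (1/2 * h * real n)) G"
      by (rule wbounded_antimono[of h "\<lambda>n. weight M (h * real n)"])
        (use h in \<open>auto intro!: weight_mono simp: abs_mult\<close>)
    then show "wbounded M (1/2 * h) (\<lambda>n. weight M (1/2 * h * real n)) (\<lambda>n t. F n t * G n t)"
      using h by (intro wbounded_mult ultra_smooth[OF u(1)] ultra_smooth[OF u(2)]) (auto simp: weight_ge_1)
  qed simp
  then show ?thesis using u by (auto simp: negligible_iff ultra_mult)
qed

end

section \<open>Ultradifferential operators\<close>

text \<open>The majorant is geometric in \<open>n\<close> and uniform in \<open>t\<close> at every
  order \<open>p\<close>. The Weierstrass test then makes the differentiated series converge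
  uniformly, which permits termwise differentiation; the factor 2 is the sum of the geometric
  series.\<close>

lemma
  assumes f: "f \<in> smooth_periodic"
    and bnd: "\<And>n p t. cmod (a n * (Dop ^^ (n + p)) f t) \<le> B p * (1/2) ^ n"
  shows ultradiff_summable: "summable (\<lambda>n. a n * (Dop ^^ (n + p)) f t)"
    and smooth_periodic_ultradiff: "ultradiff a f \<in> smooth_periodic"
    and norm_Dop_funpow_ultradiff: "cmod ((Dop ^^ p) (ultradiff a f) t) \<le> 2 * B p"
proof -
  \<comment> \<open>The series with every term differentiated \<open>p\<close> more times; these
    form a family as required by \<open>Dop_funpow_family\<close>, starting at
    \<open>ultradiff a f\<close>.\<close>
  define G where "G p t = (\<Sum>n. a n * (Dop ^^ (n + p)) f t)" for p t
  have sb: "summable (\<lambda>n. B p * (1/2) ^ n)" for p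
    by (intro summable_mult summable_geometric) simp
  have sm: "summable (\<lambda>n. a n * (Dop ^^ (n + p)) f t)" for p t
    by (rule summable_comparison_test'[OF sb[of p] bnd])
  then show "summable (\<lambda>n. a n * (Dop ^^ (n + p)) f t)" .
  have sf: "smooth_fun f" "periodic f" using f by (auto simp: smooth_periodic_iff)
  have deriv: "(G p has_vector_derivative \<i> * G (Suc p) t) (at t)" for p t
  proof -
    define f' where "f' n x = \<i> * (a n * (Dop ^^ (n + Suc p)) f x)" for n x
    have "\<exists>g. \<forall>x\<in>UNIV. (\<lambda>n. a n * (Dop ^^ (n + p)) f x) sums g x
        \<and> (g has_derivative (\<lambda>h. h *\<^sub>R (\<i> * G (Suc p) x))) (at x within UNIV)"
    proof (rule has_derivative_series)
      show "((\<lambda>x. a n * (Dop ^^ (n + p)) f x) has_derivative (\<lambda>h. h *\<^sub>R f' n x)) (at x within UNIV)" for n x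
        using has_vector_derivative_mult_right[OF smooth_fun_deriv[OF sf(1), of "n + p" x], of "a n"]
        by (simp add: has_vector_derivative_def f'_def mult_ac)
      show "\<forall>\<^sub>F n in sequentially. \<forall>x\<in>UNIV. \<forall>h.
          norm ((\<Sum>i<n. h *\<^sub>R f' i x) - h *\<^sub>R (\<i> * G (Suc p) x)) \<le> e * norm h"
        if "e > 0" for e :: real
      proof -
        have "uniform_limit UNIV (\<lambda>n x. \<Sum>i<n. a i * (Dop ^^ (i + Suc p)) f x) (G (Suc p)) sequentially"
          unfolding G_def using bnd sb by (rule Weierstrass_m_test)
        then have "\<forall>\<^sub>F n in sequentially. \<forall>x\<in>UNIV.
            dist (\<Sum>i<n. a i * (Dop ^^ (i + Suc p)) f x) (G (Suc p) x) < e"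
          using that by (rule uniform_limitD)
        then show ?thesis
        proof (eventually_elim, intro ballI allI)
          fix n x and h :: real
          assume *: "\<forall>x\<in>UNIV. dist (\<Sum>i<n. a i * (Dop ^^ (i + Suc p)) f x) (G (Suc p) x) < e"
          have "(\<Sum>i<n. h *\<^sub>R f' i x) - h *\<^sub>R (\<i> * G (Suc p) x)
              = h *\<^sub>R (\<i> * ((\<Sum>i<n. a i * (Dop ^^ (i + Suc p)) f x) - G (Suc p) x))"
            by (simp add: f'_def scaleR_sum_right[symmetric] sum_distrib_left[symmetric] algebra_simps)
          then have "norm ((\<Sum>i<n. h *\<^sub>R f' i x) - h *\<^sub>R (\<i> * G (Suc p) x))
              = \<bar>h\<bar> * cmod ((\<Sum>i<n. a i * (Dop ^^ (i + Suc p)) f x) - G (Suc p) x)"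
            by (simp add: norm_mult)
          also have "\<dots> \<le> \<bar>h\<bar> * e"
            using * by (intro mult_left_mono) (auto simp: dist_norm less_imp_le)
          finally show "norm ((\<Sum>i<n. h *\<^sub>R f' i x) - h *\<^sub>R (\<i> * G (Suc p) x)) \<le> e * norm h"
            by (simp add: mult.commute)
        qed
      qed
      show "(\<lambda>n. a n * (Dop ^^ (n + p)) f 0) sums G p 0"
        unfolding G_def by (rule summable_sums[OF sm])
    qed auto
    then obtain g where g: "\<And>x. (\<lambda>n. a n * (Dop ^^ (n + p)) f x) sums g x"
      "\<And>x. (g has_derivative (\<lambda>h. h *\<^sub>R (\<i> * G (Suc p) x))) (at x)" by auto
    have "g = G p" using g(1) by (auto simp: fun_eq_iff G_def sums_iff)
    then show ?thesis using g(2) by (simp add: has_vector_derivative_def)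
  qed
  have G0: "G 0 = ultradiff a f" by (simp add: G_def ultradiff_def fun_eq_iff)
  note fam = Dop_funpow_family[of G, OF deriv, unfolded G0]
  show "ultradiff a f \<in> smooth_periodic"
    using fam(2) periodic_Dop_funpow[OF sf(2)] by (simp add: smooth_periodic_iff periodic_def ultradiff_def)
  have "cmod (G p t) \<le> (\<Sum>n. B p * (1/2) ^ n)"
    unfolding G_def by (rule norm_suminf_le[OF bnd sb])
  also have "\<dots> = 2 * B p" by (subst suminf_mult) (auto simp: suminf_geometric)
  finally show "cmod ((Dop ^^ p) (ultradiff a f) t) \<le> 2 * B p" by (simp add: fam(1))
qed

context weight_sequence
begin

text \<open>For Beurling operators \<open>L\<close> is given and \<open>h'\<close> is chosen large;
  for Roumieu operators \<open>h'\<close> is given and \<open>L\<close> is chosen as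
  \<open>h' / (2 * H)\<close>. The two scale inequalities leave a ratio of at most 1/2 in the
  operator series and absorb the \<open>H ^ p\<close> of (M.2).\<close>

lemma ultradiff_coeffs_scale:
  assumes "ultradiff_coeffs cls M a" "for_scale cls P"
  shows "for_scale cls (\<lambda>h. \<exists>h' C L. P h' \<and> H * h \<le> h' \<and> 0 < C \<and> 0 < L \<and> 2 * L * H \<le> h'
    \<and> (\<forall>n. cmod (a n) \<le> C * L ^ n / M n))"
proof (cases cls)
  case Beurling
  then obtain L C where LC: "L > 0" "C > 0" "\<forall>n. cmod (a n) \<le> C * L ^ n / M n"
    using assms(1) by (auto simp: ultradiff_coeffs_def)
  show ?thesis unfolding Beurling for_scale.simps
  proof (intro allI impI)
    fix h :: real assume "h > 0"
    then have "max (2 * L * H) (H * h) > 0" using H_pos by (simp add: less_max_iff_disj)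
    then have "P (max (2 * L * H) (H * h))" using assms(2) Beurling by simp
    then show "\<exists>h' C L. P h' \<and> H * h \<le> h' \<and> 0 < C \<and> 0 < L \<and> 2 * L * H \<le> h'
      \<and> (\<forall>n. cmod (a n) \<le> C * L ^ n / M n)"
      using LC by (intro exI[of _ "max (2 * L * H) (H * h)"] exI[of _ C] exI[of _ L]) auto
  qed
next
  case Roumieu
  then obtain h' where h': "h' > 0" "P h'" using assms(2) by auto
  then have L: "h' / (2 * H) > 0" by simp
  then obtain C where C: "C > 0" "\<forall>n. cmod (a n) \<le> C * (h' / (2 * H)) ^ n / M n"
    using assms(1) Roumieu unfolding ultradiff_coeffs_def by auto
  have "2 * (h' / (2 * H)) * H \<le> h'" "H * (h' / H) \<le> h'" "h' / H > 0"
    using H_pos h'(1) by (simp_all add: less_imp_neq[OF H_pos, symmetric])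
  then show ?thesis unfolding Roumieu for_scale.simps using h' L C
    by (intro exI[of _ "h' / H"] exI[of _ h'] exI[of _ C] exI[of _ "h' / (2 * H)"] conjI)
qed

text \<open>(M.2) splits \<open>M (n + p)\<close>, so that \<open>M n\<close> cancels against the
  coefficient bound and \<open>M p\<close> remains for the norm. What is left is geometric in
  \<open>n\<close> with ratio \<open>L * H / h'\<close>, at most 1/2.\<close>

lemma
  assumes f: "f \<in> ultra_h M h'" and h: "0 < h" "H * h \<le> h'" "2 * L * H \<le> h'" "0 < L" "0 < C"
    and a: "\<And>n. cmod (a n) \<le> C * L ^ n / M n"
  shows ultradiff_summable_ultra_h: "summable (\<lambda>n. a n * (Dop ^^ n) f t)"
    and ultradiff_smooth_ultra_h: "ultradiff a f \<in> smooth_periodic"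
    and unorm_ultradiff: "unorm M h (ultradiff a f) \<le> ennreal (2 * C * A) * unorm M h' f"
proof -
  have fs: "f \<in> smooth_periodic" using f by (simp add: ultra_h_def)
  obtain u where u: "unorm M h' f = ennreal u" "u \<ge> 0"
    using f by (cases "unorm M h' f") (auto simp: ultra_h_def)
  have h'0: "h' > 0" using h H_pos by (meson less_le_trans mult_pos_pos)
  have bnd: "cmod (a n * (Dop ^^ (n + p)) f t) \<le> C * A * u * M p / h ^ p * (1/2) ^ n" for n p t
  proof -
    have "cmod (a n * (Dop ^^ (n + p)) f t) \<le> (C * L ^ n / M n) * (u * M (n + p) / h' ^ (n + p))"
      unfolding norm_mult using u h'0 h by (intro mult_mono a unorm_finiteD) auto
    also have "\<dots> \<le> (C * L ^ n / M n) * (u * (A * H ^ (n + p) * M n * M p) / h' ^ (n + p))"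
      using u h h'0 M_2[of n p] by (intro mult_left_mono divide_right_mono) auto
    also have "\<dots> = C * A * u * M p * (H / h') ^ p * (L * H / h') ^ n"
      by (simp add: power_add power_divide power_mult_distrib field_simps)
    also have "\<dots> \<le> C * A * u * M p * (1 / h) ^ p * (1 / 2) ^ n"
    proof (intro mult_mono power_mono)
      show "H / h' \<le> 1 / h" "L * H / h' \<le> 1 / 2" using h h'0 by (simp_all add: field_simps)
    qed (use h u A_ge h'0 H_ge in auto)
    finally show ?thesis by (simp add: power_divide)
  qed
  show "summable (\<lambda>n. a n * (Dop ^^ n) f t)" using ultradiff_summable[OF fs bnd, of 0] by simp
  show "ultradiff a f \<in> smooth_periodic" by (rule smooth_periodic_ultradiff[OF fs bnd])
  have "unorm M h (ultradiff a f) \<le> ennreal (2 * C * A * u)"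
    by (rule unorm_real_leI)
      (use norm_Dop_funpow_ultradiff[OF fs bnd] h u A_ge in \<open>auto simp: mult.assoc\<close>)
  then show "unorm M h (ultradiff a f) \<le> ennreal (2 * C * A) * unorm M h' f"
    using h u A_ge by (simp add: ennreal_mult)
qed

lemma ultradiff_summable_ultra:
  assumes "ultradiff_coeffs cls M a" "f \<in> ultra cls M"
  shows "summable (\<lambda>n. a n * (Dop ^^ n) f t)"
proof -
  have "for_scale cls (\<lambda>h. summable (\<lambda>n. a n * (Dop ^^ n) f t))"
    using ultradiff_coeffs_scale[OF assms[unfolded ultra_iff]]
  proof (rule for_scale_mono, elim exE conjE)
    fix h h' C L
    show "summable (\<lambda>n. a n * (Dop ^^ n) f t)"
      if "f \<in> ultra_h M h'" "0 < h" "H * h \<le> h'" "2 * L * H \<le> h'" "0 < L" "0 < C"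
        "\<forall>n. cmod (a n) \<le> C * L ^ n / M n"
      using that by (intro ultradiff_summable_ultra_h[of f h' h L C a]) auto
  qed
  then show ?thesis by (simp add: for_scale_const)
qed

lemma ultra_ultradiff:
  assumes "ultradiff_coeffs cls M a" "f \<in> ultra cls M"
  shows "ultradiff a f \<in> ultra cls M"
  unfolding ultra_iff using ultradiff_coeffs_scale[OF assms[unfolded ultra_iff]]
proof (rule for_scale_mono)
  fix h :: real assume "h > 0" "\<exists>h' C L. f \<in> ultra_h M h' \<and> H * h \<le> h' \<and> 0 < C \<and> 0 < L \<and> 2 * L * H \<le> h'
    \<and> (\<forall>n. cmod (a n) \<le> C * L ^ n / M n)"
  then obtain h' C L where *: "f \<in> ultra_h M h'" "0 < h" "H * h \<le> h'" "2 * L * H \<le> h'" "0 < L" "0 < C"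
    "\<And>n. cmod (a n) \<le> C * L ^ n / M n" by blast
  have "unorm M h (ultradiff a f) < \<infinity>"
    by (rule order.strict_trans1[OF unorm_ultradiff[OF *]])
      (use *(1) in \<open>auto simp: ultra_h_def ennreal_mult_less_top\<close>)
  then show "ultradiff a f \<in> ultra_h M h"
    using ultradiff_smooth_ultra_h[OF *] by (simp add: ultra_h_def)
qed

lemma ultradiff_lincomb:
  assumes "ultradiff_coeffs cls M a" "f \<in> ultra cls M" "g \<in> ultra cls M"
  shows "ultradiff a (\<lambda>t. b * f t + c * g t) t = b * ultradiff a f t + c * ultradiff a g t"
proof -
  have s: "summable (\<lambda>n. a n * (Dop ^^ n) f t)" "summable (\<lambda>n. a n * (Dop ^^ n) g t)"
    using ultradiff_summable_ultra[OF assms(1)] assms(2,3) by blast+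
  have "ultradiff a (\<lambda>t. b * f t + c * g t) t
      = (\<Sum>n. b * (a n * (Dop ^^ n) f t) + c * (a n * (Dop ^^ n) g t))"
    using assms ultra_smooth unfolding ultradiff_def
    by (intro suminf_cong) (simp add: Dop_funpow_lincomb smooth_periodic_iff algebra_simps)
  then show ?thesis
    using s by (simp add: ultradiff_def suminf_add[symmetric] suminf_mult summable_mult)
qed

lemma negligible_ultradiff:
  assumes a: "ultradiff_coeffs cls M a" and F: "F \<in> negligible_seqs cls M"
  shows "(\<lambda>n. ultradiff a (F n)) \<in> negligible_seqs cls M"
proof -
  have u: "F n \<in> ultra cls M" for n using F by (simp add: negligible_iff)
  have "for_scale cls (\<lambda>h. wbounded M h (\<lambda>n. weight M (h * real n)) F)"
    using F by (simp add: negligible_iff)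
  from ultradiff_coeffs_scale[OF a this]
  have "for_scale cls (\<lambda>h. wbounded M h (\<lambda>n. weight M (h * real n)) (\<lambda>n. ultradiff a (F n)))"
  proof (rule for_scale_mono)
    fix h :: real assume "h > 0"
      "\<exists>h' C L. wbounded M h' (\<lambda>n. weight M (h' * real n)) F \<and> H * h \<le> h' \<and> 0 < C \<and> 0 < L \<and> 2 * L * H \<le> h'
        \<and> (\<forall>n. cmod (a n) \<le> C * L ^ n / M n)"
    then obtain h' C L where w: "wbounded M h' (\<lambda>n. weight M (h' * real n)) F"
      and *: "0 < h" "H * h \<le> h'" "2 * L * H \<le> h'" "0 < L" "0 < C"
        "\<And>n. cmod (a n) \<le> C * L ^ n / M n" by blast
    obtain B :: real where B: "\<And>n. unorm M h' (F n) * weight M (h' * real n) \<le> ennreal B"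
      using w by (auto simp: wbounded_def)
    have hh: "h \<le> h'" using *(1,2) H_ge mult_right_mono[of 1 H h] by linarith
    have "unorm M h (ultradiff a (F n)) * weight M (h * real n) \<le> ennreal (2 * C * A) * ennreal B" for n
    proof -
      have "unorm M h' (F n) * 1 \<le> ennreal B"
        by (rule order_trans[OF mult_left_mono[OF weight_ge_1] B]) simp
      then have "F n \<in> ultra_h M h'"
        using ultra_smooth[OF u] by (auto simp: ultra_h_def intro: order.strict_trans1)
      then have "unorm M h (ultradiff a (F n)) * weight M (h * real n)
        \<le> (ennreal (2 * C * A) * unorm M h' (F n)) * weight M (h' * real n)"
        by (intro mult_mono unorm_ultradiff[OF _ *] scaled_weight_mono) (use * hh in auto)
      also have "\<dots> \<le> ennreal (2 * C * A) * ennreal B"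
        unfolding mult.assoc by (intro mult_left_mono B) simp
      finally show ?thesis .
    qed
    then show "wbounded M h (\<lambda>n. weight M (h * real n)) (\<lambda>n. ultradiff a (F n))"
      by (rule wboundedI_ennreal) (simp add: ennreal_mult_less_top)
  qed
  then show ?thesis using u a by (auto simp: negligible_iff ultra_ultradiff)
qed

end

text \<open>Exponentials are eigenfunctions: P(D) multiplies \<open>echar k\<close> by the value
  P(k), which exists because P is entire.\<close>

lemma ultradiff_trig_poly:
  assumes "finite K" "\<And>z. summable (\<lambda>n. a n * z ^ n)"
  shows "ultradiff a (\<lambda>t. \<Sum>k\<in>K. d k * echar k t) t
    = (\<Sum>k\<in>K. d k * (\<Sum>n. a n * of_int k ^ n) * echar k t)"
proof -
  have "ultradiff a (\<lambda>t. \<Sum>k\<in>K. d k * echar k t) t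
      = (\<Sum>n. \<Sum>k\<in>K. (a n * of_int k ^ n) * (d k * echar k t))"
    by (simp add: ultradiff_def Dop_funpow_trig_poly[OF assms(1)] sum_distrib_left mult_ac)
  also have "\<dots> = (\<Sum>k\<in>K. \<Sum>n. (a n * of_int k ^ n) * (d k * echar k t))"
    by (intro suminf_sum summable_mult2 assms(2))
  also have "\<dots> = (\<Sum>k\<in>K. d k * (\<Sum>n. a n * of_int k ^ n) * echar k t)"
    by (intro sum.cong refl) (simp add: suminf_mult2[OF assms(2), symmetric])
  finally show ?thesis .
qed


section \<open>Classes of generalized functions\<close>

lemma gen_class_eq: "gen_class cls M F = {\<lambda>n t. N n t + F n t |N. N \<in> negligible_seqs cls M}"
  by (auto simp: gen_class_def a_r_coset_def r_coset_def moderate_ring_def)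

context weight_sequence
begin

lemma negligible_add: "F \<in> negligible_seqs cls M \<Longrightarrow> G \<in> negligible_seqs cls M \<Longrightarrow>
    (\<lambda>n t. F n t + G n t) \<in> negligible_seqs cls M"
  using negligible_lincomb[of F cls G 1 1] by simp

lemma negligible_diff: "F \<in> negligible_seqs cls M \<Longrightarrow> G \<in> negligible_seqs cls M \<Longrightarrow>
    (\<lambda>n t. F n t - G n t) \<in> negligible_seqs cls M"
  using negligible_lincomb[of F cls G 1 "-1"] by simp

lemma mem_gen_class: "G \<in> gen_class cls M F \<longleftrightarrow> (\<lambda>n t. G n t - F n t) \<in> negligible_seqs cls M"
proof
  assume "(\<lambda>n t. G n t - F n t) \<in> negligible_seqs cls M"
  then show "G \<in> gen_class cls M F"
    unfolding gen_class_eq by (intro CollectI exI[of _ "\<lambda>n t. G n t - F n t"]) simp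
qed (auto simp: gen_class_eq)

lemma gen_class_eq_iff:
  "gen_class cls M F = gen_class cls M G \<longleftrightarrow> (\<lambda>n t. F n t - G n t) \<in> negligible_seqs cls M"
proof
  assume "gen_class cls M F = gen_class cls M G"
  moreover have "F \<in> gen_class cls M F" by (simp add: mem_gen_class negligible_zero)
  ultimately show "(\<lambda>n t. F n t - G n t) \<in> negligible_seqs cls M" by (simp add: mem_gen_class)
next
  assume FG: "(\<lambda>n t. F n t - G n t) \<in> negligible_seqs cls M"
  show "gen_class cls M F = gen_class cls M G"
  proof (intro Set.set_eqI)
    fix X
    show "X \<in> gen_class cls M F \<longleftrightarrow> X \<in> gen_class cls M G"
      unfolding mem_gen_class
      using negligible_add[OF FG, of "\<lambda>n t. X n t - F n t"] negligible_diff[of "\<lambda>n t. X n t - G n t", OF _ FG]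
      by auto
  qed
qed

text \<open>If a negligible change of the representative changes the images negligibly, all the
  classes in the union defining \<open>gen_lift\<close> coincide.\<close>

lemma gen_lift_gen_class:
  assumes "\<And>N. N \<in> negligible_seqs cls M \<Longrightarrow>
    (\<lambda>n t. T (\<lambda>t. N n t + F n t) t - T (F n) t) \<in> negligible_seqs cls M"
  shows "gen_lift cls M T (gen_class cls M F) = gen_class cls M (\<lambda>n. T (F n))"
proof -
  have "gen_class cls M (\<lambda>n. T (G n)) = gen_class cls M (\<lambda>n. T (F n))" if "G \<in> gen_class cls M F" for G
    using that assms by (auto simp: gen_class_eq[of _ _ F] gen_class_eq_iff)
  moreover have "F \<in> gen_class cls M F" by (simp add: mem_gen_class negligible_zero)
  ultimately show ?thesis unfolding gen_lift_def by blast
qed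

lemma gen_class_add:
  "gen_class cls M F \<oplus>\<^bsub>gen_alg cls M\<^esub> gen_class cls M G = gen_class cls M (\<lambda>n t. F n t + G n t)"
proof -
  have "gen_class cls M F \<oplus>\<^bsub>gen_alg cls M\<^esub> gen_class cls M G
      = {\<lambda>n t. X n t + Y n t |X Y. X \<in> gen_class cls M F \<and> Y \<in> gen_class cls M G}"
    by (auto simp: gen_alg_def FactRing_def set_add_def set_mult_def moderate_ring_def)
  also have "\<dots> = gen_class cls M (\<lambda>n t. F n t + G n t)"
  proof (intro Set.set_eqI iffI)
    fix Z assume "Z \<in> {\<lambda>n t. X n t + Y n t |X Y. X \<in> gen_class cls M F \<and> Y \<in> gen_class cls M G}"
    then obtain X Y where "Z = (\<lambda>n t. X n t + Y n t)" "X \<in> gen_class cls M F" "Y \<in> gen_class cls M G"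
      by blast
    then show "Z \<in> gen_class cls M (\<lambda>n t. F n t + G n t)"
      using negligible_add[of "\<lambda>n t. X n t - F n t" cls "\<lambda>n t. Y n t - G n t"]
      by (simp add: mem_gen_class algebra_simps)
  next
    fix Z assume "Z \<in> gen_class cls M (\<lambda>n t. F n t + G n t)"
    then have "F \<in> gen_class cls M F" "(\<lambda>n t. Z n t - F n t) \<in> gen_class cls M G"
      by (simp_all add: mem_gen_class negligible_zero diff_diff_eq)
    then show "Z \<in> {\<lambda>n t. X n t + Y n t |X Y. X \<in> gen_class cls M F \<and> Y \<in> gen_class cls M G}"
      \<comment> \<open>A perturbation of the sum is put entirely into the second summand.\<close>
      by (intro CollectI exI[of _ F] exI[of _ "\<lambda>n t. Z n t - F n t"]) simp
  qed
  finally show ?thesis .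
qed

lemma gen_class_mult:
  assumes F: "F \<in> bounded_seqs cls" and G: "G \<in> bounded_seqs cls"
  shows "gen_class cls M F \<otimes>\<^bsub>gen_alg cls M\<^esub> gen_class cls M G = gen_class cls M (\<lambda>n t. F n t * G n t)"
proof -
  have *: "gen_class cls M (\<lambda>n t. X n t * Y n t) = gen_class cls M (\<lambda>n t. F n t * G n t)"
    if "X \<in> gen_class cls M F" "Y \<in> gen_class cls M G" for X Y
  proof -
    have N: "(\<lambda>n t. X n t - F n t) \<in> negligible_seqs cls M" "(\<lambda>n t. Y n t - G n t) \<in> negligible_seqs cls M"
      using that by (simp_all add: mem_gen_class)
    have "(\<lambda>n t. X n t - F n t + F n t) \<in> bounded_seqs cls"
      by (rule bounded_seqs_add[OF subsetD[OF negligible_bounded N(1)] F])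
    then have X: "X \<in> bounded_seqs cls" by simp
    \<comment> \<open>The difference XY - FG is split as X(Y - G) + G(X - F), where X is bounded as
      a negligible perturbation of F.\<close>
    from negligible_add[OF negligible_mult[OF X N(2)] negligible_mult[OF G N(1)]]
    show ?thesis by (simp add: gen_class_eq_iff algebra_simps)
  qed
  \<comment> \<open>Coset multiplication is a union over representatives, so a constant family
    collapses to its value only over nonempty index sets.\<close>
  have ne: "gen_class cls M F \<noteq> {}" "gen_class cls M G \<noteq> {}"
    using negligible_zero by (auto simp: gen_class_eq)
  have "gen_class cls M F \<otimes>\<^bsub>gen_alg cls M\<^esub> gen_class cls M G
      = (\<Union>X\<in>gen_class cls M F. \<Union>Y\<in>gen_class cls M G. gen_class cls M (\<lambda>n t. X n t * Y n t))"
    by (auto simp: gen_alg_def FactRing_def rcoset_mult_def gen_class_def moderate_ring_def)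
  also have "\<dots> = (\<Union>X\<in>gen_class cls M F. \<Union>Y\<in>gen_class cls M G. gen_class cls M (\<lambda>n t. F n t * G n t))"
    by (intro SUP_cong refl *)
  also have "\<dots> = gen_class cls M (\<lambda>n t. F n t * G n t)" using ne by simp
  finally show ?thesis .
qed

end

section \<open>Functionals\<close>

text \<open>Continuity as a norm inequality on the whole test space. Where the norm is infinite it
  holds trivially, as \<open>Q\<close> is positive.\<close>

definition dual_estimate :: "ultra_class \<Rightarrow> (nat \<Rightarrow> real) \<Rightarrow> ((real \<Rightarrow> complex) \<Rightarrow> complex) \<Rightarrow> real \<Rightarrow> bool" where
  "dual_estimate cls M f h \<longleftrightarrow>
    (\<exists>Q>0. \<forall>\<psi>\<in>ultra cls M. ennreal (cmod (f \<psi>)) \<le> ennreal Q * unorm M h \<psi>)"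

text \<open>All that regularization sees of a functional. It can be checked for
  \<open>dual_embed\<close> and \<open>dual_ultradiff\<close> by computing on exponentials.\<close>

definition trig_linear :: "((real \<Rightarrow> complex) \<Rightarrow> complex) \<Rightarrow> bool" where
  "trig_linear f \<longleftrightarrow> (\<forall>K d. finite K \<longrightarrow>
    f (\<lambda>t. \<Sum>k\<in>K. d k * echar k t) = (\<Sum>k\<in>K. d k * f (echar k)))"

lemma ultra_dual_add:
  "f \<in> ultra_dual cls M \<Longrightarrow> \<phi> \<in> ultra cls M \<Longrightarrow> \<psi> \<in> ultra cls M \<Longrightarrow>
    f (\<lambda>t. \<phi> t + \<psi> t) = f \<phi> + f \<psi>"
  by (simp add: ultra_dual_def)

lemma ultra_dual_cmult:
  "f \<in> ultra_dual cls M \<Longrightarrow> \<phi> \<in> ultra cls M \<Longrightarrow> f (\<lambda>t. c * \<phi> t) = c * f \<phi>"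
  by (simp add: ultra_dual_def)

lemma openin_norm_topology_h: "openin (norm_topology_h M h) U \<longleftrightarrow> norm_open_h M h U"
  by (simp add: norm_topology_h_def topology_inverse'[OF istopology_norm_open_h])

section \<open>Continuity and Fourier expansion of functionals\<close>

context weight_sequence
begin

lemma norm_open_h_ball_0:
  assumes "norm_open_h M h U" "(\<lambda>t. 0) \<in> U"
  obtains r where "r > 0" "\<And>\<psi>. \<psi> \<in> ultra_h M h \<Longrightarrow> unorm M h \<psi> < ennreal r \<Longrightarrow> \<psi> \<in> U"
proof -
  have "\<exists>r>0. \<forall>\<psi>\<in>ultra_h M h. unorm M h (\<lambda>t. \<psi> t - 0) < ennreal r \<longrightarrow> \<psi> \<in> U"
    using assms(1)[unfolded norm_open_h_def, THEN conjunct2, rule_format, OF assms(2)] .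
  then show thesis using that by auto
qed

lemma dual_estimateI:
  assumes f: "f \<in> ultra_dual cls M" and "h > 0" "r > 0"
    and ball: "\<And>\<psi>. \<psi> \<in> ultra cls M \<Longrightarrow> unorm M h \<psi> < ennreal r \<Longrightarrow> cmod (f \<psi>) < 1"
  shows "dual_estimate cls M f h"
proof -
  have "ennreal (cmod (f \<psi>)) \<le> ennreal (1 / r) * unorm M h \<psi>" if \<psi>: "\<psi> \<in> ultra cls M" for \<psi>
  proof (cases "unorm M h \<psi>")
    case (real u)
    have "cmod (f \<psi>) \<le> u / r + e" if "e > 0" for e
    proof -
      \<comment> \<open>Dividing by \<open>s\<close> brings the norm strictly below
        \<open>r\<close>; the summand \<open>e\<close> keeps \<open>s\<close> positive even when
        \<open>u = 0\<close> and is removed at the end.\<close>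
      define s where "s = u / r + e"
      have s: "s > 0" using that real \<open>r > 0\<close> by (simp add: s_def add_nonneg_pos)
      have "unorm M h (\<lambda>t. of_real (1 / s) * \<psi> t) \<le> ennreal (1 / s) * ennreal u"
        using unorm_cmult[OF ultra_smooth[OF \<psi>], of h "of_real (1 / s)"] real s
        by (simp add: norm_divide)
      also have "\<dots> = ennreal (u / s)" using s real by (simp add: ennreal_mult[symmetric])
      also have "\<dots> < ennreal r"
        using s that real \<open>r > 0\<close> by (intro ennreal_lessI) (auto simp: s_def field_simps)
      finally have "cmod (f (\<lambda>t. of_real (1 / s) * \<psi> t)) < 1"
        by (intro ball ultra_cmult \<psi>)
      moreover have "f (\<lambda>t. of_real (1 / s) * \<psi> t) = of_real (1 / s) * f \<psi>"
        using f \<psi> by (rule ultra_dual_cmult)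
      ultimately have "cmod (f \<psi>) / s < 1" using s by (simp add: norm_divide)
      then show ?thesis using s by (simp add: s_def[symmetric])
    qed
    then have "cmod (f \<psi>) \<le> u / r" by (rule field_le_epsilon)
    then show ?thesis using real \<open>r > 0\<close> by (simp add: ennreal_mult[symmetric] ennreal_leI)
  qed (use \<open>r > 0\<close> in \<open>simp add: ennreal_mult_top\<close>)
  then show ?thesis using \<open>r > 0\<close> unfolding dual_estimate_def by (intro exI[of _ "1 / r"]) auto
qed

lemma ultra_dual_zero: "f \<in> ultra_dual cls M \<Longrightarrow> f (\<lambda>t. 0) = 0"
  using ultra_dual_cmult[of f cls M "\<lambda>t. 0" 0] ultra_zero by simp

lemma ultra_dual_preimage:
  assumes f: "f \<in> ultra_dual cls M" and top: "(\<lambda>t. 0) \<in> topspace (ultra_topology cls M)"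
  obtains U where "openin (ultra_topology cls M) U" "(\<lambda>t. 0) \<in> U" "\<And>\<psi>. \<psi> \<in> U \<Longrightarrow> cmod (f \<psi>) < 1"
proof (rule that)
  let ?U = "{\<psi> \<in> topspace (ultra_topology cls M). f \<psi> \<in> ball 0 1}"
  show "openin (ultra_topology cls M) ?U"
    using f by (intro openin_continuous_map_preimage[of _ euclidean]) (auto simp: ultra_dual_def)
  show "(\<lambda>t. 0) \<in> ?U" using top ultra_dual_zero[OF f] by simp
qed auto

lemma norm_open_h_ultra_h: "norm_open_h M h (ultra_h M h)"
  by (auto simp: norm_open_h_def intro: exI[of _ 1])

text \<open>By induction on the generation of open sets, each one containing 0 contains a ball for a
  single norm: finite intersections use the larger scale and the smaller radius. Homogeneity then
  turns boundedness on a ball into the estimate.\<close>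

lemma ultra_dual_estimate_Beurling:
  assumes f: "f \<in> ultra_dual Beurling M"
  shows "\<exists>h>0. dual_estimate Beurling M f h"
proof -
  define S where "S = (\<Union>h\<in>{0<..}. {U \<inter> ultra Beurling M |U. openin (norm_topology_h M h) U})"
  have X: "ultra_topology Beurling M = topology_generated_by S" by (simp add: S_def)
  \<comment> \<open>The space of a generated topology is the union of its generators, so one of them
    must be shown to contain 0.\<close>
  have "ultra_h M 1 \<inter> ultra Beurling M \<in> S"
    unfolding S_def openin_norm_topology_h using norm_open_h_ultra_h[of 1] zero_less_one by blast
  then have "(\<lambda>t. 0) \<in> topspace (ultra_topology Beurling M)"
    unfolding X topology_generated_by_topspace using ultra_zero[of Beurling] ultra_h_zero[of 1] by blast
  from ultra_dual_preimage[OF f this] obtain U where U: "openin (topology_generated_by S) U" "(\<lambda>t. 0) \<in> U"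
    "\<And>\<psi>. \<psi> \<in> U \<Longrightarrow> cmod (f \<psi>) < 1" unfolding X by blast
  have "\<exists>h>0. \<exists>r>0. \<forall>\<psi>\<in>ultra Beurling M. unorm M h \<psi> < ennreal r \<longrightarrow> \<psi> \<in> U" if "(\<lambda>t. 0) \<in> U"
    using U(1)[unfolded openin_topology_generated_by_iff] that
  proof (induction rule: generate_topology_on.induct)
    case (Int a b)
    then obtain h r h' r' where
      "h > 0" "r > 0" and a: "\<And>\<psi>. \<psi> \<in> ultra Beurling M \<Longrightarrow> unorm M h \<psi> < ennreal r \<Longrightarrow> \<psi> \<in> a" and
      "h' > 0" "r' > 0" and b: "\<And>\<psi>. \<psi> \<in> ultra Beurling M \<Longrightarrow> unorm M h' \<psi> < ennreal r' \<Longrightarrow> \<psi> \<in> b"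
      by (metis IntD1 IntD2)
    have *: "\<forall>\<psi>\<in>ultra Beurling M. unorm M (max h h') \<psi> < ennreal (min r r') \<longrightarrow> \<psi> \<in> a \<inter> b"
    proof (intro ballI impI)
      fix \<psi> assume \<psi>: "\<psi> \<in> ultra Beurling M" "unorm M (max h h') \<psi> < ennreal (min r r')"
      have "unorm M h \<psi> \<le> unorm M (max h h') \<psi>" "unorm M h' \<psi> \<le> unorm M (max h h') \<psi>"
        using \<open>h > 0\<close> \<open>h' > 0\<close> by (auto intro: unorm_mono)
      moreover have "ennreal (min r r') \<le> ennreal r" "ennreal (min r r') \<le> ennreal r'"
        by (auto intro: ennreal_leI)
      ultimately show "\<psi> \<in> a \<inter> b" using a[OF \<psi>(1)] b[OF \<psi>(1)] \<psi>(2) by (meson IntI le_less_trans less_le_trans)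
    qed
    show ?case
      by (rule exI[of _ "max h h'"], rule conjI[OF _ exI[of _ "min r r'"]])
        (use * \<open>h > 0\<close> \<open>h' > 0\<close> \<open>r > 0\<close> \<open>r' > 0\<close> in auto)
  next
    case (UN K)
    then show ?case by (meson UnionE UnionI)
  next
    case (Basis s)
    then obtain h V where h: "h > 0" and s: "s = V \<inter> ultra Beurling M" and V: "norm_open_h M h V"
      unfolding S_def openin_norm_topology_h by auto
    have "(\<lambda>t. 0) \<in> V" using Basis s by simp
    from norm_open_h_ball_0[OF V this] obtain r where
      "r > 0" "\<And>\<psi>. \<psi> \<in> ultra_h M h \<Longrightarrow> unorm M h \<psi> < ennreal r \<Longrightarrow> \<psi> \<in> V" by blast
    then show ?case using h s by auto
  qed simp
  then obtain h r where "h > 0" "r > 0" "\<forall>\<psi>\<in>ultra Beurling M. unorm M h \<psi> < ennreal r \<longrightarrow> \<psi> \<in> U"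
    using U(2) by blast
  then show ?thesis using dual_estimateI[OF f, of h r] U(3) by blast
qed

text \<open>A neighbourhood of 0 in the inductive limit meets every step in a neighbourhood, hence
  contains a ball of each norm. This is why every scale admits an estimate here.\<close>

lemma ultra_dual_estimate_Roumieu:
  assumes f: "f \<in> ultra_dual Roumieu M" and h: "h > 0"
  shows "dual_estimate Roumieu M f h"
proof -
  have sub: "ultra_h M h \<subseteq> ultra Roumieu M" if "h > 0" for h using that by auto
  have oi: "openin (ultra_topology Roumieu M) U \<longleftrightarrow> ind_open M U" for U
    by (simp add: topology_inverse'[OF istopology_ind_open])
  have "ind_zero_nbhd M (ultra Roumieu M)"
    unfolding ind_zero_nbhd_def openin_norm_topology_h absolutely_convex_def
    using ultra_lincomb[of _ Roumieu] norm_open_h_ultra_h ultra_h_zero sub by blast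
  then have "ind_open M (ultra Roumieu M)"
    unfolding ind_open_def using ultra_add[of _ Roumieu] by blast
  then have "(\<lambda>t. 0) \<in> topspace (ultra_topology Roumieu M)"
    using openin_subset[of "ultra_topology Roumieu M"] ultra_zero[of Roumieu] oi by blast
  from ultra_dual_preimage[OF f this] obtain U where U: "ind_open M U" "(\<lambda>t. 0) \<in> U"
    "\<And>\<psi>. \<psi> \<in> U \<Longrightarrow> cmod (f \<psi>) < 1" unfolding oi by blast
  obtain V where V: "ind_zero_nbhd M V" "\<forall>\<psi>\<in>V. (\<lambda>t. 0 + \<psi> t) \<in> U"
    using U(1,2) unfolding ind_open_def by blast
  obtain W where W: "norm_open_h M h W" "(\<lambda>t. 0) \<in> W" "W \<subseteq> V"
    using V(1) h unfolding ind_zero_nbhd_def openin_norm_topology_h by blast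
  from norm_open_h_ball_0[OF W(1,2)] obtain r where
    r: "r > 0" "\<And>\<psi>. \<psi> \<in> ultra_h M h \<Longrightarrow> unorm M h \<psi> < ennreal r \<Longrightarrow> \<psi> \<in> W" by blast
  show ?thesis
  proof (rule dual_estimateI[OF f h r(1)])
    fix \<psi> assume \<psi>: "\<psi> \<in> ultra Roumieu M" "unorm M h \<psi> < ennreal r"
    then have "\<psi> \<in> ultra_h M h"
      using ultra_smooth[OF \<psi>(1)] by (auto simp: ultra_h_def intro: less_trans)
    then have "\<psi> \<in> V" using r(2) \<psi>(2) W(3) by blast
    then have "\<psi> \<in> U" using V(2) by auto
    then show "cmod (f \<psi>) < 1" by (rule U(3))
  qed
qed

lemma trig_linear_ultra_dual:
  assumes "cond_one cls M" "f \<in> ultra_dual cls M"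
  shows "trig_linear f"
proof -
  have "f (\<lambda>t. \<Sum>k\<in>K. d k * echar k t) = (\<Sum>k\<in>K. d k * f (echar k))" if "finite K" for K d
    using that
  proof (induction K)
    case empty
    show ?case using ultra_dual_zero[OF assms(2)] by simp
  next
    case (insert x K)
    have "f (\<lambda>t. d x * echar x t + (\<Sum>k\<in>K. d k * echar k t))
      = f (\<lambda>t. d x * echar x t) + f (\<lambda>t. \<Sum>k\<in>K. d k * echar k t)"
      by (intro ultra_dual_add[OF assms(2)] ultra_cmult ultra_echar ultra_trig_poly assms(1) insert(1))
    moreover have "f (\<lambda>t. d x * echar x t) = d x * f (echar x)"
      by (intro ultra_dual_cmult[OF assms(2)] ultra_echar assms(1))
    ultimately show ?case using insert by simp
  qed
  then show ?thesis by (simp add: trig_linear_def)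
qed

text \<open>The pairing is not normalized while Fourier coefficients are; the resulting
  \<open>2 * pi\<close> cancels the value \<open>1 / (2 * pi)\<close> of the mollifier coefficients
  at low frequencies.\<close>

lemma trig_linear_dual_embed:
  assumes "cond_one cls M" "f \<in> smooth_periodic"
  shows "trig_linear (dual_embed cls M f)"
    and "dual_embed cls M f (echar (- k)) = 2 * pi * fourier_coeff f k"
proof -
  have e: "dual_embed cls M f (echar k) = integral {0..2*pi} (\<lambda>t. f t * echar k t)" for k
    using ultra_echar[OF assms(1)] by (simp add: dual_embed_def)
  have fc: "continuous_on {0..2*pi} f" using assms(2) by (simp add: smooth_periodic_iff smooth_fun_continuous0)
  show "dual_embed cls M f (echar (- k)) = 2 * pi * fourier_coeff f k"
    unfolding e by (simp add: fourier_coeff_eq)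
  have "dual_embed cls M f (\<lambda>t. \<Sum>k\<in>K. d k * echar k t) = (\<Sum>k\<in>K. d k * dual_embed cls M f (echar k))"
    if K: "finite K" for K d
  proof -
    have "dual_embed cls M f (\<lambda>t. \<Sum>k\<in>K. d k * echar k t)
        = integral {0..2*pi} (\<lambda>t. \<Sum>k\<in>K. d k * (f t * echar k t))"
      using ultra_trig_poly[OF assms(1) K] by (simp add: dual_embed_def sum_distrib_left mult_ac)
    also have "\<dots> = (\<Sum>k\<in>K. d k * integral {0..2*pi} (\<lambda>t. f t * echar k t))"
      using K fc by (subst Henstock_Kurzweil_Integration.integral_sum)
        (auto intro!: integrable_continuous_interval continuous_intros)
    finally show ?thesis by (simp add: e)
  qed
  then show "trig_linear (dual_embed cls M f)" by (simp add: trig_linear_def)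
qed

text \<open>The transpose is P(-D), and on \<open>echar (- k)\<close> the two signs cancel, leaving
  P(k).\<close>

lemma trig_linear_dual_ultradiff:
  assumes c1: "cond_one cls M" and f: "trig_linear f" and a: "\<And>z. summable (\<lambda>n. a n * z ^ n)"
  shows "trig_linear (dual_ultradiff cls M a f)"
    and "dual_ultradiff cls M a f (echar (- k)) = (\<Sum>n. a n * of_int k ^ n) * f (echar (- k))"
proof -
  define p where "p k = (\<Sum>n. (-1) ^ n * a n * of_int k ^ n)" for k :: int
  have s: "summable (\<lambda>n. ((-1) ^ n * a n) * z ^ n)" for z :: complex
    using a[of "- z"] by (simp add: power_minus[of z] mult_ac)
  have *: "dual_ultradiff cls M a f (\<lambda>t. \<Sum>k\<in>K. d k * echar k t) = (\<Sum>k\<in>K. d k * p k * f (echar k))"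
    if K: "finite K" for K d
  proof -
    have "dual_ultradiff cls M a f (\<lambda>t. \<Sum>k\<in>K. d k * echar k t)
        = f (\<lambda>t. \<Sum>k\<in>K. (d k * p k) * echar k t)"
      unfolding dual_ultradiff_def p_def
      using ultra_trig_poly[OF c1 K, of d] by (simp add: ext[OF ultradiff_trig_poly[OF K s]])
    also have "\<dots> = (\<Sum>k\<in>K. d k * p k * f (echar k))"
      by (rule f[unfolded trig_linear_def, rule_format, OF K])
    finally show ?thesis .
  qed
  have e: "dual_ultradiff cls M a f (echar k) = p k * f (echar k)" for k
    using *[of "{k}" "\<lambda>_. 1"] by simp
  show "trig_linear (dual_ultradiff cls M a f)"
    unfolding trig_linear_def e by (auto simp: * mult.assoc)
  have "p (- k) = (\<Sum>n. a n * of_int k ^ n)"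
    unfolding p_def
  proof (rule suminf_cong)
    fix n
    have "((-1) ^ n * (- 1) ^ n :: complex) = 1" by (simp flip: power_mult_distrib)
    then show "(-1) ^ n * a n * of_int (- k) ^ n = a n * of_int k ^ n"
      using power_minus[of "of_int k :: complex" n] by (simp add: mult.left_commute[of "a n"] flip: mult.assoc)
  qed
  then show "dual_ultradiff cls M a f (echar (- k)) = (\<Sum>n. a n * of_int k ^ n) * f (echar (- k))"
    by (simp add: e)
qed

text \<open>Only frequencies above \<open>N\<close> remain. At scale \<open>H * h\<close> a
  coefficient controls two factors w(hk): one is the norm weight, the other becomes an inverse
  weight whose tail sum tends to 0.\<close>

lemma unorm_fourier_sum_diff:
  assumes f: "f \<in> smooth_periodic" and h: "h > 0" and fin: "unorm M (H * h) f < \<infinity>"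
  shows "unorm M h (\<lambda>t. f t - fourier_sum f N t)
    \<le> ennreal A * unorm M (H * h) f * ennreal (M 2 / h\<^sup>2 * (4 / (2 * real N + 1)))"
proof -
  define Y where "Y = ennreal A * unorm M (H * h) f"
  have Y: "Y < \<infinity>" using fin by (auto simp: Y_def ennreal_mult_less_top)
  have S: "fourier_sum f N \<in> smooth_periodic"
    unfolding fourier_sum_def[abs_def] by (rule smooth_periodic_trig_poly) simp
  define g where "g t = f t - fourier_sum f N t" for t
  have g: "g \<in> smooth_periodic" unfolding g_def[abs_def] by (rule smooth_periodic_sum2(2)[OF f S])
  have gk: "fourier_coeff g k = (if \<bar>k\<bar> > int N then fourier_coeff f k else 0)" for k
  proof -
    have "fourier_coeff (\<lambda>t. 1 * f t + (-1) * fourier_sum f N t) k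
        = 1 * fourier_coeff f k + (-1) * fourier_coeff (fourier_sum f N) k"
      using f S by (intro fourier_coeff_lincomb) (auto simp: smooth_periodic_iff smooth_fun_continuous0)
    moreover have "fourier_coeff (fourier_sum f N) k = (if k \<in> {- int N..int N} then fourier_coeff f k else 0)"
      unfolding fourier_sum_def[abs_def] by (rule fourier_coeff_trig_poly) simp
    ultimately show ?thesis by (auto simp: g_def[abs_def])
  qed
  have "unorm M h g * 1 \<le> Y * ennreal (M 2 / h\<^sup>2 * (4 / (2 * real N + 1)))"
  proof (rule unorm_fourier_leI[OF g h])
    fix k
    let ?w = "weight M (h * of_int k)"
    have "ennreal (cmod (fourier_coeff f k)) * ?w \<le> Y * inverse ?w"
    proof (rule ennreal_le_times_inverse[OF _ Y])
      have "?w * ?w \<le> ennreal A * weight M (H * \<bar>h * of_int k\<bar>)" by (rule weight_mult) auto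
      also have "weight M (H * \<bar>h * of_int k\<bar>) = weight M (H * h * of_int k)"
        by (intro antisym weight_mono) (auto simp: abs_mult)
      finally have "ennreal (cmod (fourier_coeff f k)) * (?w * ?w)
        \<le> ennreal (cmod (fourier_coeff f k)) * (ennreal A * weight M (H * h * of_int k))"
        by (rule mult_left_mono) simp
      also have "\<dots> = ennreal A * (ennreal (cmod (fourier_coeff f k)) * weight M (H * h * of_int k))"
        by (simp add: mult_ac)
      also have "\<dots> \<le> Y" unfolding Y_def
        using h by (intro mult_left_mono unorm_fourier_ge f) auto
      finally show "ennreal (cmod (fourier_coeff f k)) * ?w * ?w \<le> Y" by (simp add: mult.assoc)
    qed simp
    then show "ennreal (cmod (fourier_coeff g k)) * ?w * 1
        \<le> Y * (if \<bar>k\<bar> > int N then inverse ?w else 0)"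
      by (simp add: gk)
  next
    fix N'
    show "(\<Sum>k\<in>{- int N'..int N'}. Y * (if \<bar>k\<bar> > int N then inverse (weight M (h * of_int k)) else 0))
       \<le> Y * ennreal (M 2 / h\<^sup>2 * (4 / (2 * real N + 1)))"
      unfolding sum_distrib_left[symmetric] by (intro mult_left_mono inverse_weight_sum_tail h) simp
  qed
  then show ?thesis by (simp add: Y_def g_def[abs_def])
qed

lemma dual_estimate_fourier_sum:
  assumes c1: "cond_one cls M" and f: "f \<in> ultra_dual cls M" and \<psi>: "\<psi> \<in> ultra cls M"
    and h: "h > 0" "unorm M (H * h) \<psi> < \<infinity>" and est: "dual_estimate cls M f h"
  shows "(\<lambda>N. \<Sum>k\<in>{- int N..int N}. fourier_coeff \<psi> k * f (echar k)) \<longlonglongrightarrow> f \<psi>"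
proof -
  obtain Q where Q: "Q > 0" "\<And>\<psi>. \<psi> \<in> ultra cls M \<Longrightarrow> ennreal (cmod (f \<psi>)) \<le> ennreal Q * unorm M h \<psi>"
    using est unfolding dual_estimate_def by blast
  obtain u where u: "unorm M (H * h) \<psi> = ennreal u" "u \<ge> 0" using h(2) by (cases "unorm M (H * h) \<psi>") auto
  define c where "c = Q * A * u * (M 2 / h\<^sup>2) * 4"
  have S: "fourier_sum \<psi> N \<in> ultra cls M" for N
    unfolding fourier_sum_def[abs_def] by (rule ultra_trig_poly[OF c1]) simp
  have fS: "f (fourier_sum \<psi> N) = (\<Sum>k\<in>{- int N..int N}. fourier_coeff \<psi> k * f (echar k))" for N
    using trig_linear_ultra_dual[OF c1 f] unfolding fourier_sum_def[abs_def] trig_linear_def by simp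
  have "cmod (f \<psi> - f (fourier_sum \<psi> N)) \<le> c * (1 / (2 * real N + 1))" for N
  proof -
    have "f (\<lambda>t. \<psi> t - fourier_sum \<psi> N t + fourier_sum \<psi> N t)
        = f (\<lambda>t. \<psi> t - fourier_sum \<psi> N t) + f (fourier_sum \<psi> N)"
      by (rule ultra_dual_add[OF f ultra_diff[OF \<psi> S] S])
    then have "ennreal (cmod (f \<psi> - f (fourier_sum \<psi> N)))
        = ennreal (cmod (f (\<lambda>t. \<psi> t - fourier_sum \<psi> N t)))" by simp
    also have "\<dots> \<le> ennreal Q * (ennreal A * ennreal u * ennreal (M 2 / h\<^sup>2 * (4 / (2 * real N + 1))))"
      using unorm_fourier_sum_diff[OF ultra_smooth[OF \<psi>] h, of N] Q(2)[OF ultra_diff[OF \<psi> S[of N]]]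
      unfolding u(1) by (meson mult_left_mono order_trans zero_le)
    also have "\<dots> = ennreal (c * (1 / (2 * real N + 1)))"
      using Q(1) u(2) A_ge h(1) by (simp add: ennreal_mult[symmetric] c_def mult_ac)
    finally show ?thesis using Q(1) u(2) A_ge h(1) by (subst (asm) ennreal_le_iff) (auto simp: c_def)
  qed
  moreover have "(\<lambda>N. c * (1 / (2 * real N + 1))) \<longlonglongrightarrow> 0" by real_asymp
  ultimately have "(\<lambda>N. f \<psi> - f (fourier_sum \<psi> N)) \<longlonglongrightarrow> 0"
    by (rule Lim_null_comparison[OF always_eventually[OF allI]])
  then have "(\<lambda>N. f \<psi> - (f \<psi> - f (fourier_sum \<psi> N))) \<longlonglongrightarrow> f \<psi> - 0" by (intro tendsto_intros)
  then show ?thesis by (simp add: fS)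
qed

text \<open>The quantifiers fit in both classes. A Beurling functional supplies one scale and the
  test function has finite norm at all; a Roumieu test function supplies one scale and the
  functional is estimated at all.\<close>

lemma ultra_dual_fourier_sum:
  assumes c1: "cond_one cls M" and f: "f \<in> ultra_dual cls M" and \<psi>: "\<psi> \<in> ultra cls M"
  shows "(\<lambda>N. \<Sum>k\<in>{- int N..int N}. fourier_coeff \<psi> k * f (echar k)) \<longlonglongrightarrow> f \<psi>"
proof (cases cls)
  case Beurling
  then obtain h where h: "h > 0" "dual_estimate cls M f h"
    using f ultra_dual_estimate_Beurling by auto
  then have "\<psi> \<in> ultra_h M (H * h)" using \<psi> Beurling by simp
  then show ?thesis using dual_estimate_fourier_sum[OF c1 f \<psi> h(1) _ h(2)] by (simp add: ultra_h_def)
next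
  case Roumieu
  then obtain h' where h': "h' > 0" "\<psi> \<in> ultra_h M h'" using \<psi> by auto
  have h: "h' / H > 0" "H * (h' / H) = h'" using h' H_pos by (simp_all add: less_imp_neq[OF H_pos, symmetric])
  then show ?thesis
    using dual_estimate_fourier_sum[OF c1 f \<psi> h(1)] ultra_dual_estimate_Roumieu[OF _ h(1)] f Roumieu h'
    by (simp add: ultra_h_def)
qed

lemma ultra_dual_eqI:
  assumes "cond_one cls M" "f \<in> ultra_dual cls M" "g \<in> ultra_dual cls M"
    and "\<And>k. f (echar k) = g (echar k)"
  shows "f = g"
proof (rule extensionalityI)
  show "f \<in> extensional (ultra cls M)" "g \<in> extensional (ultra cls M)"
    using assms by (auto simp: ultra_dual_def)
  fix \<psi> assume "\<psi> \<in> ultra cls M"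
  then show "f \<psi> = g \<psi>"
    using ultra_dual_fourier_sum[OF assms(1,2)] ultra_dual_fourier_sum[OF assms(1,3)] assms(4)
      LIMSEQ_unique by fastforce
qed

end

section \<open>The embedding\<close>

text \<open>As a function of \<open>u\<close>, \<open>echar k (t - u)\<close> is
  \<open>echar k t\<close> times \<open>echar (- k) u\<close>, so frequency \<open>k\<close> of the
  result tests the functional at \<open>- k\<close>.\<close>

lemma conv_trig_linear:
  assumes f: "trig_linear f" and \<phi>: "\<phi> \<in> smooth_periodic"
    and K: "finite K" "\<And>k. k \<notin> K \<Longrightarrow> fourier_coeff \<phi> k = 0"
  shows "conv f \<phi> = (\<lambda>t. \<Sum>k\<in>K. (fourier_coeff \<phi> k * f (echar (- k))) * echar k t)"
proof
  fix t
  let ?c = "fourier_coeff \<phi>"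
  have fin: "finite (uminus ` K)" using K(1) by simp
  have "(\<lambda>u. \<phi> (t - u)) = (\<lambda>u. \<Sum>j\<in>uminus ` K. (?c (- j) * echar (- j) t) * echar j u)"
  proof
    fix u
    have "\<phi> (t - u) = (\<Sum>k\<in>K. ?c k * echar k (t - u))"
      using fun_cong[OF smooth_periodic_eq_trig_poly[OF \<phi> K]] .
    then show "\<phi> (t - u) = (\<Sum>j\<in>uminus ` K. (?c (- j) * echar (- j) t) * echar j u)"
      by (simp add: sum.reindex echar_diff mult.assoc)
  qed
  then have "conv f \<phi> t = (\<Sum>j\<in>uminus ` K. (?c (- j) * echar (- j) t) * f (echar j))"
    unfolding conv_def using f[unfolded trig_linear_def, rule_format, OF fin] by simp
  then show "conv f \<phi> t = (\<Sum>k\<in>K. (?c k * f (echar (- k))) * echar k t)"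
    by (simp add: sum.reindex mult_ac)
qed

lemma fourier_coeff_conv:
  assumes "trig_linear f" "\<phi> \<in> smooth_periodic"
    and "finite K" "\<And>k. k \<notin> K \<Longrightarrow> fourier_coeff \<phi> k = 0"
  shows "fourier_coeff (conv f \<phi>) k = fourier_coeff \<phi> k * f (echar (- k))"
proof -
  have "fourier_coeff (conv f \<phi>) k = (if k \<in> K then fourier_coeff \<phi> k * f (echar (- k)) else 0)"
    by (rule trans[OF arg_cong[OF conv_trig_linear[OF assms], of "\<lambda>g. fourier_coeff g k"]
      fourier_coeff_trig_poly[OF assms(3)]])
  then show ?thesis by (simp add: assms(4))
qed

locale mollified = weight_sequence +
  fixes cls :: ultra_class and \<phi> :: "nat \<Rightarrow> real \<Rightarrow> complex" and C R r :: real
  assumes one: "cond_one cls M"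
    and smooth: "\<phi> n \<in> smooth_periodic"
    and C: "C > 0" "cmod (fourier_coeff (\<phi> n) k) \<le> C"
    and R: "R > 0" "\<bar>of_int k\<bar> > R * real n \<Longrightarrow> fourier_coeff (\<phi> n) k = 0"
    and r: "r > 0" "\<bar>of_int k\<bar> \<le> r * real n \<Longrightarrow> fourier_coeff (\<phi> n) k = 1 / (2 * pi)"
begin

definition freqs :: "nat \<Rightarrow> int set" where
  "freqs n = {- \<lfloor>R * real n\<rfloor>..\<lfloor>R * real n\<rfloor>}"

lemma finite_freqs: "finite (freqs n)" by (simp add: freqs_def)

lemma coeff_0: "k \<notin> freqs n \<Longrightarrow> fourier_coeff (\<phi> n) k = 0"
  by (rule R(2)) (auto simp: freqs_def; linarith)

lemma conv_eq: "trig_linear f \<Longrightarrow>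
    conv f (\<phi> n) = (\<lambda>t. \<Sum>k\<in>freqs n. (fourier_coeff (\<phi> n) k * f (echar (- k))) * echar k t)"
  by (rule conv_trig_linear[OF _ smooth finite_freqs coeff_0])

lemma conv_coeff: "trig_linear f \<Longrightarrow>
    fourier_coeff (conv f (\<phi> n)) k = fourier_coeff (\<phi> n) k * f (echar (- k))"
  by (rule fourier_coeff_conv[OF _ smooth finite_freqs coeff_0])

lemma ultra_conv: "trig_linear f \<Longrightarrow> conv f (\<phi> n) \<in> ultra cls M"
  using ultra_trig_poly[OF one finite_freqs] by (simp add: conv_eq)

text \<open>\<open>dual_add\<close> and \<open>dual_smult\<close> have their intended values on the
  test space only, so the translated mollifiers must be shown to lie there.\<close>

lemma shift_ultra: "(\<lambda>u. \<phi> n (t - u)) \<in> ultra cls M"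
proof -
  have "(\<lambda>u. \<phi> n (t - u)) = (\<lambda>u. \<Sum>k\<in>freqs n. (fourier_coeff (\<phi> n) k * echar k t) * echar (- k) u)"
  proof
    fix u
    have "\<phi> n (t - u) = (\<Sum>k\<in>freqs n. fourier_coeff (\<phi> n) k * echar k (t - u))"
      using fun_cong[OF smooth_periodic_eq_trig_poly[OF smooth finite_freqs coeff_0]] .
    then show "\<phi> n (t - u) = (\<Sum>k\<in>freqs n. (fourier_coeff (\<phi> n) k * echar k t) * echar (- k) u)"
      by (simp add: echar_diff mult.assoc)
  qed
  then show ?thesis by (simp add: ultra_sum[OF finite_freqs ultra_echar[OF one]])
qed

text \<open>One use of \<open>weight_mult\<close> merges the growth of the functional, at scale
  \<open>g\<close>, with the norm weight, at scale \<open>h\<close>, into w(sk) for s = H max(g, h).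
  A second one, with |k| at most Rn, trades this for the index weight times a summable inverse.
  Hence the scale \<open>H * (H * max g h) * R\<close>.\<close>

lemma wbounded_conv:
  assumes f: "trig_linear f" and g: "g > 0" and h: "h > 0" and Q: "Q > 0"
    and est: "\<And>k. ennreal (cmod (f (echar k))) \<le> ennreal Q * weight M (g * of_int k)"
  shows "wbounded M h (\<lambda>n. inverse (weight M (H * (H * max g h) * R * real n))) (\<lambda>n. conv f (\<phi> n))"
proof (rule wboundedI_ennreal)
  fix n
  define s where "s = H * max g h"
  define w where "w = weight M (H * s * R * real n)"
  have s: "s > 0" using g by (simp add: s_def)
  let ?D = "ennreal (C * Q * A * A)"
  show "unorm M h (conv f (\<phi> n)) * inverse (weight M (H * (H * max g h) * R * real n))
    \<le> ?D * ennreal (1 + 4 * M 2 / s\<^sup>2)"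
    unfolding s_def[symmetric] w_def[symmetric]
  proof (rule unorm_fourier_leI[OF ultra_smooth[OF ultra_conv[OF f]] h])
    fix k :: int
    let ?v = "weight M (s * of_int k)"
    show "ennreal (cmod (fourier_coeff (conv f (\<phi> n)) k)) * weight M (h * of_int k) * inverse w
      \<le> ?D * inverse ?v"
    proof (cases "k \<in> freqs n")
      case False
      then show ?thesis by (simp add: conv_coeff[OF f] coeff_0)
    next
      case True
      then have kR: "\<bar>of_int k\<bar> \<le> R * real n" unfolding freqs_def by (auto simp: abs_le_iff; linarith)
      have "ennreal (cmod (fourier_coeff (conv f (\<phi> n)) k)) \<le> ennreal C * ennreal (cmod (f (echar (- k))))"
        using C by (simp add: conv_coeff[OF f] norm_mult ennreal_mult[symmetric] ennreal_leI mult_right_mono)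
      also have "\<dots> \<le> ennreal C * (ennreal Q * weight M (g * of_int k))"
        using est[of "- k"] by (intro mult_left_mono) auto
      finally have "ennreal (cmod (fourier_coeff (conv f (\<phi> n)) k)) * weight M (h * of_int k) * inverse w
        \<le> (ennreal C * (ennreal Q * weight M (g * of_int k))) * weight M (h * of_int k) * inverse w"
        by (intro mult_right_mono) auto
      also have "\<dots> = ennreal C * ennreal Q * (weight M (g * of_int k) * weight M (h * of_int k)) * inverse w"
        by (simp add: mult_ac)
      also have "\<dots> \<le> ennreal C * ennreal Q * (ennreal A * ?v) * inverse w"
      proof (intro mult_left_mono mult_right_mono)
        have "weight M (g * of_int k) * weight M (h * of_int k)
            \<le> ennreal A * weight M (H * (max g h * \<bar>of_int k\<bar>))"
          using g h by (intro weight_mult) (auto simp: abs_mult mult_right_mono)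
        also have "weight M (H * (max g h * \<bar>of_int k\<bar>)) = ?v"
          by (intro antisym weight_mono) (auto simp: s_def abs_mult)
        finally show "weight M (g * of_int k) * weight M (h * of_int k) \<le> ennreal A * ?v" .
      qed auto
      also have "\<dots> = ennreal C * ennreal Q * ennreal A * (?v * inverse w)" by (simp add: mult_ac)
      also have "\<dots> \<le> ennreal C * ennreal Q * ennreal A * (ennreal A * inverse ?v)"
      proof (intro mult_left_mono ennreal_le_times_inverse)
        \<comment> \<open>One \<open>?v\<close> is the weight to be bounded; the second is reserved
          to make the sum over \<open>k\<close> converge.\<close>
        have "?v * ?v \<le> ennreal A * weight M (H * (s * \<bar>of_int k\<bar>))"
          using s by (intro weight_mult) (auto simp: abs_mult)
        also have "\<dots> \<le> ennreal A * w"
          unfolding w_def using s kR R(1)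
          by (intro mult_left_mono weight_mono) (auto simp: abs_mult mult_left_mono mult.assoc)
        finally have "?v * inverse w * ?v \<le> ennreal A * w * inverse w"
          by (metis mult.assoc mult.commute mult_right_mono zero_le)
        also have "\<dots> \<le> ennreal A"
          using mult_left_mono[OF ennreal_times_inverse_le, of "ennreal A" w] by (simp add: mult.assoc)
        finally show "?v * inverse w * ?v \<le> ennreal A" .
      qed auto
      also have "\<dots> = ?D * inverse ?v"
        using C(1) Q A_ge by (simp add: ennreal_mult mult.assoc)
      finally show ?thesis .
    qed
  next
    fix N
    show "(\<Sum>k\<in>{- int N..int N}. ?D * inverse (weight M (s * of_int k))) \<le> ?D * ennreal (1 + 4 * M 2 / s\<^sup>2)"
      unfolding sum_distrib_left[symmetric] by (intro mult_left_mono inverse_weight_sum s) simp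
  qed
qed (simp add: ennreal_mult_less_top)

lemma dual_estimate_echar:
  assumes "dual_estimate cls M f g" "g > 0"
  obtains Q where "Q > 0" "\<And>k. ennreal (cmod (f (echar k))) \<le> ennreal Q * weight M (g * of_int k)"
proof -
  obtain Q where Q: "Q > 0" "\<And>\<psi>. \<psi> \<in> ultra cls M \<Longrightarrow> ennreal (cmod (f \<psi>)) \<le> ennreal Q * unorm M g \<psi>"
    using assms(1) unfolding dual_estimate_def by blast
  have "ennreal (cmod (f (echar k))) \<le> ennreal Q * weight M (g * of_int k)" for k
    by (rule order_trans[OF Q(2)[OF ultra_echar[OF one]] mult_left_mono[OF unorm_echar_le[OF assms(2)]]]) simp
  then show thesis using Q(1) that by blast
qed

lemma moderate_conv:
  assumes f: "f \<in> ultra_dual cls M"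
  shows "(\<lambda>n. conv f (\<phi> n)) \<in> moderate cls M"
proof -
  have tl: "trig_linear f" by (rule trig_linear_ultra_dual[OF one f])
  show ?thesis
  proof (cases cls)
    case Beurling
    then obtain g where g: "g > 0" "dual_estimate cls M f g"
      using ultra_dual_estimate_Beurling f by auto
    obtain Q where Q: "Q > 0" "\<And>k. ennreal (cmod (f (echar k))) \<le> ennreal Q * weight M (g * of_int k)"
      using dual_estimate_echar[OF g(2,1)] by blast
    have "\<exists>\<mu>>0. wbounded M h (\<lambda>n. inverse (weight M (\<mu> * real n))) (\<lambda>n. conv f (\<phi> n))" if h: "h > 0" for h
      using wbounded_conv[OF tl g(1) h Q] g(1) R(1)
      by (intro exI[of _ "H * (H * max g h) * R"]) auto
    then show ?thesis
      using ultra_conv[OF tl] Beurling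
      unfolding moderate_def exp_ereal_uminus_assoc_fun SUP_less_top_iff wbounded_def[symmetric] by simp
  next
    case Roumieu
    have "\<exists>h>0. wbounded M h (\<lambda>n. inverse (weight M (\<mu> * real n))) (\<lambda>n. conv f (\<phi> n))" if \<mu>: "\<mu> > 0" for \<mu>
    proof -
      \<comment> \<open>A Roumieu functional is estimated at every scale, so its scale can equal
        that of the norm; the constant inverts the growth of scale in
        \<open>wbounded_conv\<close>.\<close>
      define h where "h = \<mu> / (H * H * R)"
      have h: "h > 0" "H * (H * max h h) * R = \<mu>"
        using \<mu> R(1) H_ge by (auto simp: h_def)
      have "dual_estimate cls M f h" using f Roumieu ultra_dual_estimate_Roumieu[OF _ h(1)] by simp
      then obtain Q where Q: "Q > 0" "\<And>k. ennreal (cmod (f (echar k))) \<le> ennreal Q * weight M (h * of_int k)"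
        using dual_estimate_echar[OF _ h(1)] by blast
      from wbounded_conv[OF tl h(1) h(1) Q] show ?thesis using h by auto
    qed
    then show ?thesis
      using ultra_conv[OF tl] Roumieu
      unfolding moderate_def exp_ereal_uminus_assoc_fun SUP_less_top_iff wbounded_def[symmetric] by simp
  qed
qed

text \<open>The coefficients of the difference are those of \<open>f\<close> times 2 pi c - 1, with
  c the mollifier coefficient; they vanish for |k| at most rn. Above that w(rsn) is at most w(sk),
  so three factors w(sk) are needed: for the norm, for the index weight and for summation. Two uses
  of \<open>weight_mult\<close> supply them from the norm at \<open>H * (H * s)\<close>.\<close>

lemma negligible_conv_dual_embed_diff:
  assumes f: "f \<in> ultra cls M"
  shows "(\<lambda>n t. conv (dual_embed cls M f) (\<phi> n) t - f t) \<in> negligible_seqs cls M"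
proof -
  have fs: "f \<in> smooth_periodic" by (rule ultra_smooth[OF f])
  note tl = trig_linear_dual_embed[OF one fs]
  define G where "G n t = conv (dual_embed cls M f) (\<phi> n) t - f t" for n t
  have Gu: "G n \<in> ultra cls M" for n
    unfolding G_def[abs_def] by (rule ultra_diff[OF ultra_conv[OF tl(1)] f])
  define D where "D = 1 + 2 * pi * C"
  have D: "D > 0" using C(1) by (simp add: D_def add_pos_nonneg)
  have Gk: "fourier_coeff (G n) k = (2 * pi * fourier_coeff (\<phi> n) k - 1) * fourier_coeff f k" for n k
  proof -
    have "fourier_coeff (\<lambda>t. 1 * conv (dual_embed cls M f) (\<phi> n) t + (-1) * f t) k
        = 1 * fourier_coeff (conv (dual_embed cls M f) (\<phi> n)) k + (-1) * fourier_coeff f k"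
      using fs ultra_smooth[OF ultra_conv[OF tl(1)]]
      by (intro fourier_coeff_lincomb) (auto simp: smooth_periodic_iff smooth_fun_continuous0)
    then show ?thesis by (simp add: G_def[abs_def] conv_coeff[OF tl(1)] tl(2) algebra_simps)
  qed
  have Gk_le: "cmod (fourier_coeff (G n) k) \<le> D * cmod (fourier_coeff f k)" for n k
  proof -
    have "cmod (2 * pi * fourier_coeff (\<phi> n) k - 1) \<le> cmod (2 * pi * fourier_coeff (\<phi> n) k) + cmod 1"
      by (rule norm_triangle_ineq4)
    also have "\<dots> \<le> D" using C(2)[of n k] by (simp add: D_def norm_mult)
    finally show ?thesis by (simp add: Gk norm_mult mult_right_mono)
  qed
  have key: "wbounded M s (\<lambda>n. weight M (r * s * real n)) G"
    if s: "s > 0" and fin: "unorm M (H * (H * s)) f < \<infinity>" for s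
  proof (rule wboundedI_ennreal)
    define Y where "Y = ennreal A * ennreal A * unorm M (H * (H * s)) f"
    have Y: "Y < \<infinity>" using fin by (auto simp: Y_def ennreal_mult_less_top)
    then show "ennreal D * Y * ennreal (1 + 4 * M 2 / s\<^sup>2) < \<infinity>" by (simp add: ennreal_mult_less_top)
    fix n
    show "unorm M s (G n) * weight M (r * s * real n) \<le> ennreal D * Y * ennreal (1 + 4 * M 2 / s\<^sup>2)"
    proof (rule unorm_fourier_leI[OF ultra_smooth[OF Gu] s])
      fix k :: int
      let ?v = "weight M (s * of_int k)" and ?x = "ennreal (cmod (fourier_coeff f k))"
      show "ennreal (cmod (fourier_coeff (G n) k)) * ?v * weight M (r * s * real n) \<le> ennreal D * Y * inverse ?v"
      proof (cases "\<bar>of_int k\<bar> \<le> r * real n")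
        case True
        then show ?thesis by (simp add: Gk r(2))
      next
        case False
        have "ennreal (cmod (fourier_coeff (G n) k)) * ?v * weight M (r * s * real n) \<le> ennreal D * ?x * ?v * ?v"
        proof (intro mult_mono)
          show "ennreal (cmod (fourier_coeff (G n) k)) \<le> ennreal D * ?x"
            using Gk_le[of n k] D by (simp add: ennreal_mult[symmetric] ennreal_leI)
          show "weight M (r * s * real n) \<le> ?v"
            using False s r(1) by (intro weight_mono) (auto simp: abs_mult mult.commute mult.left_commute)
        qed auto
        also have "\<dots> = ennreal D * (?x * ?v * ?v)" by (simp add: mult_ac)
        also have "\<dots> \<le> ennreal D * (Y * inverse ?v)"
        proof (intro mult_left_mono ennreal_le_times_inverse[OF _ Y])
          let ?u = "weight M (H * (s * \<bar>of_int k\<bar>))"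
          have "?v \<le> ?u" using s H_ge mult_right_mono[of 1 H "s * \<bar>of_int k\<bar>"]
            by (intro weight_mono) (auto simp: abs_mult)
          moreover have "?v * ?v \<le> ennreal A * ?u"
            using s by (intro weight_mult) (auto simp: abs_mult)
          \<comment> \<open>Two of the three factors merge at scale \<open>H * s\<close>; the third
            is enlarged to that scale so that both can be merged again.\<close>
          ultimately have "?v * ?v * ?v \<le> ennreal A * ?u * ?u" by (metis mult_mono zero_le)
          also have "\<dots> \<le> ennreal A * (ennreal A * weight M (H * (H * (s * \<bar>of_int k\<bar>))))"
            unfolding mult.assoc using s
            by (intro mult_left_mono weight_mult) (auto simp: abs_mult abs_of_pos[OF H_pos])
          also have "weight M (H * (H * (s * \<bar>of_int k\<bar>))) = weight M (H * (H * s) * of_int k)"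
            by (intro antisym weight_mono) (auto simp: abs_mult abs_of_pos[OF H_pos])
          finally have "?x * (?v * ?v * ?v) \<le> ?x * (ennreal A * (ennreal A * weight M (H * (H * s) * of_int k)))"
            by (rule mult_left_mono) simp
          also have "\<dots> = ennreal A * ennreal A * (?x * weight M (H * (H * s) * of_int k))" by (simp add: mult_ac)
          also have "\<dots> \<le> Y" unfolding Y_def using s by (intro mult_left_mono unorm_fourier_ge fs) auto
          finally show "?x * ?v * ?v * ?v \<le> Y" by (simp add: mult.assoc)
        qed auto
        finally show ?thesis by (simp add: mult.assoc)
      qed
    next
      fix N
      show "(\<Sum>k\<in>{- int N..int N}. ennreal D * Y * inverse (weight M (s * of_int k)))
        \<le> ennreal D * Y * ennreal (1 + 4 * M 2 / s\<^sup>2)"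
        unfolding sum_distrib_left[symmetric] by (intro mult_left_mono inverse_weight_sum s) simp
    qed
  qed
  have "for_scale cls (\<lambda>h. wbounded M h (\<lambda>n. weight M (h * real n)) G)"
    using f[unfolded ultra_iff]
  proof (rule for_scale_map[where c = "min 1 r / (H * H)"])
    show "min 1 r / (H * H) > 0" using r(1) by simp
    fix h' assume h': "h' > 0" "f \<in> ultra_h M h'"
    define s where "s = h' / (H * H)"
    have s: "s > 0" "H * (H * s) = h'" using h' H_ge by (auto simp: s_def)
    have eq: "min 1 r / (H * H) * h' = min 1 r * s" by (simp add: s_def)
    \<comment> \<open>\<open>key\<close> gives the norm at scale \<open>s\<close> and the weight at
      scale \<open>r * s\<close>; the minimum with 1 provides the single scale that
      \<open>negligible_iff\<close> asks for.\<close>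
    have le: "min 1 r * s \<le> s" "min 1 r * s \<le> r * s" "0 \<le> min 1 r * s"
      using s r(1) mult_right_mono[of "min 1 r" 1 s] by (auto intro: mult_right_mono)
    show "wbounded M (min 1 r / (H * H) * h') (\<lambda>n. weight M (min 1 r / (H * H) * h' * real n)) G"
      unfolding eq
      by (rule wbounded_antimono[OF key[OF s(1)] le(3,1) scaled_weight_mono[OF le(3,2)]])
        (use h' s in \<open>simp add: ultra_h_def\<close>)
  qed
  then have "G \<in> negligible_seqs cls M" using Gu by (simp add: negligible_iff)
  then show ?thesis by (simp add: G_def[abs_def])
qed

text \<open>As soon as rn exceeds |k|, the coefficient of the difference at \<open>k\<close> no
  longer depends on \<open>n\<close>. Negligibility at one scale bounds its product with w(hn), and
  the term p = 1 of the weight already grows linearly in \<open>n\<close>, which forces the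
  coefficient to vanish.\<close>

lemma negligible_conv_diff_imp_eq:
  assumes f: "trig_linear f" and g: "trig_linear g"
    and neg: "(\<lambda>n t. conv f (\<phi> n) t - conv g (\<phi> n) t) \<in> negligible_seqs cls M"
  shows "f (echar (- k)) = g (echar (- k))"
proof -
  define F where "F n t = conv f (\<phi> n) t - conv g (\<phi> n) t" for n t
  have Fs: "F n \<in> smooth_periodic" for n
    unfolding F_def[abs_def] by (intro smooth_periodic_sum2 ultra_smooth[OF ultra_conv] f g)
  have "for_scale cls (\<lambda>h. wbounded M h (\<lambda>n. weight M (h * real n)) F)"
    using neg by (simp add: negligible_iff F_def[abs_def])
  then have "\<exists>h>0. wbounded M h (\<lambda>n. weight M (h * real n)) F"
    by (cases cls) (simp_all, metis zero_less_one)
  then obtain h and B :: real where h: "h > 0" and B: "\<And>n. unorm M h (F n) * weight M (h * real n) \<le> ennreal B"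
    unfolding wbounded_def by blast
  define \<delta> where "\<delta> = cmod (f (echar (- k)) - g (echar (- k))) / (2 * pi)"
  have bnd: "\<delta> * (h * real n / M 1) \<le> \<bar>B\<bar>" if n: "\<bar>of_int k\<bar> \<le> r * real n" for n
  proof -
    have "fourier_coeff (\<lambda>t. 1 * conv f (\<phi> n) t + (-1) * conv g (\<phi> n) t) k
        = 1 * fourier_coeff (conv f (\<phi> n)) k + (-1) * fourier_coeff (conv g (\<phi> n)) k"
      using ultra_smooth[OF ultra_conv[OF f]] ultra_smooth[OF ultra_conv[OF g]]
      by (intro fourier_coeff_lincomb) (auto simp: smooth_periodic_iff smooth_fun_continuous0)
    then have "fourier_coeff (F n) k = (f (echar (- k)) - g (echar (- k))) / (2 * pi)"
      by (simp add: F_def[abs_def] conv_coeff f g r(2)[OF n] diff_divide_distrib)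
    then have \<delta>: "cmod (fourier_coeff (F n) k) = \<delta>" by (simp add: \<delta>_def norm_divide norm_mult)
    have "ennreal \<delta> * ennreal (\<bar>h * real n\<bar> ^ 1 / M 1) \<le> unorm M h (F n) * weight M (h * real n)"
    proof (intro mult_mono weight_ge)
      have "ennreal \<delta> * 1 \<le> ennreal \<delta> * weight M (h * of_int k)"
        by (intro mult_left_mono weight_ge_1) simp
      then show "ennreal \<delta> \<le> unorm M h (F n)"
        using unorm_fourier_ge[OF Fs h, of n k] \<delta> by simp
    qed auto
    also have "\<dots> \<le> ennreal \<bar>B\<bar>" by (rule order_trans[OF B]) (simp add: ennreal_leI)
    finally show ?thesis
      using h M_pos[of 1] by (simp add: ennreal_mult[symmetric] \<delta>_def)
  qed
  have "\<delta> = 0"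
  proof (rule ccontr)
    assume "\<delta> \<noteq> 0"
    then have \<delta>: "\<delta> > 0" by (simp add: \<delta>_def)
    \<comment> \<open>The first index makes the mollifier coefficient at \<open>k\<close> equal to
      \<open>1 / (2 * pi)\<close>, the second contradicts the bound.\<close>
    obtain n1 n2 :: nat where n1: "\<bar>of_int k\<bar> / r < real n1" and n2: "\<bar>B\<bar> * M 1 / (\<delta> * h) < real n2"
      using reals_Archimedean2 by meson
    define n where "n = max n1 n2"
    have "\<bar>of_int k\<bar> / r \<le> real n" using n1 by (simp add: n_def)
    then have "\<bar>of_int k\<bar> \<le> r * real n" using r(1) by (simp add: field_simps)
    moreover have "\<bar>B\<bar> * M 1 / (\<delta> * h) < real n" using n2 by (simp add: n_def)
    then have "\<bar>B\<bar> < \<delta> * (h * real n / M 1)" using \<delta> h M_pos[of 1] by (simp add: field_simps)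
    ultimately show False using bnd[of n] by simp
  qed
  then show ?thesis by (simp add: \<delta>_def)
qed

section \<open>Algebraic properties of the embedding\<close>

lemma gen_iota_add:
  assumes f: "f \<in> ultra_dual cls M" and g: "g \<in> ultra_dual cls M"
  shows "gen_iota cls M \<phi> (dual_add cls M f g)
    = gen_iota cls M \<phi> f \<oplus>\<^bsub>gen_alg cls M\<^esub> gen_iota cls M \<phi> g"
proof -
  have "conv (dual_add cls M f g) (\<phi> n) = (\<lambda>t. conv f (\<phi> n) t + conv g (\<phi> n) t)" for n
    by (simp add: conv_def dual_add_def shift_ultra fun_eq_iff)
  then show ?thesis by (simp add: gen_iota_def gen_class_add)
qed

lemma gen_iota_smult:
  assumes f: "f \<in> ultra_dual cls M"
  shows "gen_iota cls M \<phi> (dual_smult cls M c f) = gen_smult cls M c (gen_iota cls M \<phi> f)"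
proof -
  have "conv (dual_smult cls M c f) (\<phi> n) = (\<lambda>t. c * conv f (\<phi> n) t)" for n
    by (simp add: conv_def dual_smult_def shift_ultra fun_eq_iff)
  moreover have "gen_smult cls M c (gen_class cls M F) = gen_class cls M (\<lambda>n t. c * F n t)" for F
    unfolding gen_smult_def
  proof (rule gen_lift_gen_class)
    fix N assume "N \<in> negligible_seqs cls M"
    then show "(\<lambda>n t. c * (N n t + F n t) - c * F n t) \<in> negligible_seqs cls M"
      using negligible_lincomb[of N cls N c 0] by (simp add: algebra_simps)
  qed
  ultimately show ?thesis by (simp add: gen_iota_def)
qed

lemma inj_on_gen_iota: "inj_on (gen_iota cls M \<phi>) (ultra_dual cls M)"
proof (rule inj_onI)
  fix f g assume fg: "f \<in> ultra_dual cls M" "g \<in> ultra_dual cls M"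
    and "gen_iota cls M \<phi> f = gen_iota cls M \<phi> g"
  then have "(\<lambda>n t. conv f (\<phi> n) t - conv g (\<phi> n) t) \<in> negligible_seqs cls M"
    by (simp add: gen_iota_def gen_class_eq_iff)
  note * = negligible_conv_diff_imp_eq[OF trig_linear_ultra_dual[OF one fg(1)] trig_linear_ultra_dual[OF one fg(2)] this]
  show "f = g"
    by (rule ultra_dual_eqI[OF one fg]) (metis * minus_minus)
qed

text \<open>The two regularizations are the same trigonometric polynomial for each \<open>n\<close>,
  since both multiply the coefficient at \<open>k\<close> by P(k). Negligibility serves to apply
  P(D) to a class through any representative.\<close>

lemma gen_iota_ultradiff:
  assumes a: "ultradiff_coeffs cls M a" and f: "f \<in> ultra_dual cls M"
  shows "gen_ultradiff cls M a (gen_iota cls M \<phi> f) = gen_iota cls M \<phi> (dual_ultradiff cls M a f)"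
proof -
  have s: "summable (\<lambda>n. a n * z ^ n)" for z using a by (simp add: ultradiff_coeffs_def)
  have tl: "trig_linear f" by (rule trig_linear_ultra_dual[OF one f])
  note tl' = trig_linear_dual_ultradiff[OF one tl s]
  have eq: "ultradiff a (conv f (\<phi> n)) = conv (dual_ultradiff cls M a f) (\<phi> n)" for n
  proof
    fix t
    show "ultradiff a (conv f (\<phi> n)) t = conv (dual_ultradiff cls M a f) (\<phi> n) t"
      unfolding conv_eq[OF tl'(1)] conv_eq[OF tl] ultradiff_trig_poly[OF finite_freqs s] tl'(2)
      by (intro sum.cong refl) (simp only: mult_ac)
  qed
  have "gen_ultradiff cls M a (gen_class cls M (\<lambda>n. conv f (\<phi> n)))
      = gen_class cls M (\<lambda>n. ultradiff a (conv f (\<phi> n)))"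
    unfolding gen_ultradiff_def
  proof (rule gen_lift_gen_class)
    fix N assume N: "N \<in> negligible_seqs cls M"
    then have "ultradiff a (\<lambda>t. N n t + conv f (\<phi> n) t) t - ultradiff a (conv f (\<phi> n)) t = ultradiff a (N n) t" for n t
      using ultradiff_lincomb[OF a _ ultra_conv[OF tl], of "N n" 1 1] by (simp add: negligible_iff)
    then show "(\<lambda>n t. ultradiff a (\<lambda>t. N n t + conv f (\<phi> n) t) t - ultradiff a (conv f (\<phi> n)) t) \<in> negligible_seqs cls M"
      using negligible_ultradiff[OF a N] by simp
  qed
  then show ?thesis by (simp add: gen_iota_def eq)
qed

lemma gen_iota_dual_embed:
  assumes "f \<in> ultra cls M"
  shows "gen_iota cls M \<phi> (dual_embed cls M f) = gen_sigma cls M f"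
  unfolding gen_iota_def gen_sigma_def gen_class_eq_iff by (rule negligible_conv_dual_embed_diff[OF assms])

lemma gen_iota_dual_embed_mult:
  assumes "f \<in> ultra cls M" "g \<in> ultra cls M"
  shows "gen_iota cls M \<phi> (dual_embed cls M (\<lambda>t. f t * g t))
    = gen_iota cls M \<phi> (dual_embed cls M f) \<otimes>\<^bsub>gen_alg cls M\<^esub> gen_iota cls M \<phi> (dual_embed cls M g)"
  using gen_class_mult[OF bounded_seqs_const[OF assms(1)] bounded_seqs_const[OF assms(2)]]
  by (simp add: gen_iota_dual_embed assms ultra_mult gen_sigma_def)

lemma gen_iota_carrier:
  assumes "f \<in> ultra_dual cls M"
  shows "gen_iota cls M \<phi> f \<in> carrier (gen_alg cls M)"
  using moderate_conv[OF assms]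
  by (auto simp: gen_alg_def FactRing_def A_RCOSETS_def' gen_iota_def gen_class_def moderate_ring_def
      a_r_coset_def r_coset_def)

end

text \<open>By (M.1) the quotients of consecutive terms increase, so passing from \<open>q\<close>
  to \<open>q + 1\<close> multiplies the right side by at least as much as the left;
  \<open>M 0 = 1\<close> starts the induction.\<close>

lemma log_convex_supermult:
  assumes "\<forall>p. M p > 0" "M 0 = (1::real)" "cond_M1 M"
  shows "M p * M q \<le> M (p + q)"
proof -
  have step: "M (Suc q) / M q \<le> M (Suc (Suc q)) / M (Suc q)" for q
    using assms(1,3) unfolding cond_M1_def
    by (auto simp: divide_simps power2_eq_square mult.commute dest: spec[of _ "Suc q"])
  have ratio: "M (Suc q) / M q \<le> M (Suc (p + q)) / M (p + q)" for p q
    using lift_Suc_mono_le[of "\<lambda>q. M (Suc q) / M q", OF step, of q "p + q"] by simp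
  show ?thesis
  proof (induction q)
    case 0 then show ?case using assms(2) by simp
  next
    case (Suc q)
    have nz: "M n \<noteq> 0" "M n > 0" for n using assms(1) by (auto simp: less_imp_neq[symmetric])
    have "M p * M (Suc q) = (M p * M q) * (M (Suc q) / M q)" using nz by simp
    also have "\<dots> \<le> M (p + q) * (M (Suc (p + q)) / M (p + q))"
      using Suc ratio nz by (intro mult_mono) (auto simp: less_imp_le)
    also have "\<dots> = M (p + Suc q)" using nz by simp
    finally show ?case .
  qed
qed

theorem theorem3:
  fixes M :: "nat \<Rightarrow> real" and cls :: ultra_class
    and \<phi> :: "nat \<Rightarrow> real \<Rightarrow> complex"
  assumes "\<forall>p. M p > 0" and "M 0 = 1"
    and "cond_M1 M" and "cond_M2 M" and "cond_one cls M"
    and "mollifier \<phi>"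
  shows
    "(\<forall>f\<in>ultra_dual cls M. (\<lambda>n. conv f (\<phi> n)) \<in> moderate cls M)
     \<and> gen_iota cls M \<phi> \<in> ultra_dual cls M \<rightarrow> carrier (gen_alg cls M)
     \<and> (\<forall>f\<in>ultra_dual cls M. \<forall>g\<in>ultra_dual cls M.
          gen_iota cls M \<phi> (dual_add cls M f g)
            = gen_iota cls M \<phi> f \<oplus>\<^bsub>gen_alg cls M\<^esub> gen_iota cls M \<phi> g)
     \<and> (\<forall>c. \<forall>f\<in>ultra_dual cls M.
          gen_iota cls M \<phi> (dual_smult cls M c f) = gen_smult cls M c (gen_iota cls M \<phi> f))
     \<and> inj_on (gen_iota cls M \<phi>) (ultra_dual cls M)
     \<and> (\<forall>a. ultradiff_coeffs cls M a \<longrightarrow>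
          (\<forall>f\<in>ultra_dual cls M.
            gen_ultradiff cls M a (gen_iota cls M \<phi> f)
              = gen_iota cls M \<phi> (dual_ultradiff cls M a f)))
     \<and> (\<forall>f\<in>ultra cls M. gen_iota cls M \<phi> (dual_embed cls M f) = gen_sigma cls M f)
     \<and> (\<forall>f\<in>ultra cls M. \<forall>g\<in>ultra cls M.
          gen_iota cls M \<phi> (dual_embed cls M (\<lambda>t. f t * g t))
            = gen_iota cls M \<phi> (dual_embed cls M f)
              \<otimes>\<^bsub>gen_alg cls M\<^esub> gen_iota cls M \<phi> (dual_embed cls M g))"
proof -
  obtain A H where AH: "A \<ge> 1" "H \<ge> 1" "\<And>p q. M (p + q) \<le> A * H ^ (p + q) * M p * M q"
    using assms(4) unfolding cond_M2_def by blast
  obtain C R r where mol: "\<And>n. \<phi> n \<in> smooth_periodic"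
    "C > 0" "\<And>k n. cmod (fourier_coeff (\<phi> n) k) \<le> C"
    "R > 0" "\<And>n k. \<bar>of_int k\<bar> > R * real n \<Longrightarrow> fourier_coeff (\<phi> n) k = 0"
    "r > 0" "\<And>n k. \<bar>of_int k\<bar> \<le> r * real n \<Longrightarrow> fourier_coeff (\<phi> n) k = 1 / (2 * pi)"
    using assms(6) unfolding mollifier_def by blast
  interpret mollified M A H cls \<phi> C R r
    by unfold_locales (use assms(1,2,5) log_convex_supermult[OF assms(1-3)] AH mol in auto)
  show ?thesis
    using moderate_conv gen_iota_carrier gen_iota_add gen_iota_smult inj_on_gen_iota
      gen_iota_ultradiff gen_iota_dual_embed gen_iota_dual_embed_mult by blast
qed

end
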